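(* Let $\lambda$ be a nonempty partition, $\phi$ a flag compatible with $\lambda$, and $\rho\subseteq\lambda$ a partition with $j^{\lambda,\phi}_\rho(\beta;\mathbf{y})\neq 0$. Let $q$ be the largest integer such that $(q,q)$ is a cell of $\lambda$. Then at least one of the following holds (both may hold): (Case 1) If $\phi_q\le 0$, then $j^{\lambda,\phi}_\rho(\beta;\mathbf{y})$ is a sum of products, each a power of $\beta$ times a product of Type 2 and Type 3 terms, in which every Type 2 term appears at most once and every Type 3 term appears at most twice. (Case 2) If $\phi_q\ge 0$, then $j^{\lambda,\phi}_\rho(\beta;\mathbf{y})$ is a sum of products, each a power of $\beta$ times a product of Type 1 and Type 3 terms, in which every Type 1 term appears at most once and every Type 3 term appears at most twice.
   Context: $\beta$ is an indeterminate, $\mathbf{x}=(x_i)_{i\in\mathbb{Z}}$, $\mathbf{y}=(y_i)_{i\in\mathbb{Z}}$, $\mathbf{x}_-=(x_i)_{i\le0}$; $a\ominus b=\frac{a-b}{1+\beta b}$; $R(\beta;\mathbf{x};\mathbf{y})=\mathbb{Z}(\beta)[x_i,y_i,\frac1{1+\beta x_i},\frac1{1+\beta y_i}]$. Partitions are Young diagrams in matrix coordinates $(r,c)$. A set-valued tableau of shape $\lambda/\mu$ assigns a nonempty finite subset of $\mathbb{Z}$ to each cell; semistandard means $\max T(r,c)\le\min T(r,c+1)$ and $\max T(r,c)<\min T(r+1,c)$ when the cells exist; weight $\mathrm{wt}(T)=\beta^{-|\lambda/\mu|}\prod_{(r,c)}\prod_{i\in T(r,c)}\beta(x_i\ominus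 y_{i+c-r})$. A flag for $\lambda$ is a weakly increasing integer sequence $\phi=(\phi_1\le\dots\le\phi_{\ell(\lambda)})$; it is compatible with $\lambda$ if $\phi_{i+1}-\phi_i\le\lambda_i-\lambda_{i+1}+1$ for $1\le i<\ell(\lambda)$. $G^\phi_\lambda(\beta;\mathbf{x};\mathbf{y})=\sum\mathrm{wt}(T)$ over semistandard set-valued $T$ of shape $\lambda$ with $\max T(r,c)\le\phi_r$; $G_\mu(\beta;\mathbf{x}_-;\mathbf{y})=\sum\mathrm{wt}(T)$ over semistandard set-valued $T$ of shape $\mu$ with all entries $\le 0$. For compatible $\lambda,\phi$ there is a unique expansion $G^\phi_\lambda(\beta;\mathbf{x};\mathbf{y})=\sum_\mu a^{\lambda,\phi}_\mu(\beta;\mathbf{x};\mathbf{y})G_\mu(\beta;\mathbf{x}_-;\mathbf{y})$ with $a^{\lambda,\phi}_\mu\in R(\beta;\mathbf{x};\mathbf{y})$; $j^{\lambda,\phi}_\mu(\beta;\mathbf{y})$ is $a^{\lambda,\phi}_\mu$ with $x_i\mapsto y_i$. Types of $y_i\ominus y_j$: Type 1: $0<i<j$; Type 2: $i<j\le0$; Type 3: $j\le 0<i$. *)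

theory Defs
  imports "HOL-Library.Multiset" "HOL-Computational_Algebra.Polynomial"
    "HOL-Computational_Algebra.Fraction_Field"
begin

section \<open>Formal power series in arbitrarily many variables\<close>

text \<open>
  A monomial in variables of type \<open>'v\<close> is a finite multiset of variables; a formal power series
  is an arbitrary family of coefficients.  The sums over infinitely many tableaux converge
  coefficientwise in this ring (not in a polynomial ring: \<open>\<Sum>\<^sub>i\<^sub>\<le>\<^sub>0 (x\<^sub>i - y\<^sub>i)\<close> already has infinitely
  many terms of degree one).
\<close>

typedef ('v, 'a) mfps = "UNIV :: ('v multiset \<Rightarrow> 'a) set"
  morphisms mcoeff Abs_mfps by simp

setup_lifting type_definition_mfps

lemma mfps_eqI: "(\<And>m. mcoeff f m = mcoeff g m) \<Longrightarrow> f = g"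
  by (metis ext mcoeff_inject)

lemma finite_submultisets: "finite {p. p \<subseteq># (m :: 'v multiset)}"
proof (induction m)
  case (add a m)
  have "{p. p \<subseteq># add_mset a m} \<subseteq> {p. p \<subseteq># m} \<union> add_mset a ` {p. p \<subseteq># m}"
  proof
    fix p assume p: "p \<in> {p. p \<subseteq># add_mset a m}"
    show "p \<in> {p. p \<subseteq># m} \<union> add_mset a ` {p. p \<subseteq># m}"
    proof (cases "a \<in># p")
      case True
      then obtain p' where "p = add_mset a p'" by (metis multi_member_split)
      with p show ?thesis by auto
    next
      case False
      with p have "p \<subseteq># m"
        by (metis diff_single_trivial mem_Collect_eq subset_eq_diff_conv add_mset_add_single)
      then show ?thesis by auto
    qed
  qed
  then show ?case using add.IH by (meson finite_Un finite_imageI finite_subset)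
qed simp

instantiation mfps :: (type, comm_ring_1) comm_ring_1
begin

lift_definition zero_mfps :: "('a, 'b) mfps" is "\<lambda>_. 0" .
lift_definition one_mfps :: "('a, 'b) mfps" is "\<lambda>m. if m = {#} then 1 else 0" .
lift_definition plus_mfps :: "('a, 'b) mfps \<Rightarrow> ('a, 'b) mfps \<Rightarrow> ('a, 'b) mfps"
  is "\<lambda>f g m. f m + g m" .
lift_definition minus_mfps :: "('a, 'b) mfps \<Rightarrow> ('a, 'b) mfps \<Rightarrow> ('a, 'b) mfps"
  is "\<lambda>f g m. f m - g m" .
lift_definition uminus_mfps :: "('a, 'b) mfps \<Rightarrow> ('a, 'b) mfps"
  is "\<lambda>f m. - f m" .
lift_definition times_mfps :: "('a, 'b) mfps \<Rightarrow> ('a, 'b) mfps \<Rightarrow> ('a, 'b) mfps"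
  is "\<lambda>f g m. \<Sum>p | p \<subseteq># m. f p * g (m - p)" .

instance
proof
  fix f g h :: "('a, 'b) mfps"
  show "f * g * h = f * (g * h)"
  proof (rule mfps_eqI)
    fix m
    have "mcoeff (f * g * h) m =
        (\<Sum>(s, p) \<in> (SIGMA s:{s. s \<subseteq># m}. {p. p \<subseteq># s}).
           mcoeff f p * mcoeff g (s - p) * mcoeff h (m - s))"
      by (simp add: times_mfps.rep_eq sum_distrib_right sum.Sigma finite_submultisets)
    also have "\<dots> =
        (\<Sum>(p, r) \<in> (SIGMA p:{p. p \<subseteq># m}. {r. r \<subseteq># m - p}).
           mcoeff f p * (mcoeff g r * mcoeff h (m - p - r)))"
      by (rule sum.reindex_bij_witness
          [where j = "\<lambda>(s, p). (p, s - p)" and i = "\<lambda>(p, r). (p + r, p)"])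
        (auto simp: mult.assoc subset_mset.le_diff_conv2 add.commute diff_diff_add_mset
          intro: subset_mset.order_trans elim: subset_mset.order_trans
          dest: subset_mset.add_diff_inverse)
    also have "\<dots> = mcoeff (f * (g * h)) m"
      by (simp add: times_mfps.rep_eq sum_distrib_left sum.Sigma finite_submultisets)
    finally show "mcoeff (f * g * h) m = mcoeff (f * (g * h)) m" .
  qed
  show "f * g = g * f"
  proof (rule mfps_eqI)
    fix m
    show "mcoeff (f * g) m = mcoeff (g * f) m"
      unfolding times_mfps.rep_eq
      by (rule sum.reindex_bij_witness[where j = "\<lambda>p. m - p" and i = "\<lambda>p. m - p"])
        (auto simp: mult.commute subset_mset.diff_diff_right)
  qed
  show "1 * f = f"
  proof (rule mfps_eqI)
    fix m
    have "mcoeff (1 * f) m = (\<Sum>p | p \<subseteq># m. if p = {#} then mcoeff f m else 0)"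
      unfolding times_mfps.rep_eq one_mfps.rep_eq by (rule sum.cong) auto
    also have "\<dots> = mcoeff f m" by (simp add: finite_submultisets)
    finally show "mcoeff (1 * f) m = mcoeff f m" .
  qed
  show "(f + g) * h = f * h + g * h"
    by (rule mfps_eqI) (simp add: times_mfps.rep_eq plus_mfps.rep_eq distrib_right sum.distrib)
  show "f + g + h = f + (g + h)" by transfer (simp add: add.assoc)
  show "f + g = g + f" by transfer (simp add: add.commute)
  show "0 + f = f" by transfer simp
  show "- f + f = 0" by transfer simp
  show "f - g = f + - g" by transfer simp
  show "(0 :: ('a, 'b) mfps) \<noteq> 1" by transfer (auto dest: fun_cong[where x = "{#}"])
qed

end

definition mconst :: "'a::zero \<Rightarrow> ('v, 'a) mfps"
  where "mconst c = Abs_mfps (\<lambda>m. if m = {#} then c else 0)"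

definition mvar :: "'v \<Rightarrow> ('v, 'a::zero_neq_one) mfps"
  where "mvar v = Abs_mfps (\<lambda>m. if m = {#v#} then 1 else 0)"

text \<open>
  Coefficientwise sum of a family of series.  It is meaningful for families in which every
  monomial occurs in only finitely many members, as all families below.
\<close>

definition mfps_sum :: "('i \<Rightarrow> ('v, 'a::comm_monoid_add) mfps) \<Rightarrow> 'i set \<Rightarrow> ('v, 'a) mfps"
  where "mfps_sum f I = Abs_mfps (\<lambda>m. \<Sum>i | i \<in> I \<and> mcoeff (f i) m \<noteq> 0. mcoeff (f i) m)"

definition recip :: "'r::comm_ring_1 \<Rightarrow> 'r"
  where "recip f = (THE g. f * g = 1)"


section \<open>The coefficient ring\<close>

datatype var = X int | Y int

type_synonym ratbeta = "int poly fract"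

type_synonym series = "(var, ratbeta) mfps"

definition beta0 :: ratbeta
  where "beta0 = Fract [:0, 1:] 1"

definition beta :: series
  where "beta = mconst beta0"

definition xvar :: "int \<Rightarrow> series"
  where "xvar i = mvar (X i)"

definition yvar :: "int \<Rightarrow> series"
  where "yvar i = mvar (Y i)"

definition ominus :: "series \<Rightarrow> series \<Rightarrow> series"
  where "ominus a b = (a - b) * recip (1 + beta * b)"

text \<open>
  The ring \<open>\<int>(\<beta>)[x\<^sub>i, y\<^sub>i, 1/(1+\<beta>x\<^sub>i), 1/(1+\<beta>y\<^sub>i)]\<close>, as a subring of the power series ring.
\<close>

inductive_set coeff_ring :: "series set" where
  const: "mconst c \<in> coeff_ring"
| xvar: "xvar i \<in> coeff_ring"
| yvar: "yvar i \<in> coeff_ring"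
| recip_x: "recip (1 + beta * xvar i) \<in> coeff_ring"
| recip_y: "recip (1 + beta * yvar i) \<in> coeff_ring"
| add: "f \<in> coeff_ring \<Longrightarrow> g \<in> coeff_ring \<Longrightarrow> f + g \<in> coeff_ring"
| mult: "f \<in> coeff_ring \<Longrightarrow> g \<in> coeff_ring \<Longrightarrow> f * g \<in> coeff_ring"

text \<open>
  The substitution \<open>x\<^sub>i \<mapsto> y\<^sub>i\<close>: the coefficient of a monomial \<open>m\<close> is the sum of the coefficients
  of the finitely many monomials that become \<open>m\<close>.
\<close>

fun x_to_y_var :: "var \<Rightarrow> var" where
  "x_to_y_var (X i) = Y i"
| "x_to_y_var (Y i) = Y i"

definition x_to_y :: "series \<Rightarrow> series"
  where "x_to_y f = Abs_mfps (\<lambda>m. \<Sum>p | image_mset x_to_y_var p = m. mcoeff f p)"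


section \<open>Partitions, flags and set-valued tableaux\<close>

text \<open>
  A partition is the list of its positive parts; \<open>\<lambda>\<^sub>r\<close> is \<open>lam ! (r - 1)\<close>, and likewise for flags.
\<close>

definition is_partition :: "nat list \<Rightarrow> bool"
  where "is_partition lam \<longleftrightarrow> sorted_wrt (\<ge>) lam \<and> 0 \<notin> set lam"

definition cells :: "nat list \<Rightarrow> (nat \<times> nat) set"
  where "cells lam = {(r, c). 1 \<le> r \<and> r \<le> length lam \<and> 1 \<le> c \<and> c \<le> lam ! (r - 1)}"

definition is_flag :: "nat list \<Rightarrow> int list \<Rightarrow> bool"
  where "is_flag lam \<phi> \<longleftrightarrow> length \<phi> = length lam \<and> sorted \<phi>"

definition compatible :: "nat list \<Rightarrow> int list \<Rightarrow> bool"
  where "compatible lam \<phi> \<longleftrightarrow>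
    (\<forall>i. 1 \<le> i \<and> i < length lam \<longrightarrow>
      \<phi> ! i - \<phi> ! (i - 1) \<le> int (lam ! (i - 1)) - int (lam ! i) + 1)"

text \<open>
  Tableaux are made extensional by assigning the empty set to all positions outside the shape.
\<close>

definition ssvt :: "(nat \<times> nat) set \<Rightarrow> (nat \<times> nat \<Rightarrow> int set) set"
  where "ssvt D = {T.
    (\<forall>u \<in> D. finite (T u) \<and> T u \<noteq> {}) \<and>
    (\<forall>u. u \<notin> D \<longrightarrow> T u = {}) \<and>
    (\<forall>r c. (r, c) \<in> D \<longrightarrow> (r, c + 1) \<in> D \<longrightarrow> Max (T (r, c)) \<le> Min (T (r, c + 1))) \<and>
    (\<forall>r c. (r, c) \<in> D \<longrightarrow> (r + 1, c) \<in> D \<longrightarrow> Max (T (r, c)) < Min (T (r + 1, c)))}"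

definition wt :: "(nat \<times> nat) set \<Rightarrow> (nat \<times> nat \<Rightarrow> int set) \<Rightarrow> series"
  where "wt D T = mconst (inverse beta0 ^ card D) *
    (\<Prod>(r, c) \<in> D. \<Prod>i \<in> T (r, c). beta * ominus (xvar i) (yvar (i + int c - int r)))"

definition G_flagged :: "nat list \<Rightarrow> int list \<Rightarrow> series"
  where "G_flagged lam \<phi> = mfps_sum (wt (cells lam))
    {T \<in> ssvt (cells lam). \<forall>(r, c) \<in> cells lam. Max (T (r, c)) \<le> \<phi> ! (r - 1)}"

definition G_minus :: "nat list \<Rightarrow> series"
  where "G_minus \<mu> = mfps_sum (wt (cells \<mu>))
    {T \<in> ssvt (cells \<mu>). \<forall>u \<in> cells \<mu>. \<forall>i \<in> T u. i \<le> 0}"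


section \<open>The expansion coefficients\<close>

text \<open>
  Every monomial of \<^term>\<open>G_minus \<mu>\<close> has degree at least \<open>|\<mu>|\<close>, so the sum over all \<open>\<mu>\<close> is
  coefficientwise finite without a finiteness condition on \<open>a\<close>.
\<close>

definition is_expansion :: "nat list \<Rightarrow> int list \<Rightarrow> (nat list \<Rightarrow> series) \<Rightarrow> bool"
  where "is_expansion lam \<phi> a \<longleftrightarrow>
    (\<forall>\<mu>. a \<mu> \<in> coeff_ring) \<and> (\<forall>\<mu>. \<not> is_partition \<mu> \<longrightarrow> a \<mu> = 0) \<and>
    G_flagged lam \<phi> = mfps_sum (\<lambda>\<mu>. a \<mu> * G_minus \<mu>) {\<mu>. is_partition \<mu>}"

definition a_coeff :: "nat list \<Rightarrow> int list \<Rightarrow> nat list \<Rightarrow> series"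
  where "a_coeff lam \<phi> = (THE a. is_expansion lam \<phi> a)"

definition j_coeff :: "nat list \<Rightarrow> int list \<Rightarrow> nat list \<Rightarrow> series"
  where "j_coeff lam \<phi> \<mu> = x_to_y (a_coeff lam \<phi> \<mu>)"


section \<open>Positivity\<close>

text \<open>The pair \<open>(i, j)\<close> stands for the term \<open>y\<^sub>i \<ominus> y\<^sub>j\<close>.\<close>

definition type1 :: "int \<times> int \<Rightarrow> bool"
  where "type1 = (\<lambda>(i, j). 0 < i \<and> i < j)"

definition type2 :: "int \<times> int \<Rightarrow> bool"
  where "type2 = (\<lambda>(i, j). i < j \<and> j \<le> 0)"

definition type3 :: "int \<times> int \<Rightarrow> bool"
  where "type3 = (\<lambda>(i, j). j \<le> 0 \<and> 0 < i)"

text \<open>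
  \<open>(k, M)\<close> encodes the product \<open>\<beta>\<^sup>k \<Prod>\<^sub>(\<^sub>i\<^sub>,\<^sub>j\<^sub>)\<^sub>\<in>\<^sub>M (y\<^sub>i \<ominus> y\<^sub>j)\<close>.  In \<open>positive_sum once twice f\<close>, the
  factors of each summand satisfy \<open>once\<close> or \<open>twice\<close>, with the multiplicity bound 1 or 2.
\<close>

definition product_value :: "nat \<times> (int \<times> int) multiset \<Rightarrow> series"
  where "product_value = (\<lambda>(k, M). beta ^ k * (\<Prod>(i, j) \<in># M. ominus (yvar i) (yvar j)))"

definition admissible ::
    "(int \<times> int \<Rightarrow> bool) \<Rightarrow> (int \<times> int \<Rightarrow> bool) \<Rightarrow> (int \<times> int) multiset \<Rightarrow> bool"
  where "admissible once twice M \<longleftrightarrow>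
    (\<forall>p \<in># M. (once p \<and> count M p \<le> 1) \<or> (twice p \<and> count M p \<le> 2))"

definition positive_sum ::
    "(int \<times> int \<Rightarrow> bool) \<Rightarrow> (int \<times> int \<Rightarrow> bool) \<Rightarrow> series \<Rightarrow> bool"
  where "positive_sum once twice f \<longleftrightarrow>
    (\<exists>ts :: (nat \<times> (int \<times> int) multiset) list.
       (\<forall>(k, M) \<in> set ts. admissible once twice M) \<and> f = (\<Sum>t \<leftarrow> ts. product_value t))"

definition durfee :: "nat list \<Rightarrow> nat"
  where "durfee lam = Max {q. (q, q) \<in> cells lam}"

end

theory Submission
  imports Defs "HOL-Combinatorics.Permutations"
begin

text \<open>
  Deleting or lowering the entry of a corner cell of a tableau gives, for flagged Grothendieck functions,
  the recursion \<open>G B = (1 + \<beta> w) G B' + w G B''\<close> with \<open>w = x\<^sub>i \<ominus> y\<^sub>j\<close>, where \<open>B'\<close> lowers the bound of the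
  corner by one and \<open>B''\<close> removes the corner.  Hence expansions exist (they are unique by comparing
  leading monomials), and after \<open>x\<^sub>i \<mapsto> y\<^sub>i\<close> their coefficients obey the same recursion with weights
  \<open>y\<^sub>i \<ominus> y\<^sub>j\<close>.  These vanish on the diagonal, so the cells right of the diagonal and the cells below it
  can be treated one after the other.

  On either side a state is a nested chain of intervals of labels, and the recursion moves these
  intervals to the intervals of the target, one step at a time.  If the intervals reach the boundary
  between nonpositive and positive labels, every step has a weight of the required type, and no weight
  is used twice.  Otherwise all weights could have the wrong sign; but the recursion is also satisfied by
  alternants with rows \<open>(1 + \<beta> u)\<^sup>i \<Prod> (u \<ominus> y\<^sub>b)\<close>, which only depend on the sets of labels, so that labels of
  one sign may be permuted until the intervals reach the boundary.  A term of Type 3 can thus occur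
  once for each side of the diagonal.
\<close>

section \<open>Exchange systems\<close>

text \<open>On the arm side, interval \<open>i\<close> starts after the flag bound of row
  \<open>i\<close> and ends at flag bound plus row length minus \<open>i\<close>; weak decrease of
  the right ends is exactly compatibility of the flag. The obstacle is an interval ending at a
  negative label. Raising it costs \<open>y_a\<close> ominus \<open>y_b\<close> with b < a <= 0,
  which belongs to none of the three types. Relabelling repairs this, but it has no meaning for
  tableaux. Therefore expansion coefficients are required to work for all solutions of the exchange
  rules at once. Tableaux give the solutions of interest; alternants give solutions that tolerate
  relabelling and are independent enough at the target to determine every coefficient. A positive
  formula obtained for relabelled alternants is then a formula for the original coefficients. The
  factors \<open>(1 + \<beta> u)^i\<close> in the alternants serve the moves that carry no weight:
  they turn the effect of such a move on row i into a multiple of row i + 1.\<close>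

definition nested :: "nat \<Rightarrow> (nat \<Rightarrow> nat) \<Rightarrow> (nat \<Rightarrow> int) \<Rightarrow> bool"
  where "nested q k p \<longleftrightarrow> (\<forall>i. 1 \<le> i \<and> i < q \<longrightarrow>
    k (Suc i) < k i \<and> p i \<le> p (Suc i) \<and> p (Suc i) + int (k (Suc i)) \<le> p i + int (k i))"

text \<open>Pinning \<open>m\<close> to \<open>k\<close> outside \<open>{1..q}\<close> makes the set
  finite and lets shapes be compared as functions.\<close>

definition smaller_shapes :: "nat \<Rightarrow> (nat \<Rightarrow> nat) \<Rightarrow> (nat \<Rightarrow> nat) set"
  where "smaller_shapes q k = {m. (\<forall>i. if i \<in> {1..q} then m i \<le> k i else m i = k i) \<and>
    (\<forall>i. 1 \<le> i \<and> i < q \<longrightarrow> m (Suc i) < m i)}"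

text \<open>Label \<open>p r + 1\<close> leaves interval \<open>r\<close> and label
  \<open>p r + int (k r) + 1\<close> enters it. The moves without weight are those where shortening
  the interval would destroy the strict decrease of \<open>k\<close> or make a length
  negative.\<close>

definition exchange_rules ::
    "'r::comm_ring_1 \<Rightarrow> (int \<Rightarrow> int \<Rightarrow> 'r) \<Rightarrow> nat \<Rightarrow> ((nat \<Rightarrow> nat) \<Rightarrow> (nat \<Rightarrow> int) \<Rightarrow> 'r) \<Rightarrow> bool"
  where "exchange_rules \<beta> e q F \<longleftrightarrow>
    (\<forall>k p p'. (\<forall>i \<in> {1..q}. p i = p' i) \<longrightarrow> F k p = F k p') \<and>
    (\<forall>k p r. nested q k p \<longrightarrow> nested q k (p(r := p r + 1)) \<longrightarrow> r \<in> {1..q} \<longrightarrow>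
      F k (p(r := p r + 1)) =
        (if r < q \<and> k r = Suc (k (Suc r)) \<or> r = q \<and> k q = 0 then F k p
         else (1 + \<beta> * e (p r + 1) (p r + int (k r) + 1)) * F k p
            + e (p r + 1) (p r + int (k r) + 1) * F (k(r := k r - 1)) (p(r := p r + 1))))"

text \<open>Sets of pairs instead of multisets: within a summand no weight repeats, which is the
  multiplicity bound for one side of the diagonal.\<close>

definition positive_span ::
    "'r::comm_ring_1 \<Rightarrow> (int \<Rightarrow> int \<Rightarrow> 'r) \<Rightarrow> (int \<times> int) set \<Rightarrow> 'r set"
  where "positive_span \<beta> e A = {x. \<exists>ts :: (nat \<times> (int \<times> int) set) list.
    (\<forall>(n, S) \<in> set ts. finite S \<and> S \<subseteq> A) \<and>
    x = (\<Sum>(n, S) \<leftarrow> ts. \<beta> ^ n * (\<Prod>(a, b) \<in> S. e a b))}"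

text \<open>One family \<open>C\<close> serves all solutions \<open>F\<close>, so it can be
  determined on alternants and applied to tableaux. The flag \<open>pos\<close> lets a single
  induction yield existence always and positivity under a condition.\<close>

definition expands ::
    "bool \<Rightarrow> 'r::comm_ring_1 \<Rightarrow> (int \<Rightarrow> int \<Rightarrow> 'r) \<Rightarrow> nat \<Rightarrow> (nat \<Rightarrow> nat) \<Rightarrow> (nat \<Rightarrow> int) \<Rightarrow>
      (int \<times> int) set \<Rightarrow> ((nat \<Rightarrow> nat) \<Rightarrow> 'r) \<Rightarrow> bool"
  where "expands pos \<beta> e q k p A C \<longleftrightarrow>
    (\<forall>m. m \<notin> smaller_shapes q k \<longrightarrow> C m = 0) \<and>
    (pos \<longrightarrow> (\<forall>m. C m \<in> positive_span \<beta> e A)) \<and>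
    (\<forall>F. exchange_rules \<beta> e q F \<longrightarrow>
      F k p = (\<Sum>m \<in> smaller_shapes q k. C m * F m (\<lambda>_. 0)))"

lemma finite_smaller_shapes: "finite (smaller_shapes q k)"
proof -
  have "smaller_shapes q k \<subseteq>
      (\<lambda>f i. if i \<in> {1..q} then f i else k i) ` (\<Pi>\<^sub>E i \<in> {1..q}. {..k i})"
  proof
    fix m assume m: "m \<in> smaller_shapes q k"
    show "m \<in> (\<lambda>f i. if i \<in> {1..q} then f i else k i) ` (\<Pi>\<^sub>E i \<in> {1..q}. {..k i})"
    proof (rule image_eqI)
      show "restrict m {1..q} \<in> (\<Pi>\<^sub>E i \<in> {1..q}. {..k i})"
        using m by (auto simp: smaller_shapes_def)
      show "m = (\<lambda>i. if i \<in> {1..q} then restrict m {1..q} i else k i)"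
        using m by (auto simp: smaller_shapes_def fun_eq_iff)
    qed
  qed
  then show ?thesis by (rule finite_subset) (intro finite_imageI finite_PiE; simp)
qed

lemma smaller_shapes_decrease:
  assumes "r \<in> {1..q}"
  shows "smaller_shapes q (k(r := k r - 1)) \<subseteq> smaller_shapes q k"
proof
  fix m assume m: "m \<in> smaller_shapes q (k(r := k r - 1))"
  have *: "if i \<in> {1..q} then m i \<le> (k(r := k r - 1)) i else m i = (k(r := k r - 1)) i" for i
    using m unfolding smaller_shapes_def by blast
  have "if i \<in> {1..q} then m i \<le> k i else m i = k i" for i
    using *[of i] assms by (cases "i = r") (auto split: if_splits)
  then show "m \<in> smaller_shapes q k"
    using m by (simp add: smaller_shapes_def)
qed

lemma positive_span_0: "0 \<in> positive_span \<beta> e A"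
  unfolding positive_span_def by (rule CollectI, rule exI[where x = "[]"]) simp

lemma positive_span_1: "1 \<in> positive_span \<beta> e A"
  unfolding positive_span_def by (rule CollectI, rule exI[where x = "[(0, {})]"]) simp

lemma positive_span_add:
  assumes "x \<in> positive_span \<beta> e A" "y \<in> positive_span \<beta> e A"
  shows "x + y \<in> positive_span \<beta> e A"
proof -
  obtain ts us where "\<forall>(n, S) \<in> set ts. finite S \<and> S \<subseteq> A"
    "x = (\<Sum>(n, S) \<leftarrow> ts. \<beta> ^ n * (\<Prod>(a, b) \<in> S. e a b))"
    "\<forall>(n, S) \<in> set us. finite S \<and> S \<subseteq> A"
    "y = (\<Sum>(n, S) \<leftarrow> us. \<beta> ^ n * (\<Prod>(a, b) \<in> S. e a b))"
    using assms unfolding positive_span_def by blast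
  then show ?thesis
    unfolding positive_span_def by (intro CollectI exI[where x = "ts @ us"]) auto
qed

lemma positive_span_mono: "A \<subseteq> B \<Longrightarrow> positive_span \<beta> e A \<subseteq> positive_span \<beta> e B"
  unfolding positive_span_def by fastforce

text \<open>The new pair has to lie outside \<open>A\<close>: then no \<open>S\<close> contains it,
  and inserting it multiplies the product by exactly one new factor.\<close>

lemma positive_span_mult:
  assumes x: "x \<in> positive_span \<beta> e A" and ab: "(a, b) \<in> B" "(a, b) \<notin> A" and AB: "A \<subseteq> B"
  shows "\<beta> ^ n * e a b * x \<in> positive_span \<beta> e B"
proof -
  obtain ts where ts: "\<forall>(n, S) \<in> set ts. finite S \<and> S \<subseteq> A"
    "x = (\<Sum>(n, S) \<leftarrow> ts. \<beta> ^ n * (\<Prod>(a, b) \<in> S. e a b))"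
    using x unfolding positive_span_def by blast
  let ?us = "map (\<lambda>(m, S). (n + m, insert (a, b) S)) ts"
  have "\<beta> ^ n * e a b * x = (\<Sum>(m, S) \<leftarrow> ?us. \<beta> ^ m * (\<Prod>(a, b) \<in> S. e a b))"
    unfolding ts(2) sum_list_const_mult[symmetric] map_map
  proof (intro arg_cong[where f = sum_list] map_cong refl)
    fix t assume t: "t \<in> set ts"
    obtain m S where mS: "t = (m, S)" by force
    have "finite S" "(a, b) \<notin> S" using ts(1) t ab mS by auto
    then show "\<beta> ^ n * e a b * (case t of (m, S) \<Rightarrow> \<beta> ^ m * (\<Prod>(a, b) \<in> S. e a b)) =
        ((\<lambda>(m, S). \<beta> ^ m * (\<Prod>(a, b) \<in> S. e a b)) \<circ> (\<lambda>(m, S). (n + m, insert (a, b) S))) t"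
      by (simp add: mS power_add ac_simps)
  qed
  moreover have "\<forall>(n, S) \<in> set ?us. finite S \<and> S \<subseteq> B"
    using ts(1) ab AB by fastforce
  ultimately show ?thesis
    unfolding positive_span_def by blast
qed

lemma expands_same:
  assumes "expands pos \<beta> e q k p1 A1 C" "pos \<Longrightarrow> A1 \<subseteq> A"
    and "\<And>F. exchange_rules \<beta> e q F \<Longrightarrow> F k p = F k p1"
  shows "expands pos \<beta> e q k p A C"
  using assms positive_span_mono[of A1 A] unfolding expands_def by (metis subset_iff)

text \<open>The pair \<open>(a, b)\<close> is fresh for both successor states, so all products stay
  squarefree; the coefficients of the smaller shape \<open>k2\<close> extend by zero.\<close>

lemma expands_step:
  assumes 1: "expands pos \<beta> e q k p1 A1 C1" and 2: "expands pos \<beta> e q k2 p2 A2 C2"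
    and K: "smaller_shapes q k2 \<subseteq> smaller_shapes q k"
    and A: "pos \<Longrightarrow> A1 \<subseteq> A \<and> A2 \<subseteq> A \<and> (a, b) \<in> A - A1 - A2"
    and F: "\<And>F. exchange_rules \<beta> e q F \<Longrightarrow> F k p = (1 + \<beta> * e a b) * F k p1 + e a b * F k2 p2"
  shows "\<exists>C. expands pos \<beta> e q k p A C"
proof
  let ?C = "\<lambda>m. (1 + \<beta> * e a b) * C1 m + e a b * C2 m"
  show "expands pos \<beta> e q k p A ?C"
    unfolding expands_def
  proof (intro conjI impI allI)
    fix m assume "m \<notin> smaller_shapes q k"
    then show "?C m = 0" using 1 2 K unfolding expands_def by auto
  next
    fix m assume pos
    then have C: "C1 m \<in> positive_span \<beta> e A1" "C2 m \<in> positive_span \<beta> e A2"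
      using 1 2 unfolding expands_def by auto
    have "C1 m \<in> positive_span \<beta> e A"
      using C A[OF \<open>pos\<close>] positive_span_mono by blast
    moreover have "\<beta> ^ 1 * e a b * C1 m \<in> positive_span \<beta> e A"
      using C A[OF \<open>pos\<close>] by (intro positive_span_mult) auto
    moreover have "\<beta> ^ 0 * e a b * C2 m \<in> positive_span \<beta> e A"
      using C A[OF \<open>pos\<close>] by (intro positive_span_mult) auto
    ultimately have "C1 m + \<beta> ^ 1 * e a b * C1 m + \<beta> ^ 0 * e a b * C2 m \<in> positive_span \<beta> e A"
      by (intro positive_span_add)
    then show "?C m \<in> positive_span \<beta> e A"
      by (simp add: algebra_simps)
  next
    fix F assume F': "exchange_rules \<beta> e q F"
    have "F k2 p2 = (\<Sum>m \<in> smaller_shapes q k2. C2 m * F m (\<lambda>_. 0))"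
      using 2 F' unfolding expands_def by blast
    also have "\<dots> = (\<Sum>m \<in> smaller_shapes q k. C2 m * F m (\<lambda>_. 0))"
      using 2 K unfolding expands_def
      by (intro sum.mono_neutral_left) (auto simp: finite_smaller_shapes)
    finally have "F k2 p2 = \<dots>" .
    moreover have "F k p1 = (\<Sum>m \<in> smaller_shapes q k. C1 m * F m (\<lambda>_. 0))"
      using 1 F' unfolding expands_def by blast
    ultimately show "F k p = (\<Sum>m \<in> smaller_shapes q k. ?C m * F m (\<lambda>_. 0))"
      using F[OF F'] by (simp add: sum_distrib_left sum.distrib algebra_simps)
  qed
qed

section \<open>Moves that keep a chain of intervals nested\<close>

lemma nested_le:
  assumes "nested q k p" "1 \<le> i" "i \<le> j" "j \<le> q"
  shows "p i \<le> p j \<and> p j + int (k j) \<le> p i + int (k i) \<and> k j + (j - i) \<le> k i"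
  using assms(3,4)
proof (induction j rule: dec_induct)
  case (step n)
  then have "k (Suc n) < k n \<and> p n \<le> p (Suc n) \<and> p (Suc n) + int (k (Suc n)) \<le> p n + int (k n)"
    using assms(1,2) unfolding nested_def by auto
  then show ?case using step by auto
qed simp

lemma nested_raise:
  assumes "nested q k p" "r \<in> {1..q}"
    and "r < q \<Longrightarrow> p r < p (Suc r)" and "1 < r \<Longrightarrow> p r + int (k r) < p (r - 1) + int (k (r - 1))"
  shows "nested q k (p(r := p r + 1))"
  unfolding nested_def
proof (intro allI impI)
  fix i assume i: "1 \<le> i \<and> i < q"
  then have "k (Suc i) < k i \<and> p i \<le> p (Suc i) \<and> p (Suc i) + int (k (Suc i)) \<le> p i + int (k i)"
    using assms(1) unfolding nested_def by auto
  then show "k (Suc i) < k i \<and> (p(r := p r + 1)) i \<le> (p(r := p r + 1)) (Suc i) \<and>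
      (p(r := p r + 1)) (Suc i) + int (k (Suc i)) \<le> (p(r := p r + 1)) i + int (k i)"
    using assms(3,4) i by (auto simp: fun_upd_def)
qed

lemma nested_lower:
  assumes "nested q k p" "r \<in> {1..q}"
    and "1 < r \<Longrightarrow> p (r - 1) < p r" and "r < q \<Longrightarrow> p (Suc r) + int (k (Suc r)) < p r + int (k r)"
  shows "nested q k (p(r := p r - 1))"
  unfolding nested_def
proof (intro allI impI)
  fix i assume i: "1 \<le> i \<and> i < q"
  then have "k (Suc i) < k i \<and> p i \<le> p (Suc i) \<and> p (Suc i) + int (k (Suc i)) \<le> p i + int (k i)"
    using assms(1) unfolding nested_def by auto
  then show "k (Suc i) < k i \<and> (p(r := p r - 1)) i \<le> (p(r := p r - 1)) (Suc i) \<and>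
      (p(r := p r - 1)) (Suc i) + int (k (Suc i)) \<le> (p(r := p r - 1)) i + int (k i)"
    using assms(3,4) i by (auto simp: fun_upd_def)
qed

text \<open>The shortened interval lacks both exchanged labels, so it fits wherever the chain is
  nested before and after the exchange; excluding the moves without weight keeps the lengths
  strictly decreasing.\<close>

lemma nested_remove:
  assumes n: "nested q k p" and n': "nested q k (p(r := p r + 1))" and r: "r \<in> {1..q}"
    and k: "\<not> (r < q \<and> k r = Suc (k (Suc r)) \<or> r = q \<and> k q = 0)"
  shows "nested q (k(r := k r - 1)) (p(r := p r + 1))" and "0 < k r"
proof -
  have kr: "r < q \<Longrightarrow> Suc (k (Suc r)) < k r"
    using n r k unfolding nested_def by (metis Suc_lessI atLeastAtMost_iff)
  show "0 < k r"
    using kr k r by (cases "r = q") auto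
  show "nested q (k(r := k r - 1)) (p(r := p r + 1))"
    unfolding nested_def
  proof (intro allI impI)
    fix i assume i: "1 \<le> i \<and> i < q"
    have a: "k (Suc i) < k i" "p i \<le> p (Suc i)" "p (Suc i) + int (k (Suc i)) \<le> p i + int (k i)"
      using n i unfolding nested_def by auto
    have b: "(p(r := p r + 1)) i \<le> (p(r := p r + 1)) (Suc i)"
      "(p(r := p r + 1)) (Suc i) + int (k (Suc i)) \<le> (p(r := p r + 1)) i + int (k i)"
      using n' i unfolding nested_def by blast+
    show "(k(r := k r - 1)) (Suc i) < (k(r := k r - 1)) i \<and>
        (p(r := p r + 1)) i \<le> (p(r := p r + 1)) (Suc i) \<and>
        (p(r := p r + 1)) (Suc i) + int ((k(r := k r - 1)) (Suc i))
          \<le> (p(r := p r + 1)) i + int ((k(r := k r - 1)) i)"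
      using a b kr i \<open>0 < k r\<close> by (cases "i = r"; cases "Suc i = r") (auto simp: of_nat_diff)
  qed
qed

section \<open>Weights still available to a state\<close>

definition raise_region :: "nat \<Rightarrow> (nat \<Rightarrow> nat) \<Rightarrow> (nat \<Rightarrow> int) \<Rightarrow> (int \<times> int) set"
  where "raise_region q k p =
    {(a, b). b \<le> 0 \<and> 0 < a \<and> (\<exists>r \<in> {1..q}. p r < b \<and> p r + int (k r) < a)}"

definition lower_region :: "nat \<Rightarrow> (nat \<Rightarrow> nat) \<Rightarrow> (nat \<Rightarrow> int) \<Rightarrow> (int \<times> int) set"
  where "lower_region q k p =
    {(a, b). 0 < a \<and> a < b \<and> (\<exists>r \<in> {1..q}. a \<le> p r \<and> b \<le> p r + int (k r))}"

abbreviation region :: "nat \<Rightarrow> (nat \<Rightarrow> nat) \<Rightarrow> (nat \<Rightarrow> int) \<Rightarrow> (int \<times> int) set"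
  where "region q k p \<equiv> raise_region q k p \<union> lower_region q k p"

text \<open>Take the last row \<open>s\<close> with negative left end, then the first row
  \<open>r\<close> with the same right end as \<open>s\<close>. Equal right ends and strictly
  decreasing lengths force strictly increasing left ends, so \<open>r\<close> has room both towards
  its successor and towards its predecessor.\<close>

lemma raisable_row:
  assumes n: "nested q k p" and i: "i \<in> {1..q}" "p i < 0"
  obtains r where "r \<in> {1..q}" "p r < 0" "r < q \<Longrightarrow> p r < p (Suc r)"
    "1 < r \<Longrightarrow> p r + int (k r) < p (r - 1) + int (k (r - 1))"
proof -
  define s where "s = Max {i \<in> {1..q}. p i < 0}"
  have "s \<in> {i \<in> {1..q}. p i < 0}"
    unfolding s_def using i by (intro Max_in) auto
  then have s: "1 \<le> s" "s \<le> q" "p s < 0" by auto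
  have s': "p j \<ge> 0" if "s < j" "j \<le> q" for j
  proof (rule ccontr)
    assume "\<not> p j \<ge> 0"
    then have "j \<le> s" unfolding s_def using that s by (intro Max_ge) auto
    then show False using that by simp
  qed
  define r where "r = Min {i \<in> {1..s}. p i + int (k i) = p s + int (k s)}"
  have "r \<in> {i \<in> {1..s}. p i + int (k i) = p s + int (k s)}"
    unfolding r_def using s by (intro Min_in) auto
  then have r: "1 \<le> r" "r \<le> s" "p r + int (k r) = p s + int (k s)" by auto
  have r': "p j + int (k j) \<noteq> p s + int (k s)" if "1 \<le> j" "j < r" for j
  proof
    assume "p j + int (k j) = p s + int (k s)"
    then have "r \<le> j" unfolding r_def using that r by (intro Min_le) auto
    then show False using that by simp
  qed
  show ?thesis
  proof (rule that[of r])
    show "r \<in> {1..q}" using r s by auto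
    show "p r < 0" using nested_le[OF n, of r s] r s by auto
    show "p r < p (Suc r)" if "r < q"
    proof (cases "r = s")
      case True then show ?thesis using s'[of "Suc r"] s that by force
    next
      case False
      then have "p (Suc r) + int (k (Suc r)) = p r + int (k r)"
        using nested_le[OF n, of r "Suc r"] nested_le[OF n, of "Suc r" s] r s by auto
      moreover have "k (Suc r) < k r" using n r that unfolding nested_def by auto
      ultimately show ?thesis by simp
    qed
    show "p r + int (k r) < p (r - 1) + int (k (r - 1))" if "1 < r"
      using r'[of "r - 1"] nested_le[OF n, of "r - 1" r] r s that by force
  qed
qed

text \<open>Mirror image of the previous choice: the first row with positive left end, then the last
  row sharing its right end.\<close>

lemma lowerable_row:
  assumes n: "nested q k p" and i: "i \<in> {1..q}" "0 < p i"
  obtains r where "r \<in> {1..q}" "0 < p r" "1 < r \<Longrightarrow> p (r - 1) < p r"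
    "r < q \<Longrightarrow> p (Suc r) + int (k (Suc r)) < p r + int (k r)"
proof -
  define s where "s = Min {i \<in> {1..q}. 0 < p i}"
  have "s \<in> {i \<in> {1..q}. 0 < p i}"
    unfolding s_def using i by (intro Min_in) auto
  then have s: "1 \<le> s" "s \<le> q" "0 < p s" by auto
  have s': "p j \<le> 0" if "1 \<le> j" "j < s" for j
  proof (rule ccontr)
    assume "\<not> p j \<le> 0"
    then have "s \<le> j" unfolding s_def using that s by (intro Min_le) auto
    then show False using that by simp
  qed
  define r where "r = Max {i \<in> {s..q}. p i + int (k i) = p s + int (k s)}"
  have "r \<in> {i \<in> {s..q}. p i + int (k i) = p s + int (k s)}"
    unfolding r_def using s by (intro Max_in) auto
  then have r: "s \<le> r" "r \<le> q" "p r + int (k r) = p s + int (k s)" by auto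
  have r': "p j + int (k j) \<noteq> p s + int (k s)" if "r < j" "j \<le> q" for j
  proof
    assume "p j + int (k j) = p s + int (k s)"
    then have "j \<le> r" unfolding r_def using that r by (intro Max_ge) auto
    then show False using that by simp
  qed
  show ?thesis
  proof (rule that[of r])
    show "r \<in> {1..q}" using r s by auto
    show "0 < p r" using nested_le[OF n, of s r] r s by auto
    show "p (r - 1) < p r" if "1 < r"
    proof (cases "r = s")
      case True then show ?thesis using s'[of "r - 1"] s that by force
    next
      case False
      then have "p (r - 1) + int (k (r - 1)) = p r + int (k r)"
        using nested_le[OF n, of s "r - 1"] nested_le[OF n, of "r - 1" r] r s by force
      moreover have "1 \<le> r - 1 \<and> r - 1 < q" using r s False by auto
      then have "k (Suc (r - 1)) < k (r - 1)" using n unfolding nested_def by blast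
      ultimately show ?thesis using that by simp
    qed
    show "p (Suc r) + int (k (Suc r)) < p r + int (k r)" if "r < q"
      using r'[of "Suc r"] nested_le[OF n, of r "Suc r"] r s that by force
  qed
qed

lemma region_subset:
  assumes "\<And>i. i \<in> {1..q} \<Longrightarrow> p' i < 0 \<Longrightarrow> p i \<le> p' i \<and> p i + int (k i) \<le> p' i + int (k' i)"
    and "\<And>i. i \<in> {1..q} \<Longrightarrow> 0 < p' i \<Longrightarrow> p' i \<le> p i \<and> p' i + int (k' i) \<le> p i + int (k i)"
  shows "region q k' p' \<subseteq> region q k p"
proof (intro Un_mono subsetI)
  fix x assume "x \<in> raise_region q k' p'"
  then obtain a b r where x: "x = (a, b)" "b \<le> 0" "0 < a" "r \<in> {1..q}" "p' r < b"
    "p' r + int (k' r) < a" unfolding raise_region_def by blast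
  then show "x \<in> raise_region q k p"
    using assms(1)[of r] unfolding raise_region_def by force
next
  fix x assume "x \<in> lower_region q k' p'"
  then obtain a b r where x: "x = (a, b)" "0 < a" "a < b" "r \<in> {1..q}" "a \<le> p' r"
    "b \<le> p' r + int (k' r)" unfolding lower_region_def by blast
  then show "x \<in> lower_region q k p"
    using assms(2)[of r] unfolding lower_region_def by force
qed

text \<open>The weight of a raising step is available before it and never again. Any other row with
  left end at most \<open>p r\<close> ends strictly beyond row \<open>r\<close>, since otherwise the
  raised chain would not be nested. The lower bound on \<open>p r + int (k r)\<close> makes the
  first label positive.\<close>

lemma region_raise:
  assumes n: "nested q k p" and n': "nested q k (p(r := p r + 1))" and r: "r \<in> {1..q}"
    and pr: "p r < 0" and a: "0 \<le> p r + int (k r)"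
  shows "region q k (p(r := p r + 1)) \<subseteq> region q k p"
    and "region q (k(r := k r - 1)) (p(r := p r + 1)) \<subseteq> region q k p"
    and "(p r + int (k r) + 1, p r + 1) \<in> region q k p"
    and "(p r + int (k r) + 1, p r + 1) \<notin> region q k (p(r := p r + 1))"
    and "(p r + int (k r) + 1, p r + 1) \<notin> region q (k(r := k r - 1)) (p(r := p r + 1))"
proof -
  have kr: "0 < k r" using pr a by auto
  show "region q k (p(r := p r + 1)) \<subseteq> region q k p"
    using pr by (intro region_subset) (auto split: if_splits)
  show "region q (k(r := k r - 1)) (p(r := p r + 1)) \<subseteq> region q k p"
    using pr kr by (intro region_subset) (auto simp: of_nat_diff split: if_splits)
  show "(p r + int (k r) + 1, p r + 1) \<in> region q k p"
    using pr a r by (auto simp: raise_region_def)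
  have *: "p r + int (k r) < p i + int (k i)" if i: "i \<in> {1..q}" "i \<noteq> r" "p i \<le> p r" for i
  proof (cases "i < r")
    case True
    then have "p r + 1 + int (k r) \<le> p i + int (k i)"
      using nested_le[OF n', of i r] i r by (auto split: if_splits)
    then show ?thesis using i by simp
  next
    case False
    then have "p r + 1 \<le> p i"
      using nested_le[OF n', of r i] i r by (auto split: if_splits)
    then show ?thesis using i by simp
  qed
  show "(p r + int (k r) + 1, p r + 1) \<notin> region q k (p(r := p r + 1))"
    using pr by (auto simp: raise_region_def lower_region_def split: if_splits dest: * [rotated 2])
  show "(p r + int (k r) + 1, p r + 1) \<notin> region q (k(r := k r - 1)) (p(r := p r + 1))"
    using pr by (auto simp: raise_region_def lower_region_def split: if_splits dest: * [rotated 2])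
qed

text \<open>Any other row with left end at least \<open>p r\<close> ends strictly before row
  \<open>r\<close>, so the spent pair is not reachable again. As \<open>p r\<close> is positive,
  both labels are positive and the pair is of Type 1.\<close>

lemma region_lower:
  assumes n: "nested q k p" and n': "nested q k (p(r := p r - 1))" and r: "r \<in> {1..q}"
    and pr: "0 < p r" and kr: "0 < k r"
  shows "region q k (p(r := p r - 1)) \<subseteq> region q k p"
    and "region q (k(r := k r - 1)) p \<subseteq> region q k p"
    and "(p r, p r + int (k r)) \<in> region q k p"
    and "(p r, p r + int (k r)) \<notin> region q k (p(r := p r - 1))"
    and "(p r, p r + int (k r)) \<notin> region q (k(r := k r - 1)) p"
proof -
  show "region q k (p(r := p r - 1)) \<subseteq> region q k p"
    using pr by (intro region_subset) (auto split: if_splits)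
  show "region q (k(r := k r - 1)) p \<subseteq> region q k p"
    using pr kr by (intro region_subset) (auto simp: of_nat_diff split: if_splits)
  show "(p r, p r + int (k r)) \<in> region q k p"
    using pr kr r by (auto simp: lower_region_def)
  have *: "p i + int (k i) < p r + int (k r)" if i: "i \<in> {1..q}" "i \<noteq> r" "p r \<le> p i" for i
  proof (cases "i < r")
    case True
    then have "p i \<le> p r - 1"
      using nested_le[OF n', of i r] i r by (auto split: if_splits)
    then show ?thesis using i by simp
  next
    case False
    then have "p i + int (k i) \<le> p r - 1 + int (k r)"
      using nested_le[OF n', of r i] i r by (auto split: if_splits)
    then show ?thesis using i by simp
  qed
  show "(p r, p r + int (k r)) \<notin> region q k (p(r := p r - 1))"
    using pr by (auto simp: raise_region_def lower_region_def split: if_splits dest: * [rotated 2])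
  show "(p r, p r + int (k r)) \<notin> region q (k(r := k r - 1)) p"
    using pr kr by (auto simp: raise_region_def lower_region_def of_nat_diff split: if_splits dest: * [rotated 2])
qed

section \<open>Expanding a nested chain over the target intervals\<close>

locale exchange_system =
  fixes \<beta> :: "'r::comm_ring_1" and e :: "int \<Rightarrow> int \<Rightarrow> 'r"
  assumes e_self [simp]: "e a a = 0"
    and e_trans: "e a c = e a b + e b c + \<beta> * e a b * e b c"
begin

text \<open>The axiom \<open>e_trans\<close> says that \<open>1 + \<beta> * e a b\<close> behaves
  like a quotient of a quantity at \<open>a\<close> by one at \<open>b\<close>; in particular it is
  a unit, and swapping the labels inverts it.\<close>

lemma one_plus_mult: "(1 + \<beta> * e a b) * (1 + \<beta> * e b c) = 1 + \<beta> * e a c"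
  unfolding e_trans[of a c b] by (simp add: algebra_simps)

lemma one_plus_inverse: "(1 + \<beta> * e a b) * (1 + \<beta> * e b a) = 1"
  by (simp add: one_plus_mult)

text \<open>The exchange rule solved for the unraised state. Inverting the unit swaps its labels,
  and by \<open>e_trans\<close> the same swap absorbs the minus sign in front of the second
  term.\<close>

lemma raise_eq:
  assumes F: "exchange_rules \<beta> e q F" and "nested q k p" "nested q k (p(r := p r + 1))"
    and "r \<in> {1..q}" "\<not> (r < q \<and> k r = Suc (k (Suc r)) \<or> r = q \<and> k q = 0)"
  shows "F k p =
    (1 + \<beta> * e (p r + int (k r) + 1) (p r + 1)) * F k (p(r := p r + 1)) +
    e (p r + int (k r) + 1) (p r + 1) * F (k(r := k r - 1)) (p(r := p r + 1))"
proof -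
  let ?a = "p r + 1" and ?b = "p r + int (k r) + 1"
  have R: "F k (p(r := p r + 1)) =
      (1 + \<beta> * e ?a ?b) * F k p + e ?a ?b * F (k(r := k r - 1)) (p(r := p r + 1))"
    using assms unfolding exchange_rules_def by auto
  have 0: "e ?b ?a + (1 + \<beta> * e ?b ?a) * e ?a ?b = 0"
    using e_trans[of ?b ?b ?a] by (simp add: algebra_simps)
  have "(1 + \<beta> * e ?b ?a) * F k (p(r := p r + 1)) + e ?b ?a * F (k(r := k r - 1)) (p(r := p r + 1))
    = (1 + \<beta> * e ?b ?a) * (1 + \<beta> * e ?a ?b) * F k p +
      (e ?b ?a + (1 + \<beta> * e ?b ?a) * e ?a ?b) * F (k(r := k r - 1)) (p(r := p r + 1))"
    unfolding R by (simp only: algebra_simps)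
  then show ?thesis
    unfolding one_plus_mult 0 by simp
qed

lemma lower_eq:
  assumes F: "exchange_rules \<beta> e q F" and "nested q k p" "nested q k (p(r := p r - 1))"
    and "r \<in> {1..q}" "\<not> (r < q \<and> k r = Suc (k (Suc r)) \<or> r = q \<and> k q = 0)"
  shows "F k p =
    (1 + \<beta> * e (p r) (p r + int (k r))) * F k (p(r := p r - 1)) +
    e (p r) (p r + int (k r)) * F (k(r := k r - 1)) p"
proof -
  let ?p = "p(r := p r - 1)"
  have "nested q k ?p \<Longrightarrow> nested q k (?p(r := ?p r + 1)) \<Longrightarrow> r \<in> {1..q} \<Longrightarrow>
      F k (?p(r := ?p r + 1)) =
        (if r < q \<and> k r = Suc (k (Suc r)) \<or> r = q \<and> k q = 0 then F k ?p
         else (1 + \<beta> * e (?p r + 1) (?p r + int (k r) + 1)) * F k ?p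
            + e (?p r + 1) (?p r + int (k r) + 1) * F (k(r := k r - 1)) (?p(r := ?p r + 1)))"
    using F unfolding exchange_rules_def by blast
  then show ?thesis
    using assms(2-5) by simp
qed

lemma same_eq:
  assumes F: "exchange_rules \<beta> e q F" and "nested q k p" "nested q k (p(r := p r + 1))"
    and "r \<in> {1..q}" "r < q \<and> k r = Suc (k (Suc r)) \<or> r = q \<and> k q = 0"
  shows "F k (p(r := p r + 1)) = F k p"
  using assms unfolding exchange_rules_def by auto

text \<open>Every step moves a left end towards 0 or shortens an interval, whence the lexicographic
  measure. Nonnegativity of the right ends is inherited: raising never moves a right end to the
  left, and a row that is lowered has a positive left end, so its right end can afford to lose
  one.\<close>

lemma expands_region:
  assumes "nested q k p"
  shows "\<exists>C. expands (\<forall>i \<in> {1..q}. 0 \<le> p i + int (k i)) \<beta> e q k p (region q k p) C"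
  using assms
proof (induction "(\<Sum>i = 1..q. k i, \<Sum>i = 1..q. nat \<bar>p i\<bar>)" arbitrary: k p
    rule: wf_induct_rule[OF wf_lex_prod[OF wf_less_than wf_less_than]])
  case (1 k p)
  note n = \<open>nested q k p\<close>
  let ?pos = "\<lambda>k p. \<forall>i \<in> {1..q}. 0 \<le> p i + int (k i)"
  have smaller_p: "\<exists>C. expands (?pos k p') \<beta> e q k p' (region q k p') C"
    if "nested q k p'" "r \<in> {1..q}" "p' = p(r := x)" "\<bar>x\<bar> < \<bar>p r\<bar>" for p' r x
  proof (rule 1(1)[OF _ that(1)])
    have "(\<Sum>i = 1..q. nat \<bar>p' i\<bar>) < (\<Sum>i = 1..q. nat \<bar>p i\<bar>)"
      using that by (intro sum_strict_mono_ex1) auto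
    then show "((\<Sum>i = 1..q. k i, \<Sum>i = 1..q. nat \<bar>p' i\<bar>), \<Sum>i = 1..q. k i, \<Sum>i = 1..q. nat \<bar>p i\<bar>)
        \<in> less_than <*lex*> less_than" by simp
  qed
  have smaller_k: "\<exists>C. expands (?pos (k(r := k r - 1)) p') \<beta> e q (k(r := k r - 1)) p'
      (region q (k(r := k r - 1)) p') C"
    if "nested q (k(r := k r - 1)) p'" "r \<in> {1..q}" "0 < k r" for p' r
  proof (rule 1(1)[OF _ that(1)])
    have "(\<Sum>i = 1..q. (k(r := k r - 1)) i) < (\<Sum>i = 1..q. k i)"
      using that by (intro sum_strict_mono_ex1) auto
    then show "((\<Sum>i = 1..q. (k(r := k r - 1)) i, \<Sum>i = 1..q. nat \<bar>p' i\<bar>),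
        \<Sum>i = 1..q. k i, \<Sum>i = 1..q. nat \<bar>p i\<bar>) \<in> less_than <*lex*> less_than" by simp
  qed
  have pos_weak: "\<exists>C. expands (?pos k p) \<beta> e q k' p' A C"
    if "\<exists>C. expands P \<beta> e q k' p' A C" "?pos k p \<Longrightarrow> P" for P k' p' A
    using that unfolding expands_def by blast
  consider (raise) "\<exists>i \<in> {1..q}. p i < 0" | (lower) "\<exists>i \<in> {1..q}. 0 < p i"
    | (zero) "\<forall>i \<in> {1..q}. p i = 0" by force
  then show ?case
  proof cases
    case raise
    then obtain r where r: "r \<in> {1..q}" "p r < 0" "r < q \<Longrightarrow> p r < p (Suc r)"
      "1 < r \<Longrightarrow> p r + int (k r) < p (r - 1) + int (k (r - 1))"
      using raisable_row[OF n] by metis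
    let ?p = "p(r := p r + 1)"
    have n': "nested q k ?p" using nested_raise[OF n] r by blast
    obtain C1 where C1: "expands (?pos k p) \<beta> e q k ?p (region q k ?p) C1"
      using pos_weak[OF smaller_p[OF n' r(1) refl]] r by fastforce
    show ?thesis
    proof (cases "r < q \<and> k r = Suc (k (Suc r)) \<or> r = q \<and> k q = 0")
      case True
      have "expands (?pos k p) \<beta> e q k p (region q k p) C1"
      proof (rule expands_same[OF C1])
        show "region q k ?p \<subseteq> region q k p" if "?pos k p"
          using region_raise(1)[OF n n' r(1,2)] that r(1) by auto
        show "F k p = F k ?p" if "exchange_rules \<beta> e q F" for F
          using same_eq[OF that n n' r(1) True] by simp
      qed
      then show ?thesis by blast
    next
      case False
      note n'' = nested_remove[OF n n' r(1) False]
      obtain C2 where C2: "expands (?pos k p) \<beta> e q (k(r := k r - 1)) ?p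
          (region q (k(r := k r - 1)) ?p) C2"
        using pos_weak[OF smaller_k[OF n''(1) r(1) n''(2)]] n''(2) by fastforce
      show ?thesis
      proof (rule expands_step[OF C1 C2 smaller_shapes_decrease[OF r(1)]])
        show "region q k ?p \<subseteq> region q k p \<and> region q (k(r := k r - 1)) ?p \<subseteq> region q k p \<and>
            (p r + int (k r) + 1, p r + 1)
              \<in> region q k p - region q k ?p - region q (k(r := k r - 1)) ?p" if "?pos k p"
          using region_raise[OF n n' r(1,2)] that r(1) by blast
      qed (rule raise_eq[OF _ n n' r(1) False])
    qed
  next
    case lower
    then obtain r where r: "r \<in> {1..q}" "0 < p r" "1 < r \<Longrightarrow> p (r - 1) < p r"
      "r < q \<Longrightarrow> p (Suc r) + int (k (Suc r)) < p r + int (k r)"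
      using lowerable_row[OF n] by metis
    let ?p = "p(r := p r - 1)"
    have n': "nested q k ?p" using nested_lower[OF n] r by blast
    have pp: "?p(r := ?p r + 1) = p" by simp
    obtain C1 where C1: "expands (?pos k p) \<beta> e q k ?p (region q k ?p) C1"
      using pos_weak[OF smaller_p[OF n' r(1) refl]] r by fastforce
    show ?thesis
    proof (cases "r < q \<and> k r = Suc (k (Suc r)) \<or> r = q \<and> k q = 0")
      case True
      have sub: "region q k ?p \<subseteq> region q k p"
        using r(2) by (intro region_subset) (auto split: if_splits)
      have "expands (?pos k p) \<beta> e q k p (region q k p) C1"
      proof (rule expands_same[OF C1 sub])
        show "F k p = F k ?p" if "exchange_rules \<beta> e q F" for F
          using same_eq[OF that n' _ r(1) True, unfolded pp, OF n] by simp
      qed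
      then show ?thesis by blast
    next
      case False
      note n'' = nested_remove[OF n' _ r(1) False, unfolded pp, OF n]
      obtain C2 where C2: "expands (?pos k p) \<beta> e q (k(r := k r - 1)) p
          (region q (k(r := k r - 1)) p) C2"
        using pos_weak[OF smaller_k[OF n''(1) r(1) n''(2)]] r(2) n''(2) by fastforce
      show ?thesis
      proof (rule expands_step[OF C1 C2 smaller_shapes_decrease[OF r(1)]])
        show "region q k ?p \<subseteq> region q k p \<and> region q (k(r := k r - 1)) p \<subseteq> region q k p \<and>
            (p r, p r + int (k r))
              \<in> region q k p - region q k ?p - region q (k(r := k r - 1)) p" if "?pos k p"
          using region_lower[OF n n' r(1,2) n''(2)] by blast
      qed (rule lower_eq[OF _ n n' r(1) False])
    qed
  next
    case zero
    have k: "k \<in> smaller_shapes q k"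
      using n by (simp add: smaller_shapes_def nested_def)
    have "expands (?pos k p) \<beta> e q k p (region q k p) (\<lambda>m. if m = k then 1 else 0)"
      unfolding expands_def
    proof (intro conjI allI impI)
      fix F assume "exchange_rules \<beta> e q F"
      then have "F k p = F k (\<lambda>_. 0)"
        using zero unfolding exchange_rules_def by metis
      also have "\<dots> = (\<Sum>m \<in> smaller_shapes q k. if m = k then F m (\<lambda>_. 0) else 0)"
        using k by (simp add: finite_smaller_shapes)
      also have "\<dots> = (\<Sum>m \<in> smaller_shapes q k. (if m = k then 1 else 0) * F m (\<lambda>_. 0))"
        by (rule sum.cong) auto
      finally show "F k p = \<dots>" .
    qed (use k in \<open>auto simp: positive_span_0 positive_span_1\<close>)
    then show ?thesis by blast
  qed
qed

end

subsection \<open>Alternants\<close>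

text \<open>The Leibniz expansion of a determinant, with rows and columns indexed by
  \<open>{1..q}\<close>.\<close>

definition alternant :: "nat \<Rightarrow> (nat \<Rightarrow> nat \<Rightarrow> 'r::comm_ring_1) \<Rightarrow> 'r"
  where "alternant q P = (\<Sum>\<pi> | \<pi> permutes {1..q}. of_int (sign \<pi>) * (\<Prod>i = 1..q. P i (\<pi> i)))"

lemma alternant_linear:
  assumes r: "r \<in> {1..q}" and P: "\<And>j. P r j = c * P1 r j + d * P2 r j"
    and 1: "\<And>i j. i \<noteq> r \<Longrightarrow> P1 i j = P i j" and 2: "\<And>i j. i \<noteq> r \<Longrightarrow> P2 i j = P i j"
  shows "alternant q P = c * alternant q P1 + d * alternant q P2"
proof -
  have split: "(\<Prod>i = 1..q. Q i (\<pi> i)) = Q r (\<pi> r) * (\<Prod>i \<in> {1..q} - {r}. Q i (\<pi> i))"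
    for Q :: "nat \<Rightarrow> nat \<Rightarrow> 'a" and \<pi>
    using r by (intro prod.remove) auto
  have "(\<Prod>i \<in> {1..q} - {r}. P1 i (\<pi> i)) = (\<Prod>i \<in> {1..q} - {r}. P i (\<pi> i))"
    "(\<Prod>i \<in> {1..q} - {r}. P2 i (\<pi> i)) = (\<Prod>i \<in> {1..q} - {r}. P i (\<pi> i))" for \<pi>
    using 1 2 by (auto intro!: prod.cong)
  then show ?thesis
    unfolding alternant_def split P sum_distrib_left sum.distrib[symmetric]
    by (intro sum.cong) (simp_all add: algebra_simps)
qed

text \<open>Composing with the transposition of \<open>r\<close> and \<open>s\<close> matches even
  with odd permutations and reverses each term. Matching terms, instead of deriving x = - x, keeps
  the argument valid where 2 cannot be cancelled.\<close>

lemma alternant_equal_rows: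
  assumes rs: "r \<in> {1..q}" "s \<in> {1..q}" "r \<noteq> s" and P: "\<And>j. P r j = P s j"
  shows "alternant q P = 0"
proof -
  let ?\<tau> = "transpose r s"
  let ?f = "\<lambda>\<pi>. of_int (sign \<pi>) * (\<Prod>i = 1..q. P i (\<pi> i))"
  have \<tau>: "?\<tau> permutes {1..q}" using rs by (intro permutes_swap_id) auto
  have fin: "finite {\<pi>. \<pi> permutes {1..q}}" by (simp add: finite_permutations)
  have perm: "permutation \<pi>" if "\<pi> permutes {1..q}" for \<pi> :: "nat \<Rightarrow> nat"
    using that permutation_permutes by blast
  have f: "?f (\<pi> \<circ> ?\<tau>) = - ?f \<pi>" if \<pi>: "\<pi> permutes {1..q}" for \<pi>
  proof -
    have "(\<Prod>i = 1..q. P i ((\<pi> \<circ> ?\<tau>) i)) = (\<Prod>i = 1..q. P (?\<tau> i) (\<pi> (?\<tau> i)))"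
      by (intro prod.cong refl) (auto simp: transpose_def P)
    also have "\<dots> = (\<Prod>i = 1..q. P i (\<pi> i))"
      by (rule prod.permute[OF \<tau>, of "\<lambda>i. P i (\<pi> i)", unfolded comp_def, symmetric])
    finally show ?thesis
      using sign_compose[OF perm[OF \<pi>] perm[OF \<tau>]] rs by (simp add: sign_swap_id)
  qed
  have "alternant q P = (\<Sum>\<pi> | \<pi> permutes {1..q} \<and> evenperm \<pi>. ?f \<pi>)
      + (\<Sum>\<pi> | \<pi> permutes {1..q} \<and> \<not> evenperm \<pi>. ?f \<pi>)"
    unfolding alternant_def using fin
    by (subst sum.union_disjoint[symmetric]) (auto intro!: sum.cong)
  also have "(\<Sum>\<pi> | \<pi> permutes {1..q} \<and> \<not> evenperm \<pi>. ?f \<pi>)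
      = (\<Sum>\<pi> | \<pi> permutes {1..q} \<and> evenperm \<pi>. ?f (\<pi> \<circ> ?\<tau>))"
  proof (rule sum.reindex_bij_witness[where i = "\<lambda>\<pi>. \<pi> \<circ> ?\<tau>" and j = "\<lambda>\<pi>. \<pi> \<circ> ?\<tau>"])
    have ev: "evenperm (\<pi> \<circ> ?\<tau>) \<longleftrightarrow> \<not> evenperm \<pi>" if "\<pi> permutes {1..q}" for \<pi>
      using evenperm_comp[OF perm[OF that] perm[OF \<tau>]] rs by (simp add: evenperm_swap)
    fix \<pi>
    show "\<pi> \<in> {\<pi>. \<pi> permutes {1..q} \<and> \<not> evenperm \<pi>} \<Longrightarrow>
        \<pi> \<circ> ?\<tau> \<in> {\<pi>. \<pi> permutes {1..q} \<and> evenperm \<pi>}"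
      using ev \<tau> by (auto intro: permutes_compose)
    show "\<pi> \<in> {\<pi>. \<pi> permutes {1..q} \<and> evenperm \<pi>} \<Longrightarrow>
        \<pi> \<circ> ?\<tau> \<in> {\<pi>. \<pi> permutes {1..q} \<and> \<not> evenperm \<pi>}"
      using ev \<tau> by (auto intro: permutes_compose)
  qed (auto simp: comp_assoc)
  also have "\<dots> = - (\<Sum>\<pi> | \<pi> permutes {1..q} \<and> evenperm \<pi>. ?f \<pi>)"
    unfolding sum_negf[symmetric] using f by (intro sum.cong) auto
  finally show ?thesis by simp
qed

lemma alternant_add_row:
  assumes "r \<in> {1..q}" "s \<in> {1..q}" "r \<noteq> s" and "\<And>j. P r j = Q r j + c * Q s j"
    and "\<And>i j. i \<noteq> r \<Longrightarrow> P i j = Q i j"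
  shows "alternant q P = alternant q Q"
proof -
  have "alternant q P = 1 * alternant q Q + c * alternant q (Q(r := Q s))"
    using assms by (intro alternant_linear[of r]) auto
  also have "alternant q (Q(r := Q s)) = 0"
    using assms by (intro alternant_equal_rows[of r q s]) auto
  finally show ?thesis by simp
qed

subsection \<open>The determinantal model\<close>

text \<open>
  Row \<open>i\<close> of the model is the polynomial \<open>(1 + \<beta> u)\<^sup>i \<Prod> (u \<ominus> y\<^sub>b)\<close>, with \<open>b\<close> running over the interval of
  labels attached to the row, evaluated at \<open>u = y\<^sub>v\<close>.  The label \<open>c\<close> only normalises \<open>1 + \<beta> u\<close>.
\<close>

definition model_row ::
    "'r::comm_ring_1 \<Rightarrow> (int \<Rightarrow> int \<Rightarrow> 'r) \<Rightarrow> int \<Rightarrow> (nat \<Rightarrow> nat) \<Rightarrow> (nat \<Rightarrow> int) \<Rightarrow> nat \<Rightarrow> int \<Rightarrow> 'r"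
  where "model_row \<beta> e c k p i v = (1 + \<beta> * e v c) ^ i * (\<Prod>b \<in> {p i<..p i + int (k i)}. e v b)"

definition model ::
    "'r::comm_ring_1 \<Rightarrow> (int \<Rightarrow> int \<Rightarrow> 'r) \<Rightarrow> int \<Rightarrow> nat \<Rightarrow> (nat \<Rightarrow> int) \<Rightarrow> (nat \<Rightarrow> nat) \<Rightarrow> (nat \<Rightarrow> int) \<Rightarrow> 'r"
  where "model \<beta> e c q v k p = alternant q (\<lambda>i j. model_row \<beta> e c k p i (v j))"

context exchange_system
begin

text \<open>Exchanging one label changes a row factor by a constant times
  \<open>1 + \<beta> * e v c\<close>. This is what the powers in \<open>model_row\<close> are made
  for: the change of row r is a multiple of row r + 1, whose power is one higher.\<close>

lemma e_difference: "e v a = e v b + e b a * (1 + \<beta> * e c b) * (1 + \<beta> * e v c)"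
proof -
  have "e b a * (1 + \<beta> * e c b) * (1 + \<beta> * e v c) = e b a * ((1 + \<beta> * e v c) * (1 + \<beta> * e c b))"
    by (simp add: ac_simps)
  then show ?thesis
    unfolding one_plus_mult e_trans[of v a b] by (simp add: algebra_simps)
qed

lemma model_exchange_rules: "exchange_rules \<beta> e q (model \<beta> e c q v)"
  unfolding exchange_rules_def
proof (intro conjI allI impI)
  fix k :: "nat \<Rightarrow> nat" and p p' :: "nat \<Rightarrow> int"
  assume "\<forall>i \<in> {1..q}. p i = p' i"
  then show "model \<beta> e c q v k p = model \<beta> e c q v k p'"
    unfolding model_def alternant_def model_row_def by (intro sum.cong prod.cong refl arg_cong2[where f = "(*)"]) auto
next
  fix k :: "nat \<Rightarrow> nat" and p :: "nat \<Rightarrow> int" and r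
  assume n: "nested q k p" and n': "nested q k (p(r := p r + 1))" and r: "r \<in> {1..q}"
  let ?p = "p(r := p r + 1)" and ?a = "p r + 1" and ?b = "p r + int (k r) + 1"
  show "model \<beta> e c q v k ?p =
      (if r < q \<and> k r = Suc (k (Suc r)) \<or> r = q \<and> k q = 0 then model \<beta> e c q v k p
       else (1 + \<beta> * e ?a ?b) * model \<beta> e c q v k p
          + e ?a ?b * model \<beta> e c q v (k(r := k r - 1)) ?p)"
  proof (cases "r < q \<and> k r = Suc (k (Suc r)) \<or> r = q \<and> k q = 0")
    case True
    then consider (tied) "r < q" "k r = Suc (k (Suc r))" | (empty) "k r = 0" by auto
    then have "model \<beta> e c q v k ?p = model \<beta> e c q v k p"
    proof cases
      case tied
      \<comment> \<open>The raised left end gives \<open>p r + 1 \<le> p (Suc r)\<close>, the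
        unraised right end the converse. Hence interval \<open>Suc r\<close> is precisely the part
        common to both versions of interval \<open>r\<close>.\<close>
      then have ps: "p (Suc r) = ?a"
        using n n' r unfolding nested_def by (auto split: if_splits)
      let ?N = "{?a<..p r + int (k r)}"
      have I: "{?p r<..?p r + int (k r)} = insert ?b ?N" "{p r<..p r + int (k r)} = insert ?a ?N"
        "{p (Suc r)<..p (Suc r) + int (k (Suc r))} = ?N"
        using tied ps by auto
      have row: "model_row \<beta> e c k ?p r u = model_row \<beta> e c k p r u
          + (e ?a ?b * (1 + \<beta> * e c ?a)) * model_row \<beta> e c k p (Suc r) u" for u
        unfolding model_row_def I using e_difference[of u ?b ?a c]
        by (simp add: algebra_simps)
      show ?thesis
        unfolding model_def
      proof (rule alternant_add_row[of r q "Suc r"])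
        show "r \<in> {1..q}" "Suc r \<in> {1..q}" "r \<noteq> Suc r" using r tied by auto
        show "model_row \<beta> e c k ?p r (v j) = model_row \<beta> e c k p r (v j)
          + (e ?a ?b * (1 + \<beta> * e c ?a)) * model_row \<beta> e c k p (Suc r) (v j)" for j by (rule row)
        show "i \<noteq> r \<Longrightarrow> model_row \<beta> e c k ?p i (v j) = model_row \<beta> e c k p i (v j)" for i j
          by (simp add: model_row_def)
      qed
    next
      case empty
      have "model_row \<beta> e c k ?p i u = model_row \<beta> e c k p i u" for i u
        unfolding model_row_def using empty by simp
      then show ?thesis unfolding model_def by presburger
    qed
    then show ?thesis using True by simp
  next
    case False
    note kr = nested_remove(2)[OF n n' r False]
    let ?N = "{?a<..p r + int (k r)}"
    have I: "{?p r<..?p r + int (k r)} = insert ?b ?N" "{p r<..p r + int (k r)} = insert ?a ?N"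
      "{?p r<..?p r + int ((k(r := k r - 1)) r)} = ?N"
      using kr by (auto simp: of_nat_diff)
    have row: "model_row \<beta> e c k ?p r u = (1 + \<beta> * e ?a ?b) * model_row \<beta> e c k p r u
        + e ?a ?b * model_row \<beta> e c (k(r := k r - 1)) ?p r u" for u
      unfolding model_row_def I using e_trans[of u ?b ?a]
      by (simp add: algebra_simps)
    have "model \<beta> e c q v k ?p = (1 + \<beta> * e ?a ?b) * model \<beta> e c q v k p
          + e ?a ?b * model \<beta> e c q v (k(r := k r - 1)) ?p"
      unfolding model_def using r row by (intro alternant_linear[of r]) (auto simp: model_row_def)
    then show ?thesis unfolding if_not_P[OF False] .
  qed
qed

section \<open>Independence of the alternants at the target\<close>

lemma model_base_row_eq_0:
  assumes "n < m i"
  shows "model_row \<beta> e c m (\<lambda>_. 0) i (int n + 1) = 0"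
proof -
  have "(\<Prod>b \<in> {0<..0 + int (m i)}. e (int n + 1) b) = 0"
    using assms by (intro prod_zero) (auto intro!: bexI[where x = "int n + 1"])
  then show ?thesis by (simp add: model_row_def)
qed

end

text \<open>The permutation preserves order, so \<open>i \<le> \<pi> i\<close> by induction upwards
  from 1 and \<open>\<pi> i \<le> i\<close> by induction downwards from \<open>q\<close>.\<close>

lemma strictly_decreasing_permutes_id:
  fixes m n :: "nat \<Rightarrow> nat"
  assumes "\<pi> permutes {1..q}" and n: "\<And>i j. 1 \<le> i \<Longrightarrow> i < j \<Longrightarrow> j \<le> q \<Longrightarrow> n j < n i"
    and m: "\<And>i j. 1 \<le> i \<Longrightarrow> i < j \<Longrightarrow> j \<le> q \<Longrightarrow> m j < m i"
    and eq: "\<And>i. i \<in> {1..q} \<Longrightarrow> n (\<pi> i) = m i"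
  shows "\<pi> = id"
proof -
  have mem: "\<pi> i \<in> {1..q}" if "i \<in> {1..q}" for i using permutes_in_image[OF assms(1)] that by blast
  have mono: "\<pi> i < \<pi> j" if ij: "1 \<le> i" "i < j" "j \<le> q" for i j
  proof (rule ccontr)
    assume "\<not> \<pi> i < \<pi> j"
    moreover have "\<pi> i \<noteq> \<pi> j" using permutes_inj[OF assms(1)] ij by (simp add: inj_eq)
    ultimately have "\<pi> j < \<pi> i" by simp
    then have "n (\<pi> i) < n (\<pi> j)" using mem[of i] mem[of j] ij by (intro n) auto
    then show False using eq[of i] eq[of j] m[OF ij] ij by simp
  qed
  have ge: "i \<le> \<pi> i" if "i \<in> {1..q}" for i
    using that
  proof (induction i)
    case (Suc i)
    then show ?case using mono[of i "Suc i"] mem[of "Suc i"] by (cases "i = 0") force+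
  qed simp
  have le: "\<pi> (q - d) \<le> q - d" if "d < q" for d
    using that
  proof (induction d)
    case 0 then show ?case using mem[of q] by simp
  next
    case (Suc d)
    then have "\<pi> (q - Suc d) < \<pi> (q - d)" by (intro mono) auto
    then show ?case using Suc by simp
  qed
  have "\<pi> i = i" for i
  proof (cases "i \<in> {1..q}")
    case True
    then show ?thesis using ge[of i] le[of "q - i"] by simp
  next
    case False
    then show ?thesis using assms(1) by (simp add: permutes_def)
  qed
  then show ?thesis by auto
qed

lemma decreasing_chain:
  fixes m :: "nat \<Rightarrow> nat"
  assumes "\<forall>i. 1 \<le> i \<and> i < q \<longrightarrow> m (Suc i) < m i" "1 \<le> i" "i < j" "j \<le> q"
  shows "m j < m i"
  using assms(3,4)
proof (induction j)
  case (Suc j)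
  have "m (Suc j) < m j" using assms(1,2) Suc.prems by auto
  moreover have "m j \<le> m i" using Suc by (cases "i = j") auto
  ultimately show ?case by simp
qed simp

locale regular_exchange_system = exchange_system +
  assumes e_regular: "a \<noteq> b \<Longrightarrow> e a b * x = 0 \<Longrightarrow> x = 0"
begin

lemma regular_prod:
  assumes "finite I" "\<And>i y. i \<in> I \<Longrightarrow> f i * y = 0 \<Longrightarrow> y = 0" "(\<Prod>i \<in> I. f i) * x = (0 :: 'a)"
  shows "x = 0"
  using assms by (induction I arbitrary: x rule: finite_induct) (auto simp: mult.assoc)

text \<open>Row \<open>i\<close> vanishes at every point that is a label of its interval, so a
  surviving permutation satisfies \<open>m i \<le> m (\<pi> i)\<close>. Equal sums turn this into
  equality and leave the identity, whose product consists of units and regular factors.\<close>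

lemma model_base_regular:
  assumes m: "\<forall>i. 1 \<le> i \<and> i < q \<longrightarrow> m (Suc i) < m i"
    and 0: "model \<beta> e c q (\<lambda>j. int (m j) + 1) m (\<lambda>_. 0) * x = 0"
  shows "x = 0"
proof -
  let ?P = "\<lambda>i. model_row \<beta> e c m (\<lambda>_. 0) i"
  have "(\<Prod>i = 1..q. ?P i (int (m (\<pi> i)) + 1)) = 0" if \<pi>: "\<pi> permutes {1..q}" "\<pi> \<noteq> id" for \<pi>
  proof (rule ccontr)
    assume nz: "(\<Prod>i = 1..q. ?P i (int (m (\<pi> i)) + 1)) \<noteq> 0"
    have ge: "m i \<le> m (\<pi> i)" if "i \<in> {1..q}" for i
    proof (rule ccontr)
      assume "\<not> m i \<le> m (\<pi> i)"
      then have "?P i (int (m (\<pi> i)) + 1) = 0" by (intro model_base_row_eq_0) simp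
      then show False using nz that by (metis finite_atLeastAtMost prod_zero)
    qed
    have "(\<Sum>i = 1..q. m (\<pi> i)) = (\<Sum>i = 1..q. m i)"
      by (rule sum.permute[OF \<pi>(1), of m, unfolded comp_def, symmetric])
    then have "m (\<pi> i) = m i" if "i \<in> {1..q}" for i
      using sum_mono_inv[of m "{1..q}" "\<lambda>i. m (\<pi> i)" i] ge that by simp
    then have "\<pi> = id"
      using decreasing_chain[OF m] by (intro strictly_decreasing_permutes_id[OF \<pi>(1), of m m]) auto
    then show False using \<pi> by simp
  qed
  then have "model \<beta> e c q (\<lambda>j. int (m j) + 1) m (\<lambda>_. 0) =
      (\<Sum>\<pi> | \<pi> permutes {1..q}. if \<pi> = id then (\<Prod>i = 1..q. ?P i (int (m i) + 1)) else 0)"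
    unfolding model_def alternant_def by (intro sum.cong) (auto simp: sign_id)
  also have "\<dots> = (\<Prod>i = 1..q. ?P i (int (m i) + 1))"
    by (simp add: finite_permutations permutes_id)
  finally have "(\<Prod>i = 1..q. ?P i (int (m i) + 1)) * x = 0" using 0 by simp
  then show ?thesis
  proof (rule regular_prod[rotated 2])
    fix i y assume "?P i (int (m i) + 1) * y = 0"
    \<comment> \<open>Multiplying by the inverse unit strips off the normalising power and leaves
      only factors \<open>e\<close> with distinct labels.\<close>
    then have "(1 + \<beta> * e c (int (m i) + 1)) ^ i * (?P i (int (m i) + 1) * y) = 0" by simp
    also have "(1 + \<beta> * e c (int (m i) + 1)) ^ i * (?P i (int (m i) + 1) * y) =
        ((1 + \<beta> * e c (int (m i) + 1)) * (1 + \<beta> * e (int (m i) + 1) c)) ^ i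
          * ((\<Prod>b \<in> {0<..int (m i)}. e (int (m i) + 1) b) * y)"
      by (simp add: model_row_def power_mult_distrib ac_simps)
    finally have "(\<Prod>b \<in> {0<..int (m i)}. e (int (m i) + 1) b) * y = 0"
      by (simp only: one_plus_inverse power_one mult_1_left)
    then show "y = 0"
      by (rule regular_prod[rotated 2]) (auto dest: e_regular[rotated])
  qed simp
qed

text \<open>A surviving permutation gives \<open>m i \<le> n (\<pi> i)\<close>, against the assumed
  inequality of the sums; so \<open>m\<close> rearranges \<open>n\<close>, and both are
  decreasing.\<close>

lemma model_base_triangular:
  assumes m: "\<forall>i. 1 \<le> i \<and> i < q \<longrightarrow> m (Suc i) < m i"
    and n: "\<forall>i. 1 \<le> i \<and> i < q \<longrightarrow> n (Suc i) < n i"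
    and nz: "model \<beta> e c q (\<lambda>j. int (n j) + 1) m (\<lambda>_. 0) \<noteq> 0"
    and le: "(\<Sum>i = 1..q. n i) \<le> (\<Sum>i = 1..q. m i)" and i: "i \<in> {1..q}"
  shows "m i = n i"
proof -
  let ?P = "\<lambda>i. model_row \<beta> e c m (\<lambda>_. 0) i"
  obtain \<pi> where \<pi>: "\<pi> permutes {1..q}" and nz': "(\<Prod>i = 1..q. ?P i (int (n (\<pi> i)) + 1)) \<noteq> 0"
    using nz unfolding model_def alternant_def by (metis (no_types, lifting) mem_Collect_eq mult_zero_right sum.neutral)
  have ge: "m i \<le> n (\<pi> i)" if "i \<in> {1..q}" for i
  proof (rule ccontr)
    assume "\<not> m i \<le> n (\<pi> i)"
    then have "?P i (int (n (\<pi> i)) + 1) = 0" by (intro model_base_row_eq_0) simp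
    then show False using nz' that by (metis finite_atLeastAtMost prod_zero)
  qed
  have "(\<Sum>i = 1..q. n (\<pi> i)) = (\<Sum>i = 1..q. n i)"
    by (rule sum.permute[OF \<pi>(1), of n, unfolded comp_def, symmetric])
  moreover have "(\<Sum>i = 1..q. m i) \<le> (\<Sum>i = 1..q. n (\<pi> i))"
    using ge by (intro sum_mono) auto
  ultimately have "(\<Sum>i = 1..q. m i) = (\<Sum>i = 1..q. n (\<pi> i))" using le by simp
  then have eq: "n (\<pi> i) = m i" if "i \<in> {1..q}" for i
    using sum_mono_inv[of m "{1..q}" "\<lambda>i. n (\<pi> i)" i] ge that by simp
  have "\<pi> = id"
    using decreasing_chain[OF n] decreasing_chain[OF m]
    by (intro strictly_decreasing_permutes_id[OF \<pi>, of n m]) (auto simp: eq)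
  then show ?thesis using eq[OF i] by simp
qed

text \<open>Evaluation at the points \<open>m j + 1\<close> kills every other shape whose sum is at
  least that of \<open>m\<close>, while shapes of smaller sum have coefficient 0 by induction. What
  remains is \<open>D m\<close> times a regular element.\<close>

lemma model_base_independent:
  assumes D: "\<And>v. (\<Sum>m \<in> smaller_shapes q k. D m * model \<beta> e c q v m (\<lambda>_. 0)) = 0"
    and m: "m \<in> smaller_shapes q k"
  shows "D m = 0"
  using m
proof (induction "\<Sum>i = 1..q. m i" arbitrary: m rule: less_induct)
  case (less m)
  have dec: "\<forall>i. 1 \<le> i \<and> i < q \<longrightarrow> n (Suc i) < n i" if "n \<in> smaller_shapes q k" for n
    using that by (simp add: smaller_shapes_def)
  let ?v = "\<lambda>j. int (m j) + 1"
  have "D n * model \<beta> e c q ?v n (\<lambda>_. 0) = 0" if n: "n \<in> smaller_shapes q k" "n \<noteq> m" for n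
  proof (rule ccontr)
    assume nz: "D n * model \<beta> e c q ?v n (\<lambda>_. 0) \<noteq> 0"
    then have "\<not> (\<Sum>i = 1..q. n i) < (\<Sum>i = 1..q. m i)" using less(1) n by force
    moreover have "model \<beta> e c q ?v n (\<lambda>_. 0) \<noteq> 0" using nz by auto
    ultimately have *: "n i = m i" if "i \<in> {1..q}" for i
      using that by (intro model_base_triangular[OF dec[OF n(1)] dec[OF less(2)]]) auto
    have "n i = m i" if "i \<notin> {1..q}" for i
      using n(1) less(2) that unfolding smaller_shapes_def by (smt (verit) mem_Collect_eq)
    then have "n = m" using * by blast
    then show False using n by simp
  qed
  then have "(\<Sum>n \<in> smaller_shapes q k. D n * model \<beta> e c q ?v n (\<lambda>_. 0)) =
      (\<Sum>n \<in> smaller_shapes q k. if n = m then D m * model \<beta> e c q ?v m (\<lambda>_. 0) else 0)"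
    by (intro sum.cong) auto
  also have "\<dots> = D m * model \<beta> e c q ?v m (\<lambda>_. 0)"
    using less(2) by (simp add: finite_smaller_shapes)
  finally have "model \<beta> e c q ?v m (\<lambda>_. 0) * D m = 0" using D[of ?v] by (simp add: mult.commute)
  then show ?case by (rule model_base_regular[OF dec[OF less(2)]])
qed

end

subsection \<open>Relabelling\<close>

lemma relabelled_system:
  assumes "regular_exchange_system \<beta> e" "bij \<sigma>"
  shows "regular_exchange_system \<beta> (\<lambda>a b. e (\<sigma> a) (\<sigma> b))"
proof -
  interpret regular_exchange_system \<beta> e by fact
  show ?thesis
  proof
    show "e (\<sigma> a) (\<sigma> a) = 0" for a by simp
    show "e (\<sigma> a) (\<sigma> c) = e (\<sigma> a) (\<sigma> b) + e (\<sigma> b) (\<sigma> c) + \<beta> * e (\<sigma> a) (\<sigma> b) * e (\<sigma> b) (\<sigma> c)"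
      for a b c by (rule e_trans)
    show "x = 0" if "a \<noteq> b" "e (\<sigma> a) (\<sigma> b) * x = 0" for a b x
      using that e_regular[of "\<sigma> a" "\<sigma> b" x] assms(2) by (auto simp: bij_def inj_eq)
  qed
qed

lemma model_row_relabel:
  assumes "bij \<sigma>" "\<sigma> ` {p' i<..p' i + int (k i)} = {p i<..p i + int (k i)}"
  shows "model_row \<beta> (\<lambda>a b. e (\<sigma> a) (\<sigma> b)) c k p' i v = model_row \<beta> e (\<sigma> c) k p i (\<sigma> v)"
proof -
  have "inj_on \<sigma> {p' i<..p' i + int (k i)}"
    using assms(1) by (meson bij_is_inj inj_on_subset subset_UNIV)
  then show ?thesis
    by (simp add: model_row_def assms(2)[symmetric] prod.reindex)
qed

lemma positive_span_relabel:
  assumes \<sigma>: "bij \<sigma>" and A: "map_prod \<sigma> \<sigma> ` A \<subseteq> B"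
    and x: "x \<in> positive_span \<beta> (\<lambda>a b. e (\<sigma> a) (\<sigma> b)) A"
  shows "x \<in> positive_span \<beta> e B"
proof -
  obtain ts where ts: "\<forall>(n, S) \<in> set ts. finite S \<and> S \<subseteq> A"
    "x = (\<Sum>(n, S) \<leftarrow> ts. \<beta> ^ n * (\<Prod>(a, b) \<in> S. e (\<sigma> a) (\<sigma> b)))"
    using x unfolding positive_span_def by blast
  let ?us = "map (\<lambda>(n, S). (n, map_prod \<sigma> \<sigma> ` S)) ts"
  have inj: "inj_on (map_prod \<sigma> \<sigma>) S" for S
    using \<sigma> by (intro inj_on_subset[OF prod.inj_map]) (auto simp: bij_def)
  have "x = (\<Sum>(n, S) \<leftarrow> ?us. \<beta> ^ n * (\<Prod>(a, b) \<in> S. e a b))"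
    unfolding ts(2) map_map
    by (intro arg_cong[where f = sum_list] map_cong refl)
      (auto simp: prod.reindex[OF inj] case_prod_beta intro!: prod.cong)
  moreover have "\<forall>(n, S) \<in> set ?us. finite S \<and> S \<subseteq> B"
    using ts(1) A by fastforce
  ultimately show ?thesis unfolding positive_span_def by blast
qed

definition cycle_down :: "int \<Rightarrow> int \<Rightarrow> int \<Rightarrow> int"
  where "cycle_down a b j = (if a < j \<and> j \<le> b then j - 1 else if j = a then b else j)"

lemma bij_cycle_down:
  assumes "a \<le> b"
  shows "bij (cycle_down a b)"
proof (rule bij_betw_byWitness[where f' = "\<lambda>j. if a \<le> j \<and> j < b then j + 1 else if j = b then a else j"])
qed (use assms in \<open>auto simp: cycle_down_def\<close>)

lemma cycle_down_image_shift:
  assumes "a \<le> l" "r \<le> b"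
  shows "cycle_down a b ` {l<..r} = {l - 1<..r - 1}"
proof -
  have "cycle_down a b ` {l<..r} = (\<lambda>j. j - 1) ` {l<..r}"
    using assms by (intro image_cong) (auto simp: cycle_down_def)
  also have "\<dots> = {l - 1<..r - 1}"
    by (force simp: image_iff intro: bexI[where x = "_ + 1"])
  finally show ?thesis .
qed

lemma cycle_down_image_same:
  assumes "a \<le> b" "{a..b} \<subseteq> S \<or> {a..b} \<inter> S = {}"
  shows "cycle_down a b ` S = S"
proof -
  have 1: "cycle_down a b j \<in> S \<longleftrightarrow> j \<in> S" for j
    using assms by (auto simp: cycle_down_def disjoint_iff subset_iff)
  show ?thesis
  proof
    show "cycle_down a b ` S \<subseteq> S" using 1 by auto
    show "S \<subseteq> cycle_down a b ` S"
    proof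
      fix j assume "j \<in> S"
      moreover obtain i where "j = cycle_down a b i"
        using bij_cycle_down[OF assms(1)] unfolding bij_def surj_def by blast
      ultimately show "j \<in> cycle_down a b ` S" using 1 by auto
    qed
  qed
qed

definition type_3_pairs :: "(int \<times> int) set"
  where "type_3_pairs = {(a, b). b \<le> 0 \<and> 0 < a}"

text \<open>
  If some interval ends at a negative label, the intervals with the smallest right end are moved one
  step to the right; since the determinantal model only sees the sets of labels, this amounts to a
  cyclic relabelling of nonpositive labels, under which \<^term>\<open>type_3_pairs\<close> is stable.
\<close>

lemma expands_type_3:
  assumes "regular_exchange_system \<beta> e" "nested q k p" "1 \<le> q" "p q \<le> 0"
  shows "\<exists>C. expands True \<beta> e q k p type_3_pairs C"
  using assms
proof (induction "\<Sum>i = 1..q. nat (- (p i + int (k i)))" arbitrary: e p rule: less_induct)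
  case (less p e)
  interpret regular_exchange_system \<beta> e by fact
  note n = \<open>nested q k p\<close>
  have p_le: "p i \<le> 0" if "i \<in> {1..q}" for i
    using nested_le[OF n, of i q] that less.prems by auto
  show ?case
  proof (cases "0 \<le> p q + int (k q)")
    case True
    have "region q k p \<subseteq> type_3_pairs"
      using p_le by (fastforce simp: raise_region_def lower_region_def type_3_pairs_def)
    moreover have "\<forall>i \<in> {1..q}. 0 \<le> p i + int (k i)"
      using nested_le[OF n, of _ q] True by fastforce
    ultimately show ?thesis
      using expands_region[OF n] positive_span_mono unfolding expands_def by (metis subset_iff)
  next
    case False
    define t where "t = p q + int (k q)"
    let ?low = "\<lambda>i. p i + int (k i) = t"
    define p' where "p' = (\<lambda>i. if ?low i then p i + 1 else p i)"
    define s where "s = Min {i \<in> {1..q}. ?low i}"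
    have "s \<in> {i \<in> {1..q}. ?low i}"
      unfolding s_def using less.prems by (intro Min_in) (auto simp: t_def)
    then have s: "1 \<le> s" "s \<le> q" "?low s" by auto
    have low: "?low i \<longleftrightarrow> s \<le> i" if "i \<in> {1..q}" for i
    proof
      show "s \<le> i" if "?low i" unfolding s_def using that \<open>i \<in> {1..q}\<close> by (intro Min_le) auto
      show "?low i" if "s \<le> i"
        using nested_le[OF n, of s i] nested_le[OF n, of i q] that s \<open>i \<in> {1..q}\<close> by (auto simp: t_def)
    qed
    have t: "t \<le> -1" using False by (simp add: t_def)
    have high: "t + 1 \<le> p i + int (k i) \<and> p i \<le> p s" if "i \<in> {1..q}" "i < s" for i
      using nested_le[OF n, of i s] low[OF that(1)] that s by fastforce
    \<comment> \<open>\<open>\<sigma>\<close> slides the shifted low intervals back onto their old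
      labels. Every other interval contains the whole support \<open>{p s + 1..t + 1}\<close>, and
      the target intervals avoid it because \<open>t + 1 \<le> 0\<close>; both are therefore
      preserved as sets.\<close>
    define \<sigma> where "\<sigma> = cycle_down (p s + 1) (t + 1)"
    have pst: "p s + 1 \<le> t + 1" using s by simp
    have bij: "bij \<sigma>" unfolding \<sigma>_def by (rule bij_cycle_down[OF pst])
    have n': "nested q k p'"
      unfolding nested_def
    proof (intro allI impI)
      fix i assume i: "1 \<le> i \<and> i < q"
      then have a: "k (Suc i) < k i" "p i \<le> p (Suc i)" "p (Suc i) + int (k (Suc i)) \<le> p i + int (k i)"
        using n unfolding nested_def by auto
      moreover have "?low i \<Longrightarrow> ?low (Suc i)" "?low (Suc i) \<Longrightarrow> \<not> ?low i \<Longrightarrow> t < p i + int (k i)"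
        using low[of i] low[of "Suc i"] i a by auto
      ultimately show "k (Suc i) < k i \<and> p' i \<le> p' (Suc i) \<and> p' (Suc i) + int (k (Suc i)) \<le> p' i + int (k i)"
        unfolding p'_def by auto
    qed
    have sets: "\<sigma> ` {p' i<..p' i + int (k i)} = {p i<..p i + int (k i)}" if i: "i \<in> {1..q}" for i
    proof (cases "?low i")
      case True
      then have "\<sigma> ` {p i + 1<..t + 1} = {p i + 1 - 1<..t + 1 - 1}"
        unfolding \<sigma>_def using low[OF i] nested_le[OF n, of s i] i s
        by (intro cycle_down_image_shift) auto
      moreover have "{p' i<..p' i + int (k i)} = {p i + 1<..t + 1}"
        "{p i<..p i + int (k i)} = {p i + 1 - 1<..t + 1 - 1}"
        using True by (auto simp: p'_def)
      ultimately show ?thesis by (simp only:)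
    next
      case False
      then have "\<sigma> ` {p i<..p i + int (k i)} = {p i<..p i + int (k i)}"
        unfolding \<sigma>_def using low[OF i] high[OF i] pst
        by (intro cycle_down_image_same) auto
      then show ?thesis using False by (simp add: p'_def)
    qed
    let ?e' = "\<lambda>a b. e (\<sigma> a) (\<sigma> b)"
    note sys' = relabelled_system[OF \<open>regular_exchange_system \<beta> e\<close> bij]
    interpret e': regular_exchange_system \<beta> ?e' by (rule sys')
    have less': "(\<Sum>i = 1..q. nat (- (p' i + int (k i)))) < (\<Sum>i = 1..q. nat (- (p i + int (k i))))"
      using less.prems(3) t by (intro sum_strict_mono_ex1) (auto simp: p'_def t_def intro!: bexI[of _ q])
    have "p' q \<le> 0" using less.prems t by (auto simp: p'_def t_def)
    then obtain C where C: "expands True \<beta> ?e' q k p' type_3_pairs C"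
      using less.hyps[OF less' sys' n'] less.prems by blast
    obtain C0 where C0: "expands (\<forall>i \<in> {1..q}. 0 \<le> p i + int (k i)) \<beta> e q k p (region q k p) C0"
      using expands_region[OF n] by blast
    \<comment> \<open>\<open>C\<close> expands solutions for the relabelled weights,
      \<open>C0\<close> solutions for the original ones. With points and normalising label
      relabelled as well, the alternants of the two systems agree at the chain and at all targets,
      so independence identifies the coefficients and \<open>C0\<close> inherits positivity.\<close>
    have eq: "C m = C0 m" for m
    proof (cases "m \<in> smaller_shapes q k")
      case True
      have "C m - C0 m = 0"
      proof (rule model_base_independent[OF _ True, where D = "\<lambda>m. C m - C0 m"])
        fix v :: "nat \<Rightarrow> int"
        let ?v = "\<lambda>j. inv \<sigma> (v j)"
        have v: "\<sigma> (?v j) = v j" for j using bij by (simp add: bij_def surj_f_inv_f)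
        have "model \<beta> e (\<sigma> 0) q v k p = (\<Sum>m \<in> smaller_shapes q k. C0 m * model \<beta> e (\<sigma> 0) q v m (\<lambda>_. 0))"
          using C0 model_exchange_rules unfolding expands_def by blast
        moreover have "model \<beta> ?e' 0 q ?v k p' =
            (\<Sum>m \<in> smaller_shapes q k. C m * model \<beta> ?e' 0 q ?v m (\<lambda>_. 0))"
          using C e'.model_exchange_rules unfolding expands_def by blast
        moreover have "model_row \<beta> ?e' 0 k p' i u = model_row \<beta> e (\<sigma> 0) k p i (\<sigma> u)"
          if "i \<in> {1..q}" for i u by (intro model_row_relabel bij sets that)
        then have "model \<beta> ?e' 0 q ?v k p' = model \<beta> e (\<sigma> 0) q v k p"
          unfolding model_def alternant_def
          by (intro sum.cong prod.cong refl arg_cong2[where f = "(*)"]) (simp add: v)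
        moreover have "model \<beta> ?e' 0 q ?v m (\<lambda>_. 0) = model \<beta> e (\<sigma> 0) q v m (\<lambda>_. 0)" for m
        proof -
          have "\<sigma> ` {0<..0 + int (m i)} = {0<..0 + int (m i)}" for i
            unfolding \<sigma>_def using pst t by (intro cycle_down_image_same) auto
          then have "model_row \<beta> ?e' 0 m (\<lambda>_. 0) i u = model_row \<beta> e (\<sigma> 0) m (\<lambda>_. 0) i (\<sigma> u)" for i u
            by (intro model_row_relabel[OF bij]) simp
          then show ?thesis unfolding model_def by (simp add: v)
        qed
        ultimately show "(\<Sum>m \<in> smaller_shapes q k. (C m - C0 m) * model \<beta> e (\<sigma> 0) q v m (\<lambda>_. 0)) = 0"
          by (simp add: left_diff_distrib sum_subtractf)
      qed
      then show ?thesis by simp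
    next
      case False
      then show ?thesis using C C0 unfolding expands_def by simp
    qed
    have "map_prod \<sigma> \<sigma> ` type_3_pairs \<subseteq> type_3_pairs"
      using t pst by (auto simp: type_3_pairs_def \<sigma>_def cycle_down_def)
    then have "C m \<in> positive_span \<beta> e type_3_pairs" for m
      using C unfolding expands_def by (blast intro: positive_span_relabel[OF bij])
    then have "expands True \<beta> e q k p type_3_pairs C"
      using C0 unfolding expands_def eq by blast
    then show ?thesis by blast
  qed
qed

definition type_1_pairs :: "(int \<times> int) set"
  where "type_1_pairs = {(a, b). 0 < a \<and> a < b}"

text \<open>The last right end is the smallest. If \<open>p q\<close> is positive, then all right
  ends are positive and the stepwise expansion is already positive; relabelling is reserved for
  \<open>p q \<le> 0\<close>.\<close>

theorem nested_expansion:
  assumes sys: "regular_exchange_system \<beta> e" and n: "nested q k p" and q: "1 \<le> q"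
  obtains C where "expands True \<beta> e q k p (type_1_pairs \<union> type_3_pairs) C"
    and "p q \<le> 0 \<Longrightarrow> expands True \<beta> e q k p type_3_pairs C"
proof -
  interpret regular_exchange_system \<beta> e by fact
  show ?thesis
  proof (cases "p q \<le> 0")
    case True
    then obtain C where C: "expands True \<beta> e q k p type_3_pairs C"
      using expands_type_3[OF sys n q] by blast
    then have "expands True \<beta> e q k p (type_1_pairs \<union> type_3_pairs) C"
      by (rule expands_same) auto
    then show ?thesis using that C by blast
  next
    case False
    obtain C where C: "expands (\<forall>i \<in> {1..q}. 0 \<le> p i + int (k i)) \<beta> e q k p (region q k p) C"
      using expands_region[OF n] by blast
    have "\<forall>i \<in> {1..q}. 0 \<le> p i + int (k i)"
      using nested_le[OF n, of _ q] False by fastforce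
    moreover have "region q k p \<subseteq> type_1_pairs \<union> type_3_pairs"
      by (fastforce simp: raise_region_def lower_region_def type_3_pairs_def type_1_pairs_def)
    ultimately have "expands True \<beta> e q k p (type_1_pairs \<union> type_3_pairs) C"
      using C positive_span_mono unfolding expands_def by (metis subset_iff)
    then show ?thesis using that False by blast
  qed
qed

section \<open>Power series\<close>

lemma mcoeff_0 [simp]: "mcoeff 0 m = 0"
  by transfer simp

lemma mcoeff_1: "mcoeff 1 m = (if m = {#} then 1 else 0)"
  by transfer simp

lemma mcoeff_add [simp]: "mcoeff (f + g) m = mcoeff f m + mcoeff g m"
  by transfer simp

lemma mcoeff_diff [simp]: "mcoeff (f - g) m = mcoeff f m - mcoeff g m"
  by transfer simp

lemma mcoeff_minus [simp]: "mcoeff (- f) m = - mcoeff f m"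
  by transfer simp

lemma mcoeff_mult: "mcoeff (f * g) m = (\<Sum>p | p \<subseteq># m. mcoeff f p * mcoeff g (m - p))"
  by transfer simp

lemma mcoeff_Abs [simp]: "mcoeff (Abs_mfps f) = f"
  by (simp add: Abs_mfps_inverse)

lemma mcoeff_sum: "mcoeff (\<Sum>i \<in> I. f i) m = (\<Sum>i \<in> I. mcoeff (f i) m)"
  by (induction I rule: infinite_finite_induct) auto

lemma mcoeff_mconst: "mcoeff (mconst c) m = (if m = {#} then c else 0)"
  by (simp add: mconst_def)

lemma mcoeff_mvar: "mcoeff (mvar v) m = (if m = {#v#} then 1 else 0)"
  by (simp add: mvar_def)

lemma mcoeff_mconst_mult [simp]: "mcoeff (mconst c * f) m = c * mcoeff f m"
proof -
  have "mcoeff (mconst c * f) m = (\<Sum>p | p \<subseteq># m. if p = {#} then c * mcoeff f m else 0)"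
    unfolding mcoeff_mult by (intro sum.cong) (auto simp: mcoeff_mconst)
  then show ?thesis by (simp add: finite_submultisets)
qed

lemma mcoeff_mvar_mult [simp]:
  "mcoeff (mvar v * f) m = (if v \<in># m then mcoeff f (m - {#v#}) else 0)"
proof -
  have "mcoeff (mvar v * f) m =
      (\<Sum>p | p \<subseteq># m. if p = {#v#} then mcoeff f (m - {#v#}) else 0)"
    unfolding mcoeff_mult by (intro sum.cong) (auto simp: mcoeff_mvar)
  then show ?thesis by (simp add: finite_submultisets)
qed

lemma mconst_mult: "mconst (a * b) = mconst a * mconst b"
  by (rule mfps_eqI) (simp add: mcoeff_mconst)

lemma mconst_1: "mconst 1 = 1"
  by (rule mfps_eqI) (simp add: mcoeff_mconst mcoeff_1)

lemma mconst_power: "mconst (a ^ n) = mconst a ^ n"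
  by (induction n) (simp_all add: mconst_mult mconst_1)

lemma mconst_uminus_1: "mconst (- 1) = - 1"
  by (rule mfps_eqI) (simp add: mcoeff_mconst mcoeff_1)

lemma mfps_sum_mcoeff:
  "mcoeff (mfps_sum f I) m = (\<Sum>i | i \<in> I \<and> mcoeff (f i) m \<noteq> 0. mcoeff (f i) m)"
  by (simp add: mfps_sum_def)

section \<open>Summable families of series\<close>

definition mfps_summable :: "('i \<Rightarrow> ('v, 'a::comm_monoid_add) mfps) \<Rightarrow> 'i set \<Rightarrow> bool"
  where "mfps_summable f I \<longleftrightarrow> (\<forall>m. finite {i \<in> I. mcoeff (f i) m \<noteq> 0})"

lemma mcoeff_mfps_sum_superset:
  assumes "finite J" "{i \<in> I. mcoeff (f i) m \<noteq> 0} \<subseteq> J" "J \<subseteq> I"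
  shows "mcoeff (mfps_sum f I) m = (\<Sum>i \<in> J. mcoeff (f i) m)"
  unfolding mfps_sum_mcoeff using assms by (intro sum.mono_neutral_left) auto

lemma mfps_sum_cong: "I = J \<Longrightarrow> (\<And>i. i \<in> J \<Longrightarrow> f i = g i) \<Longrightarrow> mfps_sum f I = mfps_sum g J"
  by (rule mfps_eqI) (auto simp: mfps_sum_mcoeff intro!: sum.cong)

lemma mfps_sum_finite:
  assumes "finite I"
  shows "mfps_sum f I = (\<Sum>i \<in> I. f i)"
proof (rule mfps_eqI)
  fix m
  show "mcoeff (mfps_sum f I) m = mcoeff (\<Sum>i \<in> I. f i) m"
    using assms by (subst mcoeff_mfps_sum_superset[of I]) (auto simp: mcoeff_sum)
qed

lemma mfps_sum_support:
  assumes "\<And>i. i \<in> I - J \<Longrightarrow> f i = 0" "J \<subseteq> I"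
  shows "mfps_sum f I = mfps_sum f J"
proof (rule mfps_eqI)
  fix m
  have "mcoeff (f i) m = 0" if "i \<in> I" "i \<notin> J" for i
    using assms(1)[of i] that by simp
  then have "{i. i \<in> I \<and> mcoeff (f i) m \<noteq> 0} = {i. i \<in> J \<and> mcoeff (f i) m \<noteq> 0}"
    using assms(2) by blast
  then show "mcoeff (mfps_sum f I) m = mcoeff (mfps_sum f J) m"
    by (simp add: mfps_sum_mcoeff)
qed

lemma mfps_summable_subset: "mfps_summable f I \<Longrightarrow> J \<subseteq> I \<Longrightarrow> mfps_summable f J"
  unfolding mfps_summable_def by (fast elim: finite_subset[rotated])

lemma mfps_sum_Un:
  assumes "mfps_summable f I" "mfps_summable f J" "I \<inter> J = {}"
  shows "mfps_sum f (I \<union> J) = mfps_sum f I + mfps_sum f J"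
proof (rule mfps_eqI)
  fix m
  let ?s = "\<lambda>I. {i. i \<in> I \<and> mcoeff (f i) m \<noteq> 0}"
  have "?s (I \<union> J) = ?s I \<union> ?s J" by auto
  then show "mcoeff (mfps_sum f (I \<union> J)) m = mcoeff (mfps_sum f I + mfps_sum f J) m"
    using assms unfolding mfps_sum_mcoeff mcoeff_add mfps_summable_def
    by (simp add: sum.union_disjoint disjoint_iff)
qed

lemma mfps_sum_diff:
  fixes f g :: "'i \<Rightarrow> ('v, 'a::comm_ring_1) mfps"
  assumes "mfps_summable f I" "mfps_summable g I"
  shows "mfps_sum (\<lambda>i. f i - g i) I = mfps_sum f I - mfps_sum g I"
proof (rule mfps_eqI)
  fix m
  let ?s = "\<lambda>f :: 'i \<Rightarrow> ('v, 'a) mfps. {i \<in> I. mcoeff (f i) m \<noteq> 0}"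
  have fin: "finite (?s f \<union> ?s g)" using assms by (simp add: mfps_summable_def)
  have "mcoeff (mfps_sum h I) m = (\<Sum>i \<in> ?s f \<union> ?s g. mcoeff (h i) m)" if "?s h \<subseteq> ?s f \<union> ?s g" for h
    using fin that by (intro mcoeff_mfps_sum_superset) auto
  from this[of "\<lambda>i. f i - g i"] this[of f] this[of g]
  show "mcoeff (mfps_sum (\<lambda>i. f i - g i) I) m = mcoeff (mfps_sum f I - mfps_sum g I) m"
    by (fastforce simp: sum_subtractf)
qed

lemma mfps_sum_reindex:
  assumes "bij_betw h J I" "\<And>j. j \<in> J \<Longrightarrow> f (h j) = g j"
  shows "mfps_sum f I = mfps_sum g J"
proof (rule mfps_eqI)
  fix m
  show "mcoeff (mfps_sum f I) m = mcoeff (mfps_sum g J) m"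
  proof -
    have "bij_betw h {i. i \<in> J \<and> mcoeff (g i) m \<noteq> 0} {i. i \<in> I \<and> mcoeff (f i) m \<noteq> 0}"
      using assms by (fastforce simp: bij_betw_def inj_on_def image_iff)
    then have "(\<Sum>i | i \<in> I \<and> mcoeff (f i) m \<noteq> 0. mcoeff (f i) m)
        = (\<Sum>i | i \<in> J \<and> mcoeff (g i) m \<noteq> 0. mcoeff (f (h i)) m)"
      by (rule sum.reindex_bij_betw[symmetric])
    also have "\<dots> = (\<Sum>i | i \<in> J \<and> mcoeff (g i) m \<noteq> 0. mcoeff (g i) m)"
      using assms by (intro sum.cong) auto
    finally show ?thesis by (simp add: mfps_sum_mcoeff)
  qed
qed

lemma mfps_summable_mult_support:
  assumes "mfps_summable f I"
  shows "finite {i \<in> I. \<exists>p. p \<subseteq># m \<and> mcoeff (f i) (m - p) \<noteq> 0}"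
proof -
  have "{i \<in> I. \<exists>p. p \<subseteq># m \<and> mcoeff (f i) (m - p) \<noteq> 0} =
      (\<Union>p \<in> {p. p \<subseteq># m}. {i \<in> I. mcoeff (f i) (m - p) \<noteq> 0})" by auto
  then show ?thesis using assms by (simp add: finite_submultisets mfps_summable_def)
qed

lemma mcoeff_mult_nonzero:
  assumes "mcoeff (c * f) m \<noteq> 0"
  obtains p where "p \<subseteq># m" "mcoeff c p \<noteq> 0" "mcoeff f (m - p) \<noteq> 0"
proof -
  have "\<exists>p \<in> {p. p \<subseteq># m}. mcoeff c p * mcoeff f (m - p) \<noteq> 0"
    using assms unfolding mcoeff_mult by (meson sum.neutral)
  then show ?thesis using that by force
qed

lemma mfps_summable_mult:
  assumes "mfps_summable f I"
  shows "mfps_summable (\<lambda>i. c i * f i) I"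
  unfolding mfps_summable_def
proof
  fix m
  have "{i \<in> I. mcoeff (c i * f i) m \<noteq> 0} \<subseteq> {i \<in> I. \<exists>p. p \<subseteq># m \<and> mcoeff (f i) (m - p) \<noteq> 0}"
    by (auto elim: mcoeff_mult_nonzero)
  then show "finite {i \<in> I. mcoeff (c i * f i) m \<noteq> 0}"
    using mfps_summable_mult_support[OF assms] finite_subset by blast
qed

lemma mfps_sum_mult:
  assumes "mfps_summable f I"
  shows "mfps_sum (\<lambda>i. c * f i) I = c * mfps_sum f I"
proof (rule mfps_eqI)
  fix m
  let ?J = "{i \<in> I. \<exists>p. p \<subseteq># m \<and> mcoeff (f i) (m - p) \<noteq> 0}"
  have fin: "finite ?J" by (rule mfps_summable_mult_support[OF assms])
  have "mcoeff (mfps_sum (\<lambda>i. c * f i) I) m = (\<Sum>i \<in> ?J. mcoeff (c * f i) m)"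
    using fin by (intro mcoeff_mfps_sum_superset) (auto elim: mcoeff_mult_nonzero)
  also have "\<dots> = (\<Sum>p | p \<subseteq># m. \<Sum>i \<in> ?J. mcoeff c p * mcoeff (f i) (m - p))"
    unfolding mcoeff_mult by (rule sum.swap)
  also have "\<dots> = (\<Sum>p | p \<subseteq># m. mcoeff c p * mcoeff (mfps_sum f I) (m - p))"
    unfolding sum_distrib_left[symmetric]
    using fin by (intro sum.cong refl arg_cong2[where f = "(*)"] mcoeff_mfps_sum_superset[symmetric]) auto
  finally show "mcoeff (mfps_sum (\<lambda>i. c * f i) I) m = mcoeff (c * mfps_sum f I) m"
    by (simp add: mcoeff_mult)
qed

section \<open>Reciprocals, regular elements and order\<close>

lemma recip_eqI:
  assumes "f * g = (1 :: 'r::comm_ring_1)"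
  shows "recip f = g"
  unfolding recip_def
proof (rule the_equality)
  fix h assume "f * h = 1"
  then have "h = (f * g) * h" using assms by simp
  also have "\<dots> = g * (f * h)" by (simp only: ac_simps)
  finally show "h = g" using \<open>f * h = 1\<close> by simp
qed (rule assms)

lemma one_plus_const_mvar_invertible:
  "(1 + mconst c * mvar v) * Abs_mfps (\<lambda>m. if set_mset m \<subseteq> {v} then (- c) ^ size m else 0) = 1"
proof (rule mfps_eqI)
  fix m
  show "mcoeff ((1 + mconst c * mvar v) * Abs_mfps (\<lambda>m. if set_mset m \<subseteq> {v} then (- c) ^ size m else 0)) m
      = mcoeff 1 m"
  proof (cases "m = {#}")
    case True
    then show ?thesis by (simp add: distrib_right mult.assoc mcoeff_1)
  next
    case m: False
    show ?thesis
    proof (cases "v \<in># m")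
      case True
      then obtain m' where "m = add_mset v m'" by (metis multi_member_split)
      then show ?thesis by (auto simp: distrib_right mult.assoc mcoeff_1)
    next
      case False
      then have "\<not> set_mset m \<subseteq> {v}" using m by (metis multiset_nonemptyE singletonD subsetD)
      then show ?thesis using False m by (simp add: distrib_right mult.assoc mcoeff_1)
    qed
  qed
qed

lemma recip_one_plus_mvar:
  "(1 + mconst c * mvar v) * recip (1 + mconst c * mvar v) = 1"
  unfolding recip_eqI[OF one_plus_const_mvar_invertible] by (rule one_plus_const_mvar_invertible)

text \<open>Comparing coefficients at \<open>add_mset u m\<close> trades one \<open>v\<close> in
  \<open>m\<close> for one \<open>u\<close>. Once no \<open>v\<close> is left, the same comparison
  gives 0.\<close>

lemma mvar_diff_regular:
  fixes f :: "('v, 'a::comm_ring_1) mfps"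
  assumes "u \<noteq> v" "(mvar u - mvar v) * f = 0"
  shows "f = 0"
proof (rule mfps_eqI)
  fix m
  have eq: "(if u \<in># m then mcoeff f (m - {#u#}) else 0) = (if v \<in># m then mcoeff f (m - {#v#}) else 0)"
    for m
    using arg_cong[OF assms(2), of "\<lambda>f. mcoeff f m"] by (simp add: left_diff_distrib)
  have "mcoeff f m = 0" if "count m v = n" for n
    using that
  proof (induction n arbitrary: m)
    case 0
    then show ?case using eq[of "add_mset u m"] assms(1) by (auto simp: count_eq_zero_iff)
  next
    case (Suc n)
    then have "v \<in># m" by (metis count_inI nat.distinct(1))
    then have "mcoeff f m = mcoeff f (add_mset u m - {#v#})"
      using eq[of "add_mset u m"] assms(1) by simp
    also have "\<dots> = 0" using Suc assms(1) by (intro Suc.IH) simp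
    finally show ?case .
  qed
  then show "mcoeff f m = mcoeff 0 m" by simp
qed

definition order_ge :: "nat \<Rightarrow> ('v, 'a::zero) mfps \<Rightarrow> bool"
  where "order_ge n f \<longleftrightarrow> (\<forall>m. mcoeff f m \<noteq> 0 \<longrightarrow> n \<le> size m)"

lemma order_ge_0 [simp]: "order_ge 0 f"
  by (simp add: order_ge_def)

lemma order_ge_mult:
  assumes "order_ge a f" "order_ge b g"
  shows "order_ge (a + b) (f * g)"
  unfolding order_ge_def
proof (intro allI impI)
  fix m assume "mcoeff (f * g) m \<noteq> 0"
  then obtain p where p: "p \<subseteq># m" "mcoeff f p \<noteq> 0" "mcoeff g (m - p) \<noteq> 0"
    by (rule mcoeff_mult_nonzero)
  then have "a \<le> size p" "b \<le> size (m - p)" using assms by (auto simp: order_ge_def)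
  then show "a + b \<le> size m" using p(1) by (simp add: size_Diff_submset size_mset_mono le_diff_conv2)
qed

lemma order_ge_prod:
  "(\<And>i. i \<in> I \<Longrightarrow> order_ge (a i) (f i)) \<Longrightarrow> order_ge (\<Sum>i \<in> I. a i) (\<Prod>i \<in> I. f i)"
  by (induction I rule: infinite_finite_induct) (auto intro: order_ge_mult)

section \<open>Weights and coefficients\<close>

lemma beta0_nonzero: "beta0 \<noteq> 0"
  unfolding beta0_def by (simp add: Zero_fract_def eq_fract)

lemma recip_xvar: "(1 + beta * xvar i) * recip (1 + beta * xvar i) = 1"
  unfolding beta_def xvar_def by (rule recip_one_plus_mvar)

lemma recip_yvar: "(1 + beta * yvar i) * recip (1 + beta * yvar i) = 1"
  unfolding beta_def yvar_def by (rule recip_one_plus_mvar)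

lemma one_plus_ominus:
  assumes "(1 + beta * b) * recip (1 + beta * b) = 1"
  shows "1 + beta * ominus a b = (1 + beta * a) * recip (1 + beta * b)"
proof -
  have "1 + beta * ominus a b = (1 + beta * b) * recip (1 + beta * b)
      + beta * (a - b) * recip (1 + beta * b)"
    unfolding assms by (simp add: ominus_def ac_simps)
  then show ?thesis by (simp add: algebra_simps)
qed

lemma mconst_inverse_mult: "c \<noteq> (0 :: ratbeta) \<Longrightarrow> mconst (inverse c) * mconst c = 1"
  by (simp add: mconst_mult[symmetric] mconst_1)

lemma beta_cancel: "beta * f = beta * g \<Longrightarrow> f = g"
proof -
  assume "beta * f = beta * g"
  then have "mconst (inverse beta0) * beta * f = mconst (inverse beta0) * beta * g"
    by (simp add: mult.assoc)
  then show "f = g" by (simp add: beta_def mconst_inverse_mult[OF beta0_nonzero])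
qed

text \<open>\<open>1 + beta * ominus a b\<close> is the quotient of \<open>1 + beta * a\<close> by
  \<open>1 + beta * b\<close>; the identity is the multiplicativity of such quotients with
  \<open>beta\<close> cancelled.\<close>

lemma ominus_trans:
  assumes b: "(1 + beta * b) * recip (1 + beta * b) = 1" and c: "(1 + beta * c) * recip (1 + beta * c) = 1"
  shows "ominus a c = ominus a b + ominus b c + beta * ominus a b * ominus b c"
proof (rule beta_cancel)
  have "1 + beta * ominus a c =
      (1 + beta * a) * recip (1 + beta * c) * ((1 + beta * b) * recip (1 + beta * b))"
    unfolding one_plus_ominus[OF c] b by simp
  also have "\<dots> = (1 + beta * ominus a b) * (1 + beta * ominus b c)"
    unfolding one_plus_ominus[OF c] one_plus_ominus[OF b] by (simp only: ac_simps)
  finally show "beta * ominus a c = beta * (ominus a b + ominus b c + beta * ominus a b * ominus b c)"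
    by (simp add: algebra_simps)
qed

lemma ominus_self [simp]: "ominus a a = 0"
  by (simp add: ominus_def)

lemma ominus_yvar_regular:
  assumes "i \<noteq> j" "ominus (yvar i) (yvar j) * f = 0"
  shows "f = 0"
proof -
  have "(yvar i - yvar j) * f =
      (yvar i - yvar j) * ((1 + beta * yvar j) * recip (1 + beta * yvar j)) * f"
    unfolding recip_yvar by simp
  also have "\<dots> = (1 + beta * yvar j) * (ominus (yvar i) (yvar j) * f)"
    by (simp only: ominus_def ac_simps)
  also have "\<dots> = 0" using assms by simp
  finally have "(mvar (Y i) - mvar (Y j)) * f = 0" by (simp only: yvar_def)
  moreover have "Y i \<noteq> Y j" using assms(1) by simp
  ultimately show ?thesis by (rule mvar_diff_regular[rotated])
qed

section \<open>The exchange systems of the two sides of the diagonal\<close>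

definition upper_weight :: "int \<Rightarrow> int \<Rightarrow> series"
  where "upper_weight a b = ominus (yvar a) (yvar b)"

text \<open>The reflection of labels j to 1 - j swaps positive and nonpositive labels and reverses
  the order. So one combinatorial theorem serves both sides: Type 1 becomes Type 2, and Type 3 is
  preserved.\<close>

definition lower_weight :: "int \<Rightarrow> int \<Rightarrow> series"
  where "lower_weight a b = ominus (yvar (1 - b)) (yvar (1 - a))"

lemma upper_system: "regular_exchange_system beta upper_weight"
proof
  show "upper_weight a c = upper_weight a b + upper_weight b c + beta * upper_weight a b * upper_weight b c"
    for a b c unfolding upper_weight_def by (rule ominus_trans; rule recip_yvar)
  show "a \<noteq> b \<Longrightarrow> upper_weight a b * x = 0 \<Longrightarrow> x = 0" for a b x
    unfolding upper_weight_def by (rule ominus_yvar_regular)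
qed (simp add: upper_weight_def)

lemma lower_system: "regular_exchange_system beta lower_weight"
proof
  show "lower_weight a c = lower_weight a b + lower_weight b c + beta * lower_weight a b * lower_weight b c"
    for a b c
    using ominus_trans[OF recip_yvar[of "1 - b"] recip_yvar[of "1 - a"], of "yvar (1 - c)"]
    unfolding lower_weight_def by (simp only: ac_simps)
  show "a \<noteq> b \<Longrightarrow> lower_weight a b * x = 0 \<Longrightarrow> x = 0" for a b x
    unfolding lower_weight_def by (erule ominus_yvar_regular[rotated]) simp
qed (simp add: lower_weight_def)

lemma coeff_ring_1: "1 \<in> coeff_ring"
  using coeff_ring.const[of 1] by (simp add: mconst_1)

lemma coeff_ring_0: "0 \<in> coeff_ring"
proof -
  have "mconst 0 = (0 :: series)" by (rule mfps_eqI) (simp add: mcoeff_mconst)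
  then show ?thesis using coeff_ring.const[of 0] by simp
qed

lemma coeff_ring_beta: "beta \<in> coeff_ring"
  unfolding beta_def by (rule coeff_ring.const)

lemma coeff_ring_minus: "f \<in> coeff_ring \<Longrightarrow> - f \<in> coeff_ring"
  using coeff_ring.mult[OF coeff_ring.const[of "- 1"], of f] by (simp add: mconst_uminus_1)

lemma coeff_ring_diff: "f \<in> coeff_ring \<Longrightarrow> g \<in> coeff_ring \<Longrightarrow> f - g \<in> coeff_ring"
  using coeff_ring.add[OF _ coeff_ring_minus, of f g] by simp

lemma coeff_ring_ominus_xy: "ominus (xvar i) (yvar j) \<in> coeff_ring"
  and coeff_ring_ominus_yx: "ominus (yvar j) (xvar i) \<in> coeff_ring"
  unfolding ominus_def
  by (intro coeff_ring.mult coeff_ring_diff coeff_ring.intros)+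

lemma coeff_ring_one_plus: "f \<in> coeff_ring \<Longrightarrow> 1 + beta * f \<in> coeff_ring"
  by (intro coeff_ring.add coeff_ring.mult coeff_ring_1 coeff_ring_beta)

lemma one_plus_ominus_inverse:
  "(1 + beta * ominus (yvar j) (xvar i)) * (1 + beta * ominus (xvar i) (yvar j)) = 1"
proof -
  have "(1 + beta * ominus (yvar j) (xvar i)) * (1 + beta * ominus (xvar i) (yvar j)) =
      ((1 + beta * yvar j) * recip (1 + beta * yvar j)) * ((1 + beta * xvar i) * recip (1 + beta * xvar i))"
    unfolding one_plus_ominus[OF recip_xvar] one_plus_ominus[OF recip_yvar] by (simp only: ac_simps)
  then show ?thesis by (simp only: recip_xvar recip_yvar mult_1_left)
qed

subsection \<open>Substituting y for x\<close>

text \<open>A preimage has the size of \<open>m\<close> and uses only \<open>X i\<close> and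
  \<open>Y i\<close> with \<open>Y i\<close> in \<open>m\<close>. Hence the coefficient sums in
  \<open>x_to_y\<close> are honest finite sums.\<close>

lemma finite_x_to_y_fibre: "finite {p. image_mset x_to_y_var p = m}"
proof -
  let ?V = "X ` {i. Y i \<in># m} \<union> Y ` {i. Y i \<in># m}"
  have fin: "finite {i. Y i \<in># m}"
    by (rule finite_imageD[where f = Y]) (auto intro: finite_subset[of _ "set_mset m"] simp: inj_on_def)
  have "{p. image_mset x_to_y_var p = m} \<subseteq> {p. set_mset p \<subseteq> ?V \<and> size p = size m}"
  proof
    fix p assume p: "p \<in> {p. image_mset x_to_y_var p = m}"
    have "v \<in> ?V" if "v \<in># p" for v
    proof -
      have "x_to_y_var v \<in># m" using that p by force
      then show ?thesis by (cases v) auto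
    qed
    then show "p \<in> {p. set_mset p \<subseteq> ?V \<and> size p = size m}" using p by auto
  qed
  moreover have "finite {p. set_mset p \<subseteq> ?V \<and> size p = size m}"
  proof (rule finite_subset)
    show "finite (mset ` {xs. set xs \<subseteq> ?V \<and> length xs = size m})"
      using fin by (intro finite_imageI finite_lists_length_eq) auto
    show "{p. set_mset p \<subseteq> ?V \<and> size p = size m} \<subseteq> mset ` {xs. set xs \<subseteq> ?V \<and> length xs = size m}"
    proof
      fix p assume p: "p \<in> {p. set_mset p \<subseteq> ?V \<and> size p = size m}"
      obtain xs where "p = mset xs" using ex_mset by metis
      then show "p \<in> mset ` {xs. set xs \<subseteq> ?V \<and> length xs = size m}" using p by auto
    qed
  qed
  ultimately show ?thesis using finite_subset by blast
qed

lemma x_to_y_coeff: "mcoeff (x_to_y f) m = (\<Sum>p | image_mset x_to_y_var p = m. mcoeff f p)"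
  by (simp add: x_to_y_def)

lemma x_to_y_add: "x_to_y (f + g) = x_to_y f + x_to_y g"
  by (rule mfps_eqI) (simp add: x_to_y_coeff sum.distrib)

lemma x_to_y_0: "x_to_y 0 = 0"
  by (rule mfps_eqI) (simp add: x_to_y_coeff)

lemma x_to_y_mult: "x_to_y (f * g) = x_to_y f * x_to_y g"
proof (rule mfps_eqI)
  fix m
  let ?h = "image_mset x_to_y_var"
  have "mcoeff (x_to_y (f * g)) m =
      (\<Sum>(p, r) \<in> (SIGMA p:{p. ?h p = m}. {r. r \<subseteq># p}). mcoeff f r * mcoeff g (p - r))"
    by (simp add: x_to_y_coeff mcoeff_mult sum.Sigma finite_x_to_y_fibre finite_submultisets)
  also have "\<dots> = (\<Sum>(s, r, t) \<in> (SIGMA s:{s. s \<subseteq># m}. {r. ?h r = s} \<times> {t. ?h t = m - s}).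
      mcoeff f r * mcoeff g t)"
  proof (rule sum.reindex_bij_witness
      [where j = "\<lambda>(p, r). (?h r, r, p - r)" and i = "\<lambda>(s, r, t). (r + t, r)"])
    fix x assume "x \<in> (SIGMA p:{p. ?h p = m}. {r. r \<subseteq># p})"
    then obtain p r where x: "x = (p, r)" "?h p = m" "r \<subseteq># p" by auto
    have "?h (p - r) = m - ?h r" using image_mset_Diff[OF x(3), of x_to_y_var] x(2) by simp
    moreover have "?h r \<subseteq># m" using image_mset_subseteq_mono[OF x(3), of x_to_y_var] x(2) by simp
    ultimately show "(case x of (p, r) \<Rightarrow> (?h r, r, p - r))
        \<in> (SIGMA s:{s. s \<subseteq># m}. {r. ?h r = s} \<times> {t. ?h t = m - s})"
      using x(1) by simp
    show "(case case x of (p, r) \<Rightarrow> (?h r, r, p - r) of (s, r, t) \<Rightarrow> (r + t, r)) = x"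
      using x by simp
    show "(case case x of (p, r) \<Rightarrow> (?h r, r, p - r) of (s, r, t) \<Rightarrow> mcoeff f r * mcoeff g t)
        = (case x of (p, r) \<Rightarrow> mcoeff f r * mcoeff g (p - r))"
      using x by simp
  next
    fix y assume "y \<in> (SIGMA s:{s. s \<subseteq># m}. {r. ?h r = s} \<times> {t. ?h t = m - s})"
    then obtain s r t where y: "y = (s, r, t)" "s \<subseteq># m" "?h r = s" "?h t = m - s" by auto
    then show "(case y of (s, r, t) \<Rightarrow> (r + t, r)) \<in> (SIGMA p:{p. ?h p = m}. {r. r \<subseteq># p})"
      "(case case y of (s, r, t) \<Rightarrow> (r + t, r) of (p, r) \<Rightarrow> (?h r, r, p - r)) = y"
      by simp_all
  qed
  also have "\<dots> = (\<Sum>s | s \<subseteq># m. (\<Sum>(r, t) \<in> {r. ?h r = s} \<times> {t. ?h t = m - s}. mcoeff f r * mcoeff g t))"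
    by (simp add: sum.Sigma finite_submultisets finite_x_to_y_fibre)
  also have "\<dots> = (\<Sum>s | s \<subseteq># m. mcoeff (x_to_y f) s * mcoeff (x_to_y g) (m - s))"
    by (simp add: sum.cartesian_product[symmetric] x_to_y_coeff sum_product)
  finally show "mcoeff (x_to_y (f * g)) m = mcoeff (x_to_y f * x_to_y g) m"
    by (simp add: mcoeff_mult)
qed

lemma x_to_y_mconst: "x_to_y (mconst c) = mconst c"
proof (rule mfps_eqI)
  fix m
  have "mcoeff (x_to_y (mconst c)) m =
      (\<Sum>p | image_mset x_to_y_var p = m. if p = {#} then if m = {#} then c else 0 else 0)"
    unfolding x_to_y_coeff by (intro sum.cong) (auto simp: mcoeff_mconst)
  then show "mcoeff (x_to_y (mconst c)) m = mcoeff (mconst c) m"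
    by (auto simp: mcoeff_mconst finite_x_to_y_fibre)
qed

lemma x_to_y_1: "x_to_y 1 = 1"
  using x_to_y_mconst[of 1] by (simp add: mconst_1)

lemma x_to_y_beta: "x_to_y beta = beta"
  by (simp add: beta_def x_to_y_mconst)

lemma x_to_y_mvar: "x_to_y (mvar v) = mvar (x_to_y_var v)"
proof (rule mfps_eqI)
  fix m
  have "mcoeff (x_to_y (mvar v)) m =
      (\<Sum>p | image_mset x_to_y_var p = m. if p = {#v#} then if m = {#x_to_y_var v#} then 1 else 0 else 0)"
    unfolding x_to_y_coeff by (intro sum.cong) (auto simp: mcoeff_mvar)
  then show "mcoeff (x_to_y (mvar v)) m = mcoeff (mvar (x_to_y_var v)) m"
    by (auto simp: mcoeff_mvar finite_x_to_y_fibre)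
qed

lemma x_to_y_diff: "x_to_y (f - g) = x_to_y f - x_to_y g"
  by (rule mfps_eqI) (simp add: x_to_y_coeff sum_subtractf)

lemma x_to_y_ominus: "x_to_y (ominus (xvar i) (yvar j)) = upper_weight i j"
proof -
  have x: "x_to_y (xvar i) = yvar i" and y: "x_to_y (yvar j) = yvar j"
    by (simp_all add: xvar_def yvar_def x_to_y_mvar)
  \<comment> \<open>Reciprocals pass through the substitution because inverses are unique.\<close>
  have "(1 + beta * yvar j) * x_to_y (recip (1 + beta * yvar j)) = 1"
    using arg_cong[OF recip_yvar[of j], of x_to_y]
    by (simp add: x_to_y_mult x_to_y_add x_to_y_1 x_to_y_beta y)
  then have "recip (1 + beta * yvar j) = x_to_y (recip (1 + beta * yvar j))"
    by (rule recip_eqI)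
  then show ?thesis
    by (simp add: ominus_def upper_weight_def x_to_y_mult x_to_y_diff x y)
qed

section \<open>Bounded set-valued tableaux\<close>

definition young :: "(nat \<times> nat) set \<Rightarrow> bool"
  where "young D \<longleftrightarrow> finite D \<and> (\<forall>(r, c) \<in> D. 1 \<le> r \<and> 1 \<le> c) \<and>
    (\<forall>r c r' c'. (r, c) \<in> D \<longrightarrow> 1 \<le> r' \<longrightarrow> r' \<le> r \<longrightarrow> 1 \<le> c' \<longrightarrow> c' \<le> c \<longrightarrow> (r', c') \<in> D)"

definition corner :: "(nat \<times> nat) set \<Rightarrow> nat \<Rightarrow> nat \<Rightarrow> bool"
  where "corner D r c \<longleftrightarrow> (r, c) \<in> D \<and> (Suc r, c) \<notin> D \<and> (r, Suc c) \<notin> D"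

text \<open>Bounds are attached to single cells, because the recursion changes the bound of one
  corner and thereby leaves the class of flagged functions.\<close>

definition tableaux ::
    "(nat \<times> nat) set \<Rightarrow> (nat \<times> nat \<Rightarrow> int) \<Rightarrow> (nat \<times> nat \<Rightarrow> int set) set"
  where "tableaux D B = {T \<in> ssvt D. \<forall>u \<in> D. Max (T u) \<le> B u}"

definition G :: "(nat \<times> nat) set \<Rightarrow> (nat \<times> nat \<Rightarrow> int) \<Rightarrow> series"
  where "G D B = mfps_sum (wt D) (tableaux D B)"

definition cell_weight :: "nat \<times> nat \<Rightarrow> int set \<Rightarrow> series"
  where "cell_weight u S = (\<Prod>i \<in> S. beta * ominus (xvar i) (yvar (i + int (snd u) - int (fst u))))"

lemma wt_cell_weight: "wt D T = mconst (inverse beta0 ^ card D) * (\<Prod>u \<in> D. cell_weight u (T u))"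
  unfolding wt_def cell_weight_def by (simp add: case_prod_beta)

lemma G_cong: "tableaux D B = tableaux D B' \<Longrightarrow> G D B = G D B'"
  by (simp add: G_def)

lemma youngD: "young D \<Longrightarrow> finite D" "young D \<Longrightarrow> (r, c) \<in> D \<Longrightarrow> 1 \<le> r \<and> 1 \<le> c"
  "young D \<Longrightarrow> (r, c) \<in> D \<Longrightarrow> 1 \<le> r' \<Longrightarrow> r' \<le> r \<Longrightarrow> 1 \<le> c' \<Longrightarrow> c' \<le> c \<Longrightarrow> (r', c') \<in> D"
  unfolding young_def by blast+

lemma young_remove_corner:
  assumes "young D" "corner D r c"
  shows "young (D - {(r, c)})"
proof -
  have "(r1, c1) \<noteq> (r, c)" if "(r', c') \<in> D - {(r, c)}" "1 \<le> r1" "r1 \<le> r'" "1 \<le> c1" "c1 \<le> c'" for r1 c1 r' c'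
  proof
    assume eq: "(r1, c1) = (r, c)"
    then have "(Suc r, c) \<in> D \<or> (r, Suc c) \<in> D"
      using youngD(3)[OF assms(1), of r' c' "Suc r" c] youngD(3)[OF assms(1), of r' c' r "Suc c"] that
      by (cases "r < r'") auto
    then show False using assms(2) by (simp add: corner_def)
  qed
  then show ?thesis using assms(1) unfolding young_def by (auto; blast)
qed

lemma corner_exists:
  assumes "young D" "(r, c) \<in> D"
  obtains r' c' where "corner D r' c'" "r \<le> r'" "c \<le> c'"
proof -
  let ?A = "{u \<in> D. r \<le> fst u \<and> c \<le> snd u}"
  have fin: "finite ?A" using youngD(1)[OF assms(1)] by simp
  moreover have ne: "?A \<noteq> {}" using assms(2) by force
  ultimately have "Max ((\<lambda>u. fst u + snd u) ` ?A) \<in> (\<lambda>u. fst u + snd u) ` ?A"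
    by (intro Max_in) auto
  then obtain u where u: "u \<in> ?A" "fst u + snd u = Max ((\<lambda>u. fst u + snd u) ` ?A)" by auto
  have max: "fst v + snd v \<le> fst u + snd u" if "v \<in> ?A" for v
    unfolding u(2) using fin that by (intro Max_ge) auto
  have "corner D (fst u) (snd u)"
    unfolding corner_def using u(1) max[of "(Suc (fst u), snd u)"] max[of "(fst u, Suc (snd u))"] by auto
  then show ?thesis using that u by auto
qed

lemma ssvt_row_less: "T \<in> ssvt D \<Longrightarrow> (r, c) \<in> D \<Longrightarrow> (r, Suc c) \<in> D \<Longrightarrow> Max (T (r, c)) \<le> Min (T (r, Suc c))"
  unfolding ssvt_def Suc_eq_plus1 by blast

lemma ssvt_column_less: "T \<in> ssvt D \<Longrightarrow> (r, c) \<in> D \<Longrightarrow> (Suc r, c) \<in> D \<Longrightarrow> Max (T (r, c)) < Min (T (Suc r, c))"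
  unfolding ssvt_def Suc_eq_plus1 by blast

lemma Max_le_of_ssvt:
  assumes "T \<in> ssvt D" "(r, c) \<in> D"
  shows "(r, Suc c) \<in> D \<Longrightarrow> Max (T (r, c)) \<le> Max (T (r, Suc c))"
    and "(Suc r, c) \<in> D \<Longrightarrow> Max (T (r, c)) + 1 \<le> Max (T (Suc r, c))"
proof -
  have fin: "finite (T u) \<and> T u \<noteq> {}" if "u \<in> D" for u using assms(1) that unfolding ssvt_def by blast
  have le: "Min (T u) \<le> Max (T u)" if "u \<in> D" for u using fin[OF that] by simp
  show "Max (T (r, c)) \<le> Max (T (r, Suc c))" if "(r, Suc c) \<in> D"
  proof -
    have "Max (T (r, c)) \<le> Min (T (r, Suc c))" using assms that by (intro ssvt_row_less)
    then show ?thesis using le[OF that] by simp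
  qed
  show "Max (T (r, c)) + 1 \<le> Max (T (Suc r, c))" if "(Suc r, c) \<in> D"
  proof -
    have "Max (T (r, c)) < Min (T (Suc r, c))" using assms that by (intro ssvt_column_less)
    then show ?thesis using le[OF that] by simp
  qed
qed

text \<open>Walk along row \<open>r\<close>, then down column \<open>c'\<close>. This is the source
  of all redundancy among bounds: a bound on one cell controls every cell to its northwest,
  sharpened by one per row.\<close>

lemma ssvt_mono:
  assumes D: "young D" and T: "T \<in> ssvt D" and "(r, c) \<in> D" "(r', c') \<in> D" "r \<le> r'" "c \<le> c'"
  shows "Max (T (r, c)) + (int r' - int r) \<le> Max (T (r', c'))"
proof -
  have 1: "1 \<le> r" "1 \<le> c" using youngD(2)[OF D assms(3)] by auto
  have row: "Max (T (r, c)) \<le> Max (T (r, d))" if "c \<le> d" "d \<le> c'" for d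
    using that
  proof (induction d rule: dec_induct)
    case (step n)
    have "(r, n) \<in> D" "(r, Suc n) \<in> D"
      using youngD(3)[OF D assms(4), of r n] youngD(3)[OF D assms(4), of r "Suc n"] step 1 assms by auto
    then show ?case using Max_le_of_ssvt(1)[OF T, of r n] step by simp
  qed simp
  have col: "Max (T (r, c')) + (int s - int r) \<le> Max (T (s, c'))" if "r \<le> s" "s \<le> r'" for s
    using that
  proof (induction s rule: dec_induct)
    case (step n)
    have "(n, c') \<in> D" "(Suc n, c') \<in> D"
      using youngD(3)[OF D assms(4), of n c'] youngD(3)[OF D assms(4), of "Suc n" c'] step 1 assms by auto
    then show ?case using Max_le_of_ssvt(2)[OF T, of n c'] step by simp
  qed simp
  show ?thesis using row[of c'] col[of r'] assms by simp
qed

text \<open>A corner has no neighbour to the right or below, so its entry meets only the left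
  neighbour, weakly, and the upper neighbour, strictly.\<close>

lemma ssvt_extend:
  assumes "corner D r c"
  shows "T((r, c) := S) \<in> ssvt D \<longleftrightarrow>
    T((r, c) := {}) \<in> ssvt (D - {(r, c)}) \<and> finite S \<and> S \<noteq> {} \<and>
    (\<forall>c'. c = Suc c' \<longrightarrow> (r, c') \<in> D \<longrightarrow> Max (T (r, c')) \<le> Min S) \<and>
    (\<forall>r'. r = Suc r' \<longrightarrow> (r', c) \<in> D \<longrightarrow> Max (T (r', c)) < Min S)"
  (is "?L \<longleftrightarrow> ?R")
proof
  assume L: ?L
  let ?T = "T((r, c) := S)"
  have 1: "finite (?T u) \<and> ?T u \<noteq> {}" if "u \<in> D" for u using L that unfolding ssvt_def by blast
  have 2: "?T u = {}" if "u \<notin> D" for u using L that unfolding ssvt_def by blast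
  have 3: "Max (?T (r, c)) \<le> Min (?T (r, c + 1))" if "(r, c) \<in> D" "(r, c + 1) \<in> D" for r c
    using L that unfolding ssvt_def by blast
  have 4: "Max (?T (r, c)) < Min (?T (r + 1, c))" if "(r, c) \<in> D" "(r + 1, c) \<in> D" for r c
    using L that unfolding ssvt_def by blast
  have "T((r, c) := {}) \<in> ssvt (D - {(r, c)})"
    unfolding ssvt_def
  proof (intro CollectI conjI ballI allI impI)
    fix u assume "u \<in> D - {(r, c)}"
    then show "finite ((T((r, c) := {})) u)" "(T((r, c) := {})) u \<noteq> {}"
      using 1[of u] by auto
  next
    fix u assume "u \<notin> D - {(r, c)}"
    then show "(T((r, c) := {})) u = {}" using 2[of u] by auto
  next
    fix r' c' assume "(r', c') \<in> D - {(r, c)}" "(r', c' + 1) \<in> D - {(r, c)}"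
    then show "Max ((T((r, c) := {})) (r', c')) \<le> Min ((T((r, c) := {})) (r', c' + 1))"
      using 3[of r' c'] by (auto split: if_splits)
  next
    fix r' c' assume "(r', c') \<in> D - {(r, c)}" "(r' + 1, c') \<in> D - {(r, c)}"
    then show "Max ((T((r, c) := {})) (r', c')) < Min ((T((r, c) := {})) (r' + 1, c'))"
      using 4[of r' c'] by (auto split: if_splits)
  qed
  then show ?R using 1[of "(r, c)"] 3 4 assms unfolding corner_def by fastforce
next
  assume R: ?R
  let ?T = "T((r, c) := {})"
  have 1: "finite (?T u) \<and> ?T u \<noteq> {}" if "u \<in> D - {(r, c)}" for u using R that unfolding ssvt_def by blast
  have 2: "?T u = {}" if "u \<notin> D - {(r, c)}" for u using R that unfolding ssvt_def by blast
  have 3: "Max (?T (s, d)) \<le> Min (?T (s, d + 1))" if "(s, d) \<in> D - {(r, c)}" "(s, d + 1) \<in> D - {(r, c)}" for s d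
    using R that unfolding ssvt_def by blast
  have 4: "Max (?T (s, d)) < Min (?T (s + 1, d))" if "(s, d) \<in> D - {(r, c)}" "(s + 1, d) \<in> D - {(r, c)}" for s d
    using R that unfolding ssvt_def by blast
  show ?L
    unfolding ssvt_def
  proof (intro CollectI conjI ballI allI impI)
    fix u assume "u \<in> D"
    then show "finite ((T((r, c) := S)) u)" "(T((r, c) := S)) u \<noteq> {}"
      using 1[of u] R by (auto split: if_splits)
  next
    fix u assume "u \<notin> D"
    then show "(T((r, c) := S)) u = {}" using 2[of u] assms by (auto simp: corner_def)
  next
    fix s d assume "(s, d) \<in> D" "(s, d + 1) \<in> D"
    then show "Max ((T((r, c) := S)) (s, d)) \<le> Min ((T((r, c) := S)) (s, d + 1))"
      using 3[of s d] R assms by (cases "(s, d + 1) = (r, c)"; cases "(s, d) = (r, c)") (auto simp: corner_def)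
  next
    fix s d assume "(s, d) \<in> D" "(s + 1, d) \<in> D"
    then show "Max ((T((r, c) := S)) (s, d)) < Min ((T((r, c) := S)) (s + 1, d))"
      using 4[of s d] R assms by (cases "(s + 1, d) = (r, c)"; cases "(s, d) = (r, c)") (auto simp: corner_def)
  qed
qed

lemma wt_extend:
  assumes "finite D" "u \<in> D"
  shows "wt D (T(u := S)) = mconst (inverse beta0) * cell_weight u S * wt (D - {u}) (T(u := S'))"
proof -
  have "(\<Prod>v \<in> D. cell_weight v ((T(u := S)) v)) =
      cell_weight u S * (\<Prod>v \<in> D - {u}. cell_weight v ((T(u := S)) v))"
    using assms by (subst prod.remove[of D u]) auto
  also have "(\<Prod>v \<in> D - {u}. cell_weight v ((T(u := S)) v)) = (\<Prod>v \<in> D - {u}. cell_weight v ((T(u := S')) v))"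
    by (rule prod.cong) auto
  finally have "(\<Prod>v \<in> D. cell_weight v ((T(u := S)) v)) =
      cell_weight u S * (\<Prod>v \<in> D - {u}. cell_weight v ((T(u := S')) v))" .
  moreover have "(mconst (inverse beta0 ^ card D) :: series) = mconst (inverse beta0) * mconst (inverse beta0 ^ card (D - {u}))"
    using card_Suc_Diff1[OF assms, symmetric] by (simp add: mconst_mult)
  ultimately show ?thesis unfolding wt_cell_weight by (simp only: ac_simps)
qed

lemma ominus_support:
  assumes "mcoeff (ominus (xvar i) (yvar j)) m \<noteq> 0"
  shows "X i \<in># m \<or> Y j \<in># m"
proof -
  obtain p where "p \<subseteq># m" "mcoeff (xvar i - yvar j) p \<noteq> 0"
    using assms unfolding ominus_def by (rule mcoeff_mult_nonzero)
  then have "p \<subseteq># m" "p = {#X i#} \<or> p = {#Y j#}"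
    by (auto simp: xvar_def yvar_def mcoeff_mvar split: if_splits)
  then show ?thesis by auto
qed

lemma mcoeff_prod_nonzero:
  assumes "finite I" "i \<in> I" "mcoeff (\<Prod>i \<in> I. f i) m \<noteq> 0"
  obtains p where "p \<subseteq># m" "mcoeff (f i) p \<noteq> 0"
proof -
  have "mcoeff (f i * (\<Prod>i \<in> I - {i}. f i)) m \<noteq> 0"
    using assms by (subst prod.remove[of I i, symmetric]) auto
  then show ?thesis using that by (rule mcoeff_mult_nonzero) auto
qed

lemma wt_support:
  assumes "mcoeff (wt D T) m \<noteq> 0" "finite D" "(r, c) \<in> D" "finite (T (r, c))" "i \<in> T (r, c)"
  shows "X i \<in># m \<or> Y (i + int c - int r) \<in># m"
proof -
  have "mcoeff (\<Prod>u \<in> D. cell_weight u (T u)) m \<noteq> 0"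
    using assms(1) unfolding wt_cell_weight by auto
  then obtain p where p: "p \<subseteq># m" "mcoeff (cell_weight (r, c) (T (r, c))) p \<noteq> 0"
    using mcoeff_prod_nonzero[OF assms(2,3)] by blast
  then obtain p' where p': "p' \<subseteq># p" "mcoeff (beta * ominus (xvar i) (yvar (i + int c - int r))) p' \<noteq> 0"
    using mcoeff_prod_nonzero[OF assms(4,5)] unfolding cell_weight_def fst_conv snd_conv by blast
  then have "X i \<in># p' \<or> Y (i + int c - int r) \<in># p'"
    unfolding beta_def by (intro ominus_support) auto
  then show ?thesis using p p' by (meson mset_subset_eqD)
qed

text \<open>If a tableau contributes to the monomial \<open>m\<close>, each of its entries is
  visible in \<open>m\<close>, as an x-label or as a y-label shifted by the content of the cell.
  This leaves finitely many entries for every cell.\<close>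

lemma wt_summable:
  assumes D: "finite D"
  shows "mfps_summable (wt D) (ssvt D)"
  unfolding mfps_summable_def
proof
  fix m :: "var multiset"
  let ?F = "\<lambda>(r, c). {i. X i \<in># m} \<union> (\<lambda>j. j - int c + int r) ` {j. Y j \<in># m}"
  have "inj X" "inj Y" by (auto simp: inj_def)
  then have "finite {i. X i \<in># m}" "finite {i. Y i \<in># m}"
    using finite_vimageI[of "set_mset m" X] finite_vimageI[of "set_mset m" Y] by (auto simp: vimage_def)
  then have fin: "finite (Pow (?F u))" for u by (cases u) simp
  let ?E = "\<lambda>f u. if u \<in> D then f u else {}"
  have "{T \<in> ssvt D. mcoeff (wt D T) m \<noteq> 0} \<subseteq> ?E ` (\<Pi>\<^sub>E u \<in> D. Pow (?F u))"
  proof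
    fix T assume T: "T \<in> {T \<in> ssvt D. mcoeff (wt D T) m \<noteq> 0}"
    then have out: "T u = {}" if "u \<notin> D" for u using that unfolding ssvt_def by blast
    show "T \<in> ?E ` (\<Pi>\<^sub>E u \<in> D. Pow (?F u))"
    proof (rule image_eqI)
      show "T = ?E (restrict T D)" unfolding fun_eq_iff using out by simp
      show "restrict T D \<in> (\<Pi>\<^sub>E u \<in> D. Pow (?F u))"
      proof (rule restrict_PiE_iff[THEN iffD2], rule ballI, rule PowI, rule subsetI)
        fix u i assume u: "u \<in> D" and i: "i \<in> T u"
        obtain r c where rc: "u = (r, c)" by force
        have "finite (T (r, c))" using T u rc unfolding ssvt_def by blast
        then have "X i \<in># m \<or> Y (i + int c - int r) \<in># m"
          using T u i rc by (intro wt_support[OF _ D]) auto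
        then show "i \<in> ?F u"
          unfolding rc by (auto intro: image_eqI[where x = "i + int c - int r"])
      qed
    qed
  qed
  moreover have "finite (?E ` (\<Pi>\<^sub>E u \<in> D. Pow (?F u)))"
    using D fin by (intro finite_imageI finite_PiE) auto
  ultimately show "finite {T \<in> ssvt D. mcoeff (wt D T) m \<noteq> 0}" by (rule finite_subset)
qed

lemma tableaux_summable: "finite D \<Longrightarrow> mfps_summable (wt D) (tableaux D B)"
  by (rule mfps_summable_subset[OF wt_summable]) (auto simp: tableaux_def)

lemma tableauxI: "T \<in> ssvt D \<Longrightarrow> (\<And>v. v \<in> D \<Longrightarrow> Max (T v) \<le> B v) \<Longrightarrow> T \<in> tableaux D B"
  by (simp add: tableaux_def)

lemma tableauxD: "T \<in> tableaux D B \<Longrightarrow> T \<in> ssvt D" "T \<in> tableaux D B \<Longrightarrow> v \<in> D \<Longrightarrow> Max (T v) \<le> B v"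
  by (simp_all add: tableaux_def)

text \<open>The conditions that an entry \<open>{b + 1}\<close> of the removed corner imposed on its
  two neighbours, kept as bounds on the smaller shape.\<close>

definition cap_neighbours ::
    "(nat \<times> nat \<Rightarrow> int) \<Rightarrow> nat \<Rightarrow> nat \<Rightarrow> int \<Rightarrow> nat \<times> nat \<Rightarrow> int"
  where "cap_neighbours B r c b v =
    (if v = (r, c - 1) then min (B v) (b + 1) else if v = (r - 1, c) then min (B v) b else B v)"

lemma cell_weight_insert:
  "finite S \<Longrightarrow> i \<notin> S \<Longrightarrow>
    cell_weight (r, c) (insert i S) = beta * ominus (xvar i) (yvar (i + int c - int r)) * cell_weight (r, c) S"
  by (simp add: cell_weight_def)

text \<open>
  Classify the tableaux by the corner entry: it avoids \<open>b + 1\<close>, it is \<open>{b + 1}\<close>, or it contains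
  \<open>b + 1\<close> together with smaller numbers.
\<close>

lemma G_corner:
  assumes D: "young D" and u: "corner D r c" and b: "B (r, c) = b + 1"
  defines "w \<equiv> ominus (xvar (b + 1)) (yvar (b + 1 + int c - int r))"
  shows "G D B = (1 + beta * w) * G D (B((r, c) := b)) + w * G (D - {(r, c)}) (cap_neighbours B r c b)"
proof -
  let ?u = "(r, c)" and ?D' = "D - {(r, c)}"
  let ?all = "tableaux D B" and ?low = "tableaux D (B(?u := b))"
  let ?single = "{T \<in> ?all. T ?u = {b + 1}}" and ?more = "{T \<in> ?all. b + 1 \<in> T ?u \<and> T ?u \<noteq> {b + 1}}"
  let ?rest = "tableaux ?D' (cap_neighbours B r c b)"
  have fin: "finite D" by (rule youngD(1)[OF D])
  have uD: "?u \<in> D" using u by (simp add: corner_def)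
  have rc: "1 \<le> r" "1 \<le> c" using youngD(2)[OF D uD] by auto
  have fT: "finite (T v)" "T v \<noteq> {}" if "T \<in> ssvt D" "v \<in> D" for T v
    using that unfolding ssvt_def by blast+
  have ext: "T(?u := S) \<in> ssvt D \<longleftrightarrow>
    T(?u := {}) \<in> ssvt ?D' \<and> finite S \<and> S \<noteq> {} \<and>
    ((r, c - 1) \<in> D \<longrightarrow> Max (T (r, c - 1)) \<le> Min S) \<and>
    ((r - 1, c) \<in> D \<longrightarrow> Max (T (r - 1, c)) < Min S)" for T S
    unfolding ssvt_extend[OF u] using rc by (cases r; cases c) auto
  have S0_iff: "T \<in> ?low \<longleftrightarrow> T \<in> ?all \<and> b + 1 \<notin> T ?u" for T
  proof
    assume T: "T \<in> ?low"
    note ss = tableauxD(1)[OF T] and le = tableauxD(2)[OF T]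
    have "Max (T ?u) \<le> b" using le[OF uD] by simp
    then have "b + 1 \<notin> T ?u" using Max_ge[OF fT(1)[OF ss uD], of "b + 1"] by auto
    moreover have "Max (T v) \<le> B v" if "v \<in> D" for v
      using le[OF that] b by (cases "v = ?u") simp_all
    then have "T \<in> ?all" by (rule tableauxI[OF ss])
    ultimately show "T \<in> ?all \<and> b + 1 \<notin> T ?u" by simp
  next
    assume T: "T \<in> ?all \<and> b + 1 \<notin> T ?u"
    note ss = tableauxD(1)[OF conjunct1[OF T]] and le = tableauxD(2)[OF conjunct1[OF T]]
    have "Max (T ?u) \<in> T ?u" by (rule Max_in[OF fT[OF ss uD]])
    then have "Max (T ?u) \<noteq> b + 1" using T by metis
    then have m: "Max (T ?u) \<le> b" using le[OF uD] b by linarith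
    show "T \<in> ?low"
    proof (rule tableauxI[OF ss])
      show "Max (T v) \<le> (B(?u := b)) v" if "v \<in> D" for v
        using le[OF that] m by (cases "v = ?u") simp_all
    qed
  qed
  then have S0: "?low = {T \<in> ?all. b + 1 \<notin> T ?u}" by blast
  have part: "?all = ?low \<union> (?single \<union> ?more)" unfolding S0 by blast
  have summ: "mfps_summable (wt D) J" if "J \<subseteq> ?all" for J
    by (rule mfps_summable_subset[OF tableaux_summable[OF fin] that])
  have G3: "G D B = mfps_sum (wt D) ?low + (mfps_sum (wt D) ?single + mfps_sum (wt D) ?more)"
    unfolding G_def
    by (subst part, subst mfps_sum_Un, (use S0 in \<open>intro summ; blast\<close>)+,
        use S0 in blast, subst mfps_sum_Un, (intro summ; blast)+, blast, rule refl)
  \<comment> \<open>Inserting \<open>b + 1\<close> into the corner entry is a bijection from the low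
    tableaux. The number of cells stays the same, so the factor \<open>beta\<close> of the new entry
    survives.\<close>
  have 2: "mfps_sum (wt D) ?more = beta * w * mfps_sum (wt D) ?low"
  proof -
    have "mfps_sum (wt D) ?more = mfps_sum (\<lambda>T. beta * w * wt D T) ?low"
    proof (rule mfps_sum_reindex[where h = "\<lambda>T. T(?u := insert (b + 1) (T ?u))"])
      show "bij_betw (\<lambda>T. T(?u := insert (b + 1) (T ?u))) ?low ?more"
      proof (rule bij_betw_byWitness[where f' = "\<lambda>T. T(?u := T ?u - {b + 1})"])
        show "\<forall>T \<in> ?low. (T(?u := insert (b + 1) (T ?u)))
            (?u := (T(?u := insert (b + 1) (T ?u))) ?u - {b + 1}) = T"
          unfolding S0 by auto
        show "\<forall>T \<in> ?more. (T(?u := T ?u - {b + 1}))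
            (?u := insert (b + 1) ((T(?u := T ?u - {b + 1})) ?u)) = T"
          by (auto simp: fun_eq_iff)
        show "(\<lambda>T. T(?u := insert (b + 1) (T ?u))) ` ?low \<subseteq> ?more"
        proof (rule image_subsetI)
          fix T assume T: "T \<in> ?low"
          note ss = tableauxD(1)[OF T] and le = tableauxD(2)[OF T]
          have n: "b + 1 \<notin> T ?u" and TS: "T \<in> ?all" using T S0_iff by blast+
          note f = fT[OF ss uD]
          have m: "Max (T ?u) \<le> b" using le[OF uD] by simp
          have "Min (T ?u) \<le> b" using m f by (meson Max_in Min_le order_trans)
          then have mi: "Min (insert (b + 1) (T ?u)) = Min (T ?u)" using f by simp
          have "T(?u := insert (b + 1) (T ?u)) \<in> ssvt D"
            unfolding ext[of T "insert (b + 1) (T ?u)"] mi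
            using ext[of T "T ?u", unfolded fun_upd_triv] ss by blast
          moreover have "Max (insert (b + 1) (T ?u)) = b + 1" using m f by simp
          then have "Max ((T(?u := insert (b + 1) (T ?u))) v) \<le> B v" if "v \<in> D" for v
            using tableauxD(2)[OF TS that] b by (cases "v = ?u") simp_all
          ultimately have "T(?u := insert (b + 1) (T ?u)) \<in> ?all" by (rule tableauxI)
          moreover have "insert (b + 1) (T ?u) \<noteq> {b + 1}" using n f by blast
          ultimately show "T(?u := insert (b + 1) (T ?u)) \<in> ?more" by simp
        qed
        show "(\<lambda>T. T(?u := T ?u - {b + 1})) ` ?more \<subseteq> ?low"
        proof (rule image_subsetI)
          fix T assume T: "T \<in> ?more"
          then have TS: "T \<in> ?all" and mem: "b + 1 \<in> T ?u" "T ?u \<noteq> {b + 1}" by blast+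
          note ss = tableauxD(1)[OF TS] and le = tableauxD(2)[OF TS]
          note f = fT[OF ss uD]
          let ?A = "T ?u - {b + 1}"
          have ne: "?A \<noteq> {}" "finite ?A" using mem f by auto
          have leb: "i \<le> b" if "i \<in> ?A" for i
            using that Max_ge[OF f(1), of i] le[OF uD] b by auto
          have mi: "Min (T ?u) \<le> Min ?A"
            using f ne by (intro Min_antimono) auto
          have "T(?u := ?A) \<in> ssvt D"
            unfolding ext[of T ?A]
            using ext[of T "T ?u", unfolded fun_upd_triv] ss ne
              order_trans[OF _ mi] order_less_le_trans[OF _ mi] by blast
          moreover have "Max ?A \<le> b" using leb Max_in[OF ne(2,1)] by blast
          then have "Max ((T(?u := ?A)) v) \<le> (B(?u := b)) v" if "v \<in> D" for v
            using le[OF that] by (cases "v = ?u") simp_all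
          ultimately show "T(?u := ?A) \<in> ?low" by (rule tableauxI)
        qed
      qed
      fix T assume T: "T \<in> ?low"
      note ss = tableauxD(1)[OF T]
      have n: "b + 1 \<notin> T ?u" using T S0_iff by blast
      have "wt D (T(?u := T ?u)) = mconst (inverse beta0) * cell_weight ?u (T ?u) * wt ?D' (T(?u := {}))"
        by (rule wt_extend[OF fin uD])
      moreover have "wt D (T(?u := insert (b + 1) (T ?u))) =
          mconst (inverse beta0) * (beta * w * cell_weight ?u (T ?u)) * wt ?D' (T(?u := {}))"
        unfolding wt_extend[OF fin uD, where S' = "{}"] cell_weight_insert[OF fT(1)[OF ss uD] n] w_def ..
      ultimately show "wt D (T(?u := insert (b + 1) (T ?u))) = beta * w * wt D T"
        by (simp only: fun_upd_triv ac_simps)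
    qed
    then show ?thesis
      unfolding mfps_sum_mult[OF tableaux_summable[OF fin]] .
  qed
  \<comment> \<open>Here the corner cell disappears together with its entry, and the normalisation
    by the number of cells absorbs \<open>beta\<close>.\<close>
  have 1: "mfps_sum (wt D) ?single = w * mfps_sum (wt ?D') ?rest"
  proof -
    have bound: "Max (T (r, c - 1)) \<le> b + 1 \<longleftrightarrow> Max (T (r, c - 1)) \<le> Min {b + 1}"
      "Max (T (r - 1, c)) \<le> b \<longleftrightarrow> Max (T (r - 1, c)) < Min {b + 1}" for T :: "nat \<times> nat \<Rightarrow> int set"
      by auto
    have neq: "(r, c - 1) \<noteq> ?u" "(r - 1, c) \<noteq> ?u" "(r, c - 1) \<noteq> (r - 1, c)" using rc by auto
    have cap: "(\<forall>v \<in> ?D'. Max (T v) \<le> cap_neighbours B r c b v) \<longleftrightarrow>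
        (\<forall>v \<in> ?D'. Max (T v) \<le> B v) \<and> ((r, c - 1) \<in> D \<longrightarrow> Max (T (r, c - 1)) \<le> Min {b + 1})
        \<and> ((r - 1, c) \<in> D \<longrightarrow> Max (T (r - 1, c)) < Min {b + 1})" for T
      unfolding bound[symmetric] cap_neighbours_def using neq by (auto split: if_splits)
    have S1: "T(?u := {b + 1}) \<in> ?single \<longleftrightarrow> T(?u := {}) \<in> ?rest" for T
    proof -
      have "T(?u := {b + 1}) \<in> ?single \<longleftrightarrow> T(?u := {b + 1}) \<in> ssvt D \<and> (\<forall>v \<in> ?D'. Max (T v) \<le> B v)"
        using uD b by (auto simp: tableaux_def)
      also have "\<dots> \<longleftrightarrow> T(?u := {}) \<in> ssvt ?D' \<and> (\<forall>v \<in> ?D'. Max (T v) \<le> cap_neighbours B r c b v)"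
        unfolding cap ext by auto
      also have "\<dots> \<longleftrightarrow> T(?u := {}) \<in> ?rest" by (auto simp: tableaux_def)
      finally show ?thesis .
    qed
    have out: "T(?u := {}) = T" if "T \<in> ?rest" for T
    proof -
      have "T ?u = {}" using that unfolding tableaux_def ssvt_def by blast
      then show ?thesis by (metis fun_upd_triv)
    qed
    have "mfps_sum (wt D) ?single = mfps_sum (\<lambda>T. w * wt ?D' T) ?rest"
    proof (rule mfps_sum_reindex[where h = "\<lambda>T. T(?u := {b + 1})"])
      show "bij_betw (\<lambda>T. T(?u := {b + 1})) ?rest ?single"
      proof (rule bij_betw_byWitness[where f' = "\<lambda>T. T(?u := {})"])
        show "\<forall>T \<in> ?rest. (T(?u := {b + 1}))(?u := {}) = T" using out by simp
        show "\<forall>T \<in> ?single. (T(?u := {}))(?u := {b + 1}) = T" by (auto simp: fun_eq_iff)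
        show "(\<lambda>T. T(?u := {b + 1})) ` ?rest \<subseteq> ?single"
        proof (rule image_subsetI)
          fix T assume "T \<in> ?rest"
          then show "T(?u := {b + 1}) \<in> ?single" unfolding S1 using out by simp
        qed
        show "(\<lambda>T. T(?u := {})) ` ?single \<subseteq> ?rest"
        proof (rule image_subsetI)
          fix T assume T: "T \<in> ?single"
          then have "T = T(?u := {b + 1})" by (auto simp: fun_eq_iff)
          then have "T(?u := {b + 1}) \<in> ?single" using T by metis
          then show "T(?u := {}) \<in> ?rest" unfolding S1 .
        qed
      qed
      fix T assume T: "T \<in> ?rest"
      have "cell_weight ?u {b + 1} = beta * w" by (simp add: cell_weight_def w_def)
      then have "wt D (T(?u := {b + 1})) = mconst (inverse beta0) * (beta * w) * wt ?D' T"
        using wt_extend[OF fin uD, of T "{b + 1}" "{}"] out[OF T] by simp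
      also have "\<dots> = (mconst (inverse beta0) * mconst beta0) * (w * wt ?D' T)"
        unfolding beta_def by (simp only: ac_simps)
      finally show "wt D (T(?u := {b + 1})) = w * wt ?D' T"
        unfolding mconst_inverse_mult[OF beta0_nonzero] by simp
    qed
    then show ?thesis
      unfolding mfps_sum_mult[OF tableaux_summable[OF finite_Diff[OF fin]]] .
  qed
  show ?thesis
    unfolding G3 1 2 unfolding G_def by (simp only: distrib_right mult_1_left ac_simps)
qed

section \<open>Uniqueness of expansions\<close>

lemma cells_Sigma: "cells lam = (SIGMA r:{1..length lam}. {1..lam ! (r - 1)})"
  by (auto simp: cells_def)

lemma partition_nth_antimono:
  assumes "is_partition lam" "i \<le> j" "j < length lam"
  shows "lam ! j \<le> lam ! i"
  using assms by (cases "i = j") (auto simp: is_partition_def sorted_wrt_iff_nth_less)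

lemma partition_nth_pos:
  assumes "is_partition lam" "i < length lam"
  shows "0 < lam ! i"
proof (rule ccontr)
  assume "\<not> 0 < lam ! i"
  then have "0 \<in> set lam" using nth_mem[OF assms(2)] by simp
  then show False using assms(1) by (simp add: is_partition_def)
qed

lemma young_cells:
  assumes "is_partition lam"
  shows "young (cells lam)"
proof -
  have "(r', c') \<in> cells lam" if "(r, c) \<in> cells lam" "1 \<le> r'" "r' \<le> r" "1 \<le> c'" "c' \<le> c" for r c r' c'
  proof -
    have "lam ! (r - 1) \<le> lam ! (r' - 1)"
      using that by (intro partition_nth_antimono[OF assms]) (auto simp: cells_def)
    then show ?thesis using that by (auto simp: cells_def)
  qed
  then show ?thesis
    unfolding young_def by (auto simp: cells_Sigma)
qed

lemma cells_inject:
  assumes "is_partition \<mu>" "is_partition \<nu>" "cells \<mu> = cells \<nu>"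
  shows "\<mu> = \<nu>"
proof -
  have len: "(r, 1) \<in> cells lam \<longleftrightarrow> 1 \<le> r \<and> r \<le> length lam" if "is_partition lam" for lam r
    using partition_nth_pos[OF that, of "r - 1"] by (cases r) (auto simp: cells_def Suc_le_eq)
  have "r \<le> length \<mu> \<longleftrightarrow> r \<le> length \<nu>" if "1 \<le> r" for r
    using len[OF assms(1), of r] len[OF assms(2), of r] assms(3) that by simp
  from this[of "length \<mu>"] this[of "length \<nu>"] have l: "length \<mu> = length \<nu>"
    by (metis le_antisym le_zero_eq nat_le_linear not_less_eq_eq One_nat_def)
  have "\<mu> ! i = \<nu> ! i" if i: "i < length \<mu>" for i
  proof -
    have "c \<le> \<mu> ! i \<longleftrightarrow> c \<le> \<nu> ! i" if "1 \<le> c" for c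
    proof -
      have "(Suc i, c) \<in> cells \<mu> \<longleftrightarrow> (Suc i, c) \<in> cells \<nu>" using assms(3) by simp
      then show ?thesis using i l that by (simp add: cells_def)
    qed
    from this[of "\<mu> ! i"] this[of "\<nu> ! i"] show ?thesis
      using partition_nth_pos[OF assms(1) i] partition_nth_pos[OF assms(2), of i] i l by simp
  qed
  then show ?thesis using l by (simp add: list_eq_iff_nth_eq)
qed

lemma G_minus_eq_G: "G_minus \<mu> = G (cells \<mu>) (\<lambda>_. 0)"
proof -
  have "(\<forall>i \<in> T u. i \<le> 0) \<longleftrightarrow> Max (T u) \<le> 0" if "T \<in> ssvt (cells \<mu>)" "u \<in> cells \<mu>" for T u
    using that by (subst Max_le_iff) (auto simp: ssvt_def)
  then have "{T \<in> ssvt (cells \<mu>). \<forall>u \<in> cells \<mu>. \<forall>i \<in> T u. i \<le> 0} = tableaux (cells \<mu>) (\<lambda>_. 0)"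
    unfolding tableaux_def by blast
  then show ?thesis by (simp add: G_minus_def G_def)
qed

lemma order_ge_wt:
  assumes "finite D" "\<And>u. u \<in> D \<Longrightarrow> finite (T u)"
  shows "order_ge (\<Sum>u \<in> D. card (T u)) (wt D T)"
proof -
  have "order_ge 1 (beta * ominus (xvar i) (yvar j))" for i j
    unfolding order_ge_def
  proof (intro allI impI)
    fix m assume "mcoeff (beta * ominus (xvar i) (yvar j)) m \<noteq> 0"
    then have "X i \<in># m \<or> Y j \<in># m" unfolding beta_def by (intro ominus_support) auto
    then have "m \<noteq> {#}" by auto
    then show "1 \<le> size m" by (simp add: Suc_leI nonempty_has_size)
  qed
  then have "order_ge (\<Sum>i \<in> S. 1) (cell_weight u S)" for u S
    unfolding cell_weight_def by (intro order_ge_prod)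
  then have "order_ge (\<Sum>u \<in> D. card (T u)) (\<Prod>u \<in> D. cell_weight u (T u))"
    by (intro order_ge_prod) simp
  then have "order_ge (0 + (\<Sum>u \<in> D. card (T u))) (wt D T)"
    unfolding wt_cell_weight by (intro order_ge_mult order_ge_0)
  then show ?thesis by simp
qed

lemma mfps_sum_nonzero:
  assumes "mcoeff (mfps_sum f I) m \<noteq> 0"
  obtains i where "i \<in> I" "mcoeff (f i) m \<noteq> 0"
proof -
  have "{i. i \<in> I \<and> mcoeff (f i) m \<noteq> 0} \<noteq> {}"
    using assms unfolding mfps_sum_mcoeff by (metis sum.empty)
  then show ?thesis using that by blast
qed

lemma order_ge_G:
  assumes "finite D"
  shows "order_ge (card D) (G D B)"
  unfolding order_ge_def G_def
proof (intro allI impI)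
  fix m assume "mcoeff (mfps_sum (wt D) (tableaux D B)) m \<noteq> 0"
  then obtain T where T: "T \<in> tableaux D B" "mcoeff (wt D T) m \<noteq> 0" by (rule mfps_sum_nonzero)
  have f: "finite (T u) \<and> T u \<noteq> {}" if "u \<in> D" for u
    using tableauxD(1)[OF T(1)] that unfolding ssvt_def by blast
  then have "(\<Sum>u \<in> D. 1) \<le> (\<Sum>u \<in> D. card (T u))"
    by (intro sum_mono) (simp add: Suc_leI card_gt_0_iff)
  also have "\<dots> \<le> size m"
    using order_ge_wt[OF assms] f T(2) unfolding order_ge_def by blast
  finally show "card D \<le> size m" by simp
qed

subsection \<open>Monomials without y-variables\<close>

definition x_only :: "var multiset \<Rightarrow> bool"
  where "x_only m \<longleftrightarrow> set_mset m \<subseteq> range X"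

text \<open>Equality after setting all y-variables to 0.\<close>

definition x_eq :: "series \<Rightarrow> series \<Rightarrow> bool"
  where "x_eq f g \<longleftrightarrow> (\<forall>m. x_only m \<longrightarrow> mcoeff f m = mcoeff g m)"

definition monomial :: "'v multiset \<Rightarrow> ('v, 'a::zero_neq_one) mfps"
  where "monomial m = Abs_mfps (\<lambda>n. if n = m then 1 else 0)"

lemma x_eq_refl: "x_eq f f"
  by (simp add: x_eq_def)

lemma x_eq_mult: "x_eq f f' \<Longrightarrow> x_eq g g' \<Longrightarrow> x_eq (f * g) (f' * g')"
  unfolding x_eq_def
proof (intro allI impI)
  fix m assume f: "\<forall>m. x_only m \<longrightarrow> mcoeff f m = mcoeff f' m"
    and g: "\<forall>m. x_only m \<longrightarrow> mcoeff g m = mcoeff g' m" and m: "x_only m"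
  have "x_only p \<and> x_only (m - p)" if "p \<subseteq># m" for p
    using m that unfolding x_only_def by (meson diff_subset_eq_self order_trans set_mset_mono)
  then show "mcoeff (f * g) m = mcoeff (f' * g') m"
    unfolding mcoeff_mult using f g by (intro sum.cong) auto
qed

lemma x_eq_prod: "(\<And>i. i \<in> I \<Longrightarrow> x_eq (f i) (g i)) \<Longrightarrow> x_eq (\<Prod>i \<in> I. f i) (\<Prod>i \<in> I. g i)"
  by (induction I rule: infinite_finite_induct) (auto simp: x_eq_refl intro: x_eq_mult)

lemma x_eq_ominus: "x_eq (beta * ominus (xvar i) (yvar j)) (mconst beta0 * monomial {#X i#})"
proof -
  let ?s = "recip (1 + beta * yvar j)"
  have y: "x_eq (yvar j) 0"
    by (auto simp: x_eq_def x_only_def yvar_def mcoeff_mvar)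
  have y_mult: "x_eq (f * (yvar j * g)) 0" for f g
    using x_eq_mult[OF x_eq_refl[of f] x_eq_mult[OF y x_eq_refl[of g]]] by simp
  \<comment> \<open>Unfolding the equation of the reciprocal once exposes a factor
    \<open>yvar j\<close>, which disappears at y = 0.\<close>
  have s: "?s = 1 - beta * (yvar j * ?s)"
    using recip_yvar[of j] by (simp add: algebra_simps)
  have "mcoeff ?s m = mcoeff 1 m" if "x_only m" for m
    using y_mult[of beta ?s] that by (subst s) (simp add: x_eq_def)
  then have "x_eq ?s 1" by (simp add: x_eq_def)
  moreover have "x_eq (xvar i - yvar j) (monomial {#X i#})"
    using y by (simp add: x_eq_def monomial_def xvar_def mcoeff_mvar)
  ultimately have "x_eq (beta * ((xvar i - yvar j) * ?s)) (mconst beta0 * (monomial {#X i#} * 1))"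
    unfolding beta_def[symmetric] by (intro x_eq_mult x_eq_refl)
  then show ?thesis by (simp add: ominus_def)
qed

lemma mcoeff_monomial: "mcoeff (monomial m) n = (if n = m then 1 else 0)"
  by (simp add: monomial_def)

lemma monomial_add: "monomial (m + n) = monomial m * (monomial n :: ('v, 'a::comm_ring_1) mfps)"
proof (rule mfps_eqI)
  fix k
  have "mcoeff (monomial m * monomial n :: ('v, 'a) mfps) k =
      (\<Sum>p | p \<subseteq># k. if p = m then if k - m = n then 1 else 0 else 0)"
    unfolding mcoeff_mult mcoeff_monomial by (intro sum.cong) auto
  also have "\<dots> = (if m \<subseteq># k \<and> k - m = n then 1 else 0)"
    by (simp add: finite_submultisets)
  also have "m \<subseteq># k \<and> k - m = n \<longleftrightarrow> k = m + n"
    by (auto simp: subset_mset.add_diff_inverse)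
  finally show "mcoeff (monomial (m + n)) k = mcoeff (monomial m * monomial n :: ('v, 'a) mfps) k"
    by (simp add: mcoeff_monomial)
qed

lemma monomial_empty: "monomial {#} = 1"
  by (rule mfps_eqI) (simp add: mcoeff_monomial mcoeff_1)

lemma monomial_sum: "(\<Prod>i \<in> I. monomial (m i)) = (monomial (\<Sum>i \<in> I. m i) :: ('v, 'a::comm_ring_1) mfps)"
  by (induction I rule: infinite_finite_induct) (auto simp: monomial_empty monomial_add)

section \<open>Row tableaux and leading monomials\<close>

definition tableau_content :: "(nat \<times> nat) set \<Rightarrow> (nat \<times> nat \<Rightarrow> int set) \<Rightarrow> var multiset"
  where "tableau_content D T = (\<Sum>u \<in> D. \<Sum>i \<in> T u. {#X i#})"

lemma mconst_prod: "mconst (\<Prod>i \<in> I. f i) = (\<Prod>i \<in> I. mconst (f i))"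
  by (induction I rule: infinite_finite_induct) (auto simp: mconst_1 mconst_mult)

lemma mcoeff_wt_x_only:
  assumes "x_only m"
  shows "mcoeff (wt D T) m =
    (if m = tableau_content D T then inverse beta0 ^ card D * beta0 ^ (\<Sum>u \<in> D. card (T u)) else 0)"
proof -
  have cw: "x_eq (cell_weight u S) (mconst (beta0 ^ card S) * monomial (\<Sum>i \<in> S. {#X i#}))" for u S
  proof -
    have "x_eq (cell_weight u S) (\<Prod>i \<in> S. mconst beta0 * monomial {#X i#})"
      unfolding cell_weight_def by (intro x_eq_prod x_eq_ominus)
    then show ?thesis by (simp add: prod.distrib monomial_sum mconst_power)
  qed
  have "x_eq (\<Prod>u \<in> D. cell_weight u (T u))
      (\<Prod>u \<in> D. mconst (beta0 ^ card (T u)) * monomial (\<Sum>i \<in> T u. {#X i#}))"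
    by (intro x_eq_prod cw)
  also have "(\<Prod>u \<in> D. mconst (beta0 ^ card (T u)) * monomial (\<Sum>i \<in> T u. {#X i#})) =
      mconst (beta0 ^ (\<Sum>u \<in> D. card (T u))) * (monomial (tableau_content D T) :: series)"
    by (simp add: prod.distrib monomial_sum tableau_content_def mconst_prod power_sum)
  finally have "x_eq (wt D T) (mconst (inverse beta0 ^ card D) *
      (mconst (beta0 ^ (\<Sum>u \<in> D. card (T u))) * monomial (tableau_content D T)))"
    unfolding wt_cell_weight by (intro x_eq_mult x_eq_refl)
  then show ?thesis
    using assms by (simp add: x_eq_def mcoeff_monomial)
qed

text \<open>For a partition \<mu> this is n(\<mu>) + |\<mu>|, with the usual statistic n(\<mu>)
  summing (i - 1) times the i-th part.\<close>

definition row_sum :: "(nat \<times> nat) set \<Rightarrow> nat"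
  where "row_sum D = (\<Sum>u \<in> D. fst u)"

text \<open>The offset \<open>a\<close> makes it possible to place the entries below all x-labels of
  given coefficients.\<close>

definition row_tableau :: "int \<Rightarrow> (nat \<times> nat) set \<Rightarrow> nat \<times> nat \<Rightarrow> int set"
  where "row_tableau a D u = (if u \<in> D then {a + int (fst u)} else {})"

lemma row_tableau_ssvt: "row_tableau a D \<in> ssvt D"
  by (auto simp: ssvt_def row_tableau_def)

lemma content_row_tableau: "tableau_content D (row_tableau a D) = (\<Sum>u \<in> D. {#X (a + int (fst u))#})"
  unfolding tableau_content_def by (intro sum.cong) (auto simp: row_tableau_def)

fun x_index :: "var \<Rightarrow> int" where
  "x_index (X i) = i"
| "x_index (Y i) = i"

lemma sum_mset_sum_set: "(\<Sum>v \<in># (\<Sum>i \<in> I. f i). g v) = (\<Sum>i \<in> I. \<Sum>v \<in># f i. (g v :: int))"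
  by (induction I rule: infinite_finite_induct) auto

text \<open>
  The row tableau is extremal: in row \<open>t\<close> of a tableau whose entries exceed \<open>a\<close>, all entries are at
  least \<open>a + t\<close>, so the sum of the entries bounds the sum of the row numbers.
\<close>

lemma content_row_tableau_extremal:
  assumes D: "young D" and D0: "finite D0" and T: "T \<in> ssvt D"
    and eq: "tableau_content D T = tableau_content D0 (row_tableau a D0)" and pos: "\<And>u. u \<in> D0 \<Longrightarrow> 1 \<le> fst u"
  shows "row_sum D \<le> row_sum D0"
    and "row_sum D = row_sum D0 \<Longrightarrow> T = row_tableau a D"
proof -
  have fin: "finite D" by (rule youngD(1)[OF D])
  have fT: "finite (T u)" "T u \<noteq> {}" if "u \<in> D" for u using T that unfolding ssvt_def by blast+
  have mem: "a + 1 \<le> i" if u: "u \<in> D" "i \<in> T u" for u i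
  proof -
    have "X i \<in># (\<Sum>i \<in> T u. {#X i#})" using u fT[OF u(1)] by (subst set_mset_sum) auto
    then have "X i \<in># tableau_content D T" unfolding tableau_content_def using u fin by (subst set_mset_sum) auto
    then have "X i \<in># (\<Sum>u \<in> D0. {#X (a + int (fst u))#})" unfolding eq content_row_tableau .
    then show ?thesis using pos D0 by (subst (asm) set_mset_sum) force+
  qed
  have low: "a + int r \<le> i" if "(r, c) \<in> D" "i \<in> T (r, c)" for r c i
    using that
  proof (induction r arbitrary: i)
    case 0
    then show ?case using youngD(2)[OF D] by fastforce
  next
    case (Suc r)
    show ?case
    proof (cases "r = 0")
      case True
      then show ?thesis using mem[OF Suc.prems] by simp
    next
      case False
      then have r: "(r, c) \<in> D" using youngD(3)[OF D Suc.prems(1), of r c] youngD(2)[OF D Suc.prems(1)] by simp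
      have "a + int r \<le> Max (T (r, c))" using Suc.IH[OF r] Max_in[OF fT[OF r]] by blast
      also have "\<dots> < Min (T (Suc r, c))" by (rule ssvt_column_less[OF T r Suc.prems(1)])
      also have "\<dots> \<le> i" using fT[OF Suc.prems(1)] Suc.prems(2) by simp
      finally show ?thesis by simp
    qed
  qed
  have low': "int (fst u) \<le> i - a" if "u \<in> D" "i \<in> T u" for u i
    using low[of "fst u" "snd u" i] that by simp
  have cell: "int (fst u) \<le> (\<Sum>i \<in> T u. i - a)" if u: "u \<in> D" for u
  proof -
    obtain i where i: "i \<in> T u" using fT[OF u] by blast
    have "int (fst u) \<le> (\<Sum>i \<in> {i}. i - a)" using low'[OF u i] by simp
    also have "\<dots> \<le> (\<Sum>i \<in> T u. i - a)"
    proof (rule sum_mono2)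
      show "finite (T u)" "{i} \<subseteq> T u" using fT[OF u] i by auto
      show "0 \<le> b - a" if "b \<in> T u - {i}" for b using mem[OF u, of b] that by simp
    qed
    finally show ?thesis .
  qed
  let ?s = "\<lambda>m. \<Sum>v \<in># m. x_index v - a"
  \<comment> \<open>Both contents are weighed by label minus \<open>a\<close>, which on the row
    tableau is the row number.\<close>
  have sum: "(\<Sum>u \<in> D. \<Sum>i \<in> T u. i - a) = int (row_sum D0)"
  proof -
    have "?s (tableau_content D T) = (\<Sum>u \<in> D. \<Sum>i \<in> T u. i - a)"
      by (simp add: tableau_content_def sum_mset_sum_set)
    moreover have "?s (tableau_content D0 (row_tableau a D0)) = (\<Sum>u \<in> D0. int (fst u))"
      by (simp add: content_row_tableau sum_mset_sum_set)
    ultimately show ?thesis using eq by (simp add: row_sum_def)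
  qed
  have le: "int (row_sum D) \<le> int (row_sum D0)"
    unfolding sum[symmetric] using cell by (simp add: row_sum_def sum_mono)
  then show "row_sum D \<le> row_sum D0" by simp
  assume "row_sum D = row_sum D0"
  then have "(\<Sum>u \<in> D. int (fst u)) = (\<Sum>u \<in> D. \<Sum>i \<in> T u. i - a)"
    unfolding sum by (simp add: row_sum_def flip: of_nat_sum)
  then have tight: "int (fst u) = (\<Sum>i \<in> T u. i - a)" if "u \<in> D" for u
    using cell that fin by (rule sum_mono_inv)
  have "T u = row_tableau a D u" for u
  proof (cases "u \<in> D")
    case u: True
    have one: "i = a + int (fst u) \<and> T u = {i}" if i: "i \<in> T u" for i
    proof -
      have "(\<Sum>j \<in> T u. j - a) = (i - a) + (\<Sum>j \<in> T u - {i}. j - a)"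
        using fT[OF u] i by (simp add: sum.remove)
      moreover have "0 \<le> (\<Sum>j \<in> T u - {i}. j - a)" using mem[OF u] by (intro sum_nonneg) force
      moreover have "T u - {i} \<noteq> {} \<Longrightarrow> 0 < (\<Sum>j \<in> T u - {i}. j - a)"
        using mem[OF u] fT[OF u] by (intro sum_pos) force+
      ultimately show ?thesis using tight[OF u] low'[OF u i] i by fastforce
    qed
    then show ?thesis using fT[OF u] u unfolding row_tableau_def by (metis ex_in_conv)
  next
    case False
    then have "T u = {}" using T unfolding ssvt_def by blast
    then show ?thesis using False by (simp add: row_tableau_def)
  qed
  then show "T = row_tableau a D" by blast
qed

lemma count_content_row_tableau:
  assumes "finite D"
  shows "count (tableau_content D (row_tableau a D)) (X (a + int r)) = card {u \<in> D. fst u = r}"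
proof -
  have "count (\<Sum>u \<in> D. {#X (a + int (fst u))#}) (X (a + int r)) = (\<Sum>u \<in> D. if fst u = r then 1 else 0)"
    unfolding count_sum by (intro sum.cong) auto
  then show ?thesis using assms by (simp add: content_row_tableau sum.If_cases Int_def)
qed

lemma row_tableau_content_inject:
  assumes "is_partition \<mu>" "is_partition \<nu>"
    and "tableau_content (cells \<mu>) (row_tableau a (cells \<mu>)) = tableau_content (cells \<nu>) (row_tableau a (cells \<nu>))"
  shows "\<mu> = \<nu>"
proof (rule cells_inject[OF assms(1,2)])
  have row: "{u \<in> cells lam. fst u = r} = Pair r ` {1..if 1 \<le> r \<and> r \<le> length lam then lam ! (r - 1) else 0}" for lam r
    by (auto simp: cells_def)
  have card: "card {u \<in> cells lam. fst u = r} = (if 1 \<le> r \<and> r \<le> length lam then lam ! (r - 1) else 0)" for lam r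
    unfolding row by (subst card_image) (auto simp: inj_on_def)
  have fin: "finite (cells lam)" for lam by (simp add: cells_Sigma)
  have "{u \<in> cells \<mu>. fst u = r} = {u \<in> cells \<nu>. fst u = r}" for r
  proof -
    have "count (tableau_content (cells \<mu>) (row_tableau a (cells \<mu>))) (X (a + int r)) =
        count (tableau_content (cells \<nu>) (row_tableau a (cells \<nu>))) (X (a + int r))"
      unfolding assms(3) ..
    then have "card {u \<in> cells \<mu>. fst u = r} = card {u \<in> cells \<nu>. fst u = r}"
      unfolding count_content_row_tableau[OF fin] .
    then show ?thesis unfolding card unfolding row by (rule arg_cong)
  qed
  then show "cells \<mu> = cells \<nu>" by blast
qed

text \<open>Unitriangularity. By extremality a tableau with this content on a shape of at least this
  row sum is the row tableau of its shape, and the multiplicities of the labels recover the row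
  lengths. The condition on \<open>a\<close> keeps the entries nonpositive.\<close>

lemma mcoeff_G_minus_row_content:
  assumes \<mu>: "is_partition \<mu>" and \<mu>0: "is_partition \<mu>0" and a: "a + int (length \<mu>0) \<le> 0"
    and le: "row_sum (cells \<mu>0) \<le> row_sum (cells \<mu>)"
  shows "mcoeff (G_minus \<mu>) (tableau_content (cells \<mu>0) (row_tableau a (cells \<mu>0))) = (if \<mu> = \<mu>0 then 1 else 0)"
    (is "mcoeff _ ?m = _")
proof -
  have fin: "finite (cells lam)" for lam by (simp add: cells_Sigma)
  have m: "x_only ?m"
    unfolding x_only_def content_row_tableau by (subst set_mset_sum) (auto simp: fin)
  have pos: "1 \<le> fst u" if "u \<in> cells \<mu>0" for u using that by (auto simp: cells_def)
  have T: "\<mu> = \<mu>0 \<and> T = row_tableau a (cells \<mu>0)"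
    if "T \<in> tableaux (cells \<mu>) (\<lambda>_. 0)" "mcoeff (wt (cells \<mu>) T) ?m \<noteq> 0" for T
  proof -
    have eq: "tableau_content (cells \<mu>) T = ?m"
      using that(2) unfolding mcoeff_wt_x_only[OF m] by (metis (full_types))
    note ext = content_row_tableau_extremal[OF young_cells[OF \<mu>] fin tableauxD(1)[OF that(1)] eq pos]
    have "T = row_tableau a (cells \<mu>)" using ext le by simp
    moreover have "\<mu> = \<mu>0"
      using eq unfolding \<open>T = _\<close> by (rule row_tableau_content_inject[OF \<mu> \<mu>0])
    ultimately show ?thesis by simp
  qed
  let ?t = "row_tableau a (cells \<mu>0)"
  have t: "?t \<in> tableaux (cells \<mu>0) (\<lambda>_. 0)"
  proof (rule tableauxI[OF row_tableau_ssvt])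
    fix v assume v: "v \<in> cells \<mu>0"
    then have "int (fst v) \<le> int (length \<mu>0)" by (auto simp: cells_def)
    then show "Max (?t v) \<le> 0" using v a by (simp add: row_tableau_def)
  qed
  have one: "mcoeff (wt (cells \<mu>0) ?t) ?m = 1"
    unfolding mcoeff_wt_x_only[OF m] using beta0_nonzero
    by (simp add: row_tableau_def power_mult_distrib[symmetric])
  show ?thesis
  proof (cases "\<mu> = \<mu>0")
    case True
    have "{T. T \<in> tableaux (cells \<mu>) (\<lambda>_. 0) \<and> mcoeff (wt (cells \<mu>) T) ?m \<noteq> 0} = {?t}"
      using T t one True by auto
    then show ?thesis unfolding G_minus_eq_G G_def mfps_sum_mcoeff using True one by simp
  next
    case False
    then have "{T. T \<in> tableaux (cells \<mu>) (\<lambda>_. 0) \<and> mcoeff (wt (cells \<mu>) T) ?m \<noteq> 0} = {}"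
      using T by auto
    then show ?thesis unfolding G_minus_eq_G G_def mfps_sum_mcoeff using False by simp
  qed
qed

section \<open>Independence of the functions \<open>G_minus\<close> over the coefficient
  ring\<close>

definition expansion_of :: "series \<Rightarrow> (nat list \<Rightarrow> series) \<Rightarrow> bool"
  where "expansion_of g a \<longleftrightarrow>
    (\<forall>\<mu>. a \<mu> \<in> coeff_ring) \<and> (\<forall>\<mu>. \<not> is_partition \<mu> \<longrightarrow> a \<mu> = 0) \<and>
    g = mfps_sum (\<lambda>\<mu>. a \<mu> * G_minus \<mu>) {\<mu>. is_partition \<mu>}"

lemma card_cells: "card (cells \<mu>) = sum_list \<mu>"
proof -
  have "card (cells \<mu>) = (\<Sum>r = 1..length \<mu>. \<mu> ! (r - 1))"
    by (simp add: cells_Sigma)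
  also have "\<dots> = (\<Sum>i < length \<mu>. \<mu> ! i)"
    by (rule sum.reindex_bij_witness[where i = Suc and j = "\<lambda>r. r - 1"]) auto
  finally show ?thesis by (simp add: sum_list_sum_nth atLeast0LessThan)
qed

lemma finite_partitions: "finite {\<mu>. is_partition \<mu> \<and> card (cells \<mu>) \<le> n}"
proof (rule finite_subset)
  show "{\<mu>. is_partition \<mu> \<and> card (cells \<mu>) \<le> n} \<subseteq> {\<mu>. set \<mu> \<subseteq> {..n} \<and> length \<mu> \<le> n}"
  proof
    fix \<mu> assume "\<mu> \<in> {\<mu>. is_partition \<mu> \<and> card (cells \<mu>) \<le> n}"
    then have \<mu>: "is_partition \<mu>" "sum_list \<mu> \<le> n" by (auto simp: card_cells)
    have "i \<le> n" if "i \<in> set \<mu>" for i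
      using member_le_sum_list[OF that] \<mu>(2) by simp
    moreover have "length \<mu> \<le> sum_list \<mu>"
    proof -
      have "0 \<notin> set \<mu>" using \<mu>(1) by (simp add: is_partition_def)
      then show ?thesis by (induction \<mu>) auto
    qed
    ultimately show "\<mu> \<in> {\<mu>. set \<mu> \<subseteq> {..n} \<and> length \<mu> \<le> n}" using \<mu>(2) by auto
  qed
  show "finite {\<mu>. set \<mu> \<subseteq> {..n} \<and> length \<mu> \<le> n}" by (rule finite_lists_length_le) simp
qed

lemma G_minus_nonzero:
  assumes "is_partition \<mu>" "mcoeff (G_minus \<mu>) m \<noteq> 0"
  shows "card (cells \<mu>) \<le> size m"
  using order_ge_G[OF youngD(1)[OF young_cells[OF assms(1)]]] assms(2)
  unfolding G_minus_eq_G order_ge_def by blast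

lemma G_minus_summable: "mfps_summable (\<lambda>\<mu>. a \<mu> * G_minus \<mu>) {\<mu>. is_partition \<mu>}"
proof (rule mfps_summable_mult)
  show "mfps_summable G_minus {\<mu>. is_partition \<mu>}"
    unfolding mfps_summable_def
  proof
    fix m
    show "finite {\<mu> \<in> {\<mu>. is_partition \<mu>}. mcoeff (G_minus \<mu>) m \<noteq> 0}"
      using G_minus_nonzero by (intro finite_subset[OF _ finite_partitions[of "size m"]]) auto
  qed
qed

text \<open>An element is built from finitely many generators, so its x-labels are bounded below.
  This leaves room for row tableaux with fresh labels, so that their monomials can be separated from
  those of the coefficients.\<close>

lemma coeff_ring_x_bounded:
  assumes "f \<in> coeff_ring"
  shows "\<exists>N. \<forall>m i. mcoeff f m \<noteq> 0 \<longrightarrow> X i \<in># m \<longrightarrow> N < i"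
  using assms
proof induction
  case (const c)
  then show ?case by (auto simp: mcoeff_mconst)
next
  case (xvar i)
  have "\<forall>m j. mcoeff (xvar i) m \<noteq> 0 \<longrightarrow> X j \<in># m \<longrightarrow> i - 1 < j"
    by (auto simp: xvar_def mcoeff_mvar)
  then show ?case by blast
next
  case (yvar i)
  then show ?case by (auto simp: yvar_def mcoeff_mvar)
next
  case (recip_x i)
  have "\<forall>m j. mcoeff (recip (1 + beta * xvar i)) m \<noteq> 0 \<longrightarrow> X j \<in># m \<longrightarrow> i - 1 < j"
    unfolding beta_def xvar_def recip_eqI[OF one_plus_const_mvar_invertible] by auto
  then show ?case by blast
next
  case (recip_y i)
  have "\<forall>m j. mcoeff (recip (1 + beta * yvar i)) m \<noteq> 0 \<longrightarrow> X j \<in># m \<longrightarrow> 0 < j"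
    unfolding beta_def yvar_def recip_eqI[OF one_plus_const_mvar_invertible] by auto
  then show ?case by blast
next
  case (add f g)
  then obtain N N' where "\<forall>m i. mcoeff f m \<noteq> 0 \<longrightarrow> X i \<in># m \<longrightarrow> N < i"
    "\<forall>m i. mcoeff g m \<noteq> 0 \<longrightarrow> X i \<in># m \<longrightarrow> N' < i" by blast
  then have "\<forall>m i. mcoeff (f + g) m \<noteq> 0 \<longrightarrow> X i \<in># m \<longrightarrow> min N N' < i"
    by (metis add_cancel_right_left mcoeff_add min_less_iff_disj)
  then show ?case by blast
next
  case (mult f g)
  then obtain N N' where N: "\<forall>m i. mcoeff f m \<noteq> 0 \<longrightarrow> X i \<in># m \<longrightarrow> N < i"
    "\<forall>m i. mcoeff g m \<noteq> 0 \<longrightarrow> X i \<in># m \<longrightarrow> N' < i" by blast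
  have "min N N' < i" if nz: "mcoeff (f * g) m \<noteq> 0" and i: "X i \<in># m" for m i
  proof -
    obtain p where p: "p \<subseteq># m" "mcoeff f p \<noteq> 0" "mcoeff g (m - p) \<noteq> 0"
      using nz by (rule mcoeff_mult_nonzero)
    have "m = p + (m - p)" using p(1) by simp
    then have "X i \<in># p \<or> X i \<in># m - p" using i by (metis union_iff)
    then show ?thesis using N p by (auto simp: min_less_iff_disj)
  qed
  then show ?case by blast
qed

lemma subset_add_disjoint:
  assumes "p \<subseteq># p0 + m0" "\<And>v. v \<in># p \<Longrightarrow> v \<notin># m0"
  shows "p \<subseteq># p0"
proof (rule mset_subset_eqI)
  fix v
  have "count p v \<le> count p0 v + count m0 v" using mset_subset_eq_count[OF assms(1)] by simp
  then show "count p v \<le> count p0 v"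
    using assms(2)[of v] by (cases "v \<in># p") (auto simp: not_in_iff)
qed

text \<open>
  A nonzero family of coefficients has a term \<open>(\<mu>\<^sub>0, p\<^sub>0)\<close> of least total degree, with \<open>p\<^sub>0\<close> of least degree and
  then with least row sum of \<open>\<mu>\<^sub>0\<close>.  The product of \<open>p\<^sub>0\<close> with the content of a row tableau of shape
  \<open>\<mu>\<^sub>0\<close> whose variables \<open>x\<^sub>i\<close> do not occur in the coefficients arises from this term only.
\<close>

lemma expansion_zero:
  assumes ring: "\<And>\<mu>. d \<mu> \<in> coeff_ring" and out: "\<And>\<mu>. \<not> is_partition \<mu> \<Longrightarrow> d \<mu> = 0"
    and zero: "mfps_sum (\<lambda>\<mu>. d \<mu> * G_minus \<mu>) {\<mu>. is_partition \<mu>} = 0"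
  shows "d \<mu> = 0"
proof (rule ccontr)
  assume "d \<mu> \<noteq> 0"
  then obtain p where p: "mcoeff (d \<mu>) p \<noteq> 0" by (metis mcoeff_0 mfps_eqI)
  define P where "P = {(\<mu>, p). mcoeff (d \<mu>) p \<noteq> 0}"
  let ?M = "measures [\<lambda>(\<mu>, p). size p + card (cells \<mu>), \<lambda>(\<mu>, p). size p, \<lambda>(\<mu>, p). row_sum (cells \<mu>)]"
  have "(\<mu>, p) \<in> P" using p by (simp add: P_def)
  then obtain z where z: "z \<in> P" "\<And>y. (y, z) \<in> ?M \<Longrightarrow> y \<notin> P"
    using wfE_min[OF wf_measures] by metis
  obtain \<mu>0 p0 where zz: "z = (\<mu>0, p0)" by force
  have nz: "mcoeff (d \<mu>0) p0 \<noteq> 0" using z(1) zz by (simp add: P_def)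
  have part: "is_partition \<mu>0" using nz out by force
  have min: "((\<mu>, p), (\<mu>0, p0)) \<notin> ?M" if "mcoeff (d \<mu>) p \<noteq> 0" for \<mu> p
    using z(2)[of "(\<mu>, p)"] that zz by (auto simp: P_def)
  define e where "e = size p0 + card (cells \<mu>0)"
  let ?S = "{\<mu>. is_partition \<mu> \<and> card (cells \<mu>) \<le> e}"
  have "\<forall>\<mu>. \<exists>N. \<forall>m i. mcoeff (d \<mu>) m \<noteq> 0 \<longrightarrow> X i \<in># m \<longrightarrow> N < i"
    using coeff_ring_x_bounded[OF ring] by blast
  then obtain N where N: "\<And>\<mu> m i. mcoeff (d \<mu>) m \<noteq> 0 \<Longrightarrow> X i \<in># m \<Longrightarrow> N \<mu> < i" by metis
  \<comment> \<open>Only finitely many shapes matter in total degree \<open>e\<close>;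
    \<open>a\<close> places the row tableau below the x-labels of all their coefficients, and also
    among the nonpositive labels.\<close>
  define a where "a = Min (insert 0 (N ` ?S)) - int (length \<mu>0)"
  have a0: "a + int (length \<mu>0) \<le> 0"
    unfolding a_def using finite_partitions by simp
  have aN: "a + int (length \<mu>0) \<le> N \<mu>" if "\<mu> \<in> ?S" for \<mu>
    unfolding a_def using finite_partitions that by simp
  define m0 where "m0 = tableau_content (cells \<mu>0) (row_tableau a (cells \<mu>0))"
  have fin: "finite (cells \<mu>0)" by (rule youngD(1)[OF young_cells[OF part]])
  have m0: "\<exists>i \<le> a + int (length \<mu>0). v = X i" if "v \<in># m0" for v
    using that unfolding m0_def content_row_tableau set_mset_sum[OF fin] by (force simp: cells_def)
  have size: "size m0 = card (cells \<mu>0)"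
    unfolding m0_def content_row_tableau by (simp add: size_multiset_sum)
  have G0: "mcoeff (G_minus \<mu>0) m0 = 1"
    unfolding m0_def using mcoeff_G_minus_row_content[OF part part a0] by simp
  have only: "\<mu> = \<mu>0 \<and> p = p0"
    if \<mu>: "is_partition \<mu>" and p: "p \<subseteq># p0 + m0" "mcoeff (d \<mu>) p \<noteq> 0"
      and G: "mcoeff (G_minus \<mu>) (p0 + m0 - p) \<noteq> 0" for \<mu> p
  proof -
    have "card (cells \<mu>) \<le> size (p0 + m0 - p)" by (rule G_minus_nonzero[OF \<mu> G])
    moreover have "size p \<le> size (p0 + m0)" by (rule size_mset_mono[OF p(1)])
    ultimately have "size p + card (cells \<mu>) \<le> e"
      unfolding e_def size_Diff_submset[OF p(1)] using size by simp
    moreover have "e \<le> size p + card (cells \<mu>)" using min[OF p(2)] by (simp add: e_def)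
    ultimately have e: "size p + card (cells \<mu>) = e" by simp
    \<comment> \<open>The labels of \<open>m0\<close> are too small to occur in
      \<open>d \<mu>\<close>, so \<open>p\<close> takes nothing from \<open>m0\<close>.\<close>
    have "p \<subseteq># p0"
    proof (rule subset_add_disjoint[OF p(1)])
      fix v assume v: "v \<in># p"
      show "v \<notin># m0"
      proof
        assume "v \<in># m0"
        then obtain i where i: "i \<le> a + int (length \<mu>0)" "v = X i" using m0 by blast
        have "N \<mu> < i" using N[OF p(2)] v i by simp
        moreover have "\<mu> \<in> ?S" using e \<mu> by simp
        ultimately show False using aN[of \<mu>] i by simp
      qed
    qed
    moreover have "size p0 \<le> size p" using min[OF p(2)] e by (simp add: e_def)
    ultimately have pp: "p = p0"
      using mset_subset_size subset_mset.less_le by fastforce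
    then have "row_sum (cells \<mu>0) \<le> row_sum (cells \<mu>)" using min[OF p(2)] e by (simp add: e_def)
    then have "\<mu> = \<mu>0"
      using G mcoeff_G_minus_row_content[OF \<mu> part a0] pp by (auto simp: m0_def split: if_splits)
    then show ?thesis using pp by simp
  qed
  have coeff: "mcoeff (d \<mu> * G_minus \<mu>) (p0 + m0) = (if \<mu> = \<mu>0 then mcoeff (d \<mu>0) p0 else 0)"
    if "is_partition \<mu>" for \<mu>
  proof -
    have "mcoeff (d \<mu> * G_minus \<mu>) (p0 + m0) =
        (\<Sum>p | p \<subseteq># p0 + m0. if p = p0 then if \<mu> = \<mu>0 then mcoeff (d \<mu>0) p0 else 0 else 0)"
      unfolding mcoeff_mult
    proof (rule sum.cong[OF refl])
      fix p assume p: "p \<in> {p. p \<subseteq># p0 + m0}"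
      show "mcoeff (d \<mu>) p * mcoeff (G_minus \<mu>) (p0 + m0 - p) =
          (if p = p0 then if \<mu> = \<mu>0 then mcoeff (d \<mu>0) p0 else 0 else 0)"
      proof (cases "p = p0 \<and> \<mu> = \<mu>0")
        case True then show ?thesis using G0 by simp
      next
        case False
        then have "mcoeff (d \<mu>) p = 0 \<or> mcoeff (G_minus \<mu>) (p0 + m0 - p) = 0"
          using only[OF that] p by blast
        then show ?thesis using False by auto
      qed
    qed
    then show ?thesis by (simp add: finite_submultisets)
  qed
  have "mcoeff (mfps_sum (\<lambda>\<mu>. d \<mu> * G_minus \<mu>) {\<mu>. is_partition \<mu>}) (p0 + m0) =
      (\<Sum>\<mu> \<in> {\<mu>0}. mcoeff (d \<mu> * G_minus \<mu>) (p0 + m0))"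
    using part coeff by (intro mcoeff_mfps_sum_superset) (auto split: if_splits)
  then show False using coeff[OF part] zero nz by simp
qed

lemma expansion_unique:
  assumes "expansion_of g a" "expansion_of g b"
  shows "a = b"
proof
  fix \<mu>
  have "a \<mu> - b \<mu> = 0"
  proof (rule expansion_zero)
    show "a \<mu> - b \<mu> \<in> coeff_ring" for \<mu>
      using assms by (auto simp: expansion_of_def intro: coeff_ring_diff)
    show "a \<mu> - b \<mu> = 0" if "\<not> is_partition \<mu>" for \<mu>
      using assms that by (simp add: expansion_of_def)
    have "mfps_sum (\<lambda>\<mu>. (a \<mu> - b \<mu>) * G_minus \<mu>) {\<mu>. is_partition \<mu>} = g - g"
      using assms unfolding expansion_of_def left_diff_distrib
      by (simp add: mfps_sum_diff[OF G_minus_summable G_minus_summable])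
    then show "mfps_sum (\<lambda>\<mu>. (a \<mu> - b \<mu>) * G_minus \<mu>) {\<mu>. is_partition \<mu>} = 0" by simp
  qed
  then show "a \<mu> = b \<mu>" by simp
qed

lemma expansion_combine:
  assumes "expansion_of g a" "expansion_of h b" "s \<in> coeff_ring" "t \<in> coeff_ring"
  shows "expansion_of (s * g + t * h) (\<lambda>\<mu>. s * a \<mu> + t * b \<mu>)"
proof -
  let ?I = "{\<mu>. is_partition \<mu>}"
  have neg: "- t \<in> coeff_ring" using assms(4) by (rule coeff_ring_minus)
  have "mfps_sum (\<lambda>\<mu>. (s * a \<mu> + t * b \<mu>) * G_minus \<mu>) ?I =
      mfps_sum (\<lambda>\<mu>. s * (a \<mu> * G_minus \<mu>) - (- t) * (b \<mu> * G_minus \<mu>)) ?I"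
    by (intro mfps_sum_cong) (simp_all add: algebra_simps)
  also have "\<dots> = s * mfps_sum (\<lambda>\<mu>. a \<mu> * G_minus \<mu>) ?I - (- t) * mfps_sum (\<lambda>\<mu>. b \<mu> * G_minus \<mu>) ?I"
    by (simp only: mfps_sum_diff[OF mfps_summable_mult mfps_summable_mult] G_minus_summable mfps_sum_mult)
  finally have "mfps_sum (\<lambda>\<mu>. (s * a \<mu> + t * b \<mu>) * G_minus \<mu>) ?I = s * g + t * h"
    using assms by (simp add: expansion_of_def)
  then show ?thesis
    using assms unfolding expansion_of_def by (auto intro: coeff_ring.add coeff_ring.mult)
qed

lemma expansion_G_minus:
  assumes "is_partition \<mu>"
  shows "expansion_of (G_minus \<mu>) (\<lambda>\<nu>. if \<nu> = \<mu> then 1 else 0)"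
proof -
  have "mfps_sum (\<lambda>\<nu>. (if \<nu> = \<mu> then 1 else 0) * G_minus \<nu>) {\<mu>. is_partition \<mu>} =
      mfps_sum (\<lambda>\<nu>. (if \<nu> = \<mu> then 1 else 0) * G_minus \<nu>) {\<mu>}"
    using assms by (intro mfps_sum_support) auto
  also have "\<dots> = G_minus \<mu>" by (simp add: mfps_sum_finite)
  finally show ?thesis
    using assms by (auto simp: expansion_of_def coeff_ring_0 coeff_ring_1)
qed

section \<open>Expansion coefficients of bounded tableaux\<close>

lemma initial_segment:
  fixes A :: "nat set"
  assumes "finite A" "\<And>c. c \<in> A \<Longrightarrow> 1 \<le> c" "\<And>c c'. c \<in> A \<Longrightarrow> 1 \<le> c' \<Longrightarrow> c' \<le> c \<Longrightarrow> c' \<in> A"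
  shows "A = {1..card A}"
proof (cases "A = {}")
  case False
  have "A = {1..Max A}"
  proof
    show "A \<subseteq> {1..Max A}" using assms(1,2) by auto
    show "{1..Max A} \<subseteq> A" using assms(3)[OF Max_in[OF assms(1) False]] by auto
  qed
  then show ?thesis by (metis card_atLeastAtMost diff_Suc_1)
qed simp

lemma young_partition:
  assumes D: "young D"
  obtains \<mu> where "is_partition \<mu>" "cells \<mu> = D"
proof -
  let ?row = "\<lambda>r. {c. (r, c) \<in> D}" and ?col = "{r. (r, 1) \<in> D}"
  note fin = youngD(1)[OF D]
  have finr: "finite (?row r)" for r
    by (rule finite_subset[of _ "snd ` D"]) (use fin in force)+
  have row: "?row r = {1..card (?row r)}" for r
    using youngD(2)[OF D] youngD(3)[OF D, of r _ r] by (intro initial_segment[OF finr]) force+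
  have "finite ?col"
    by (rule finite_subset[of _ "fst ` D"]) (use fin in force)+
  then have col: "?col = {1..card ?col}"
    using youngD(2)[OF D] youngD(3)[OF D, of _ 1 _ 1] by (intro initial_segment) force+
  define \<mu> where "\<mu> = map (\<lambda>i. card (?row (Suc i))) [0..<card ?col]"
  have mem: "(r, c) \<in> D \<longleftrightarrow> 1 \<le> r \<and> r \<le> card ?col \<and> 1 \<le> c \<and> c \<le> card (?row r)" for r c
  proof
    assume rc: "(r, c) \<in> D"
    then have "c \<in> ?row r" by simp
    then have "c \<in> {1..card (?row r)}" using row by blast
    moreover have "(r, 1) \<in> D" using youngD(2,3)[OF D rc] by simp
    then have "r \<in> ?col" by simp
    then have "r \<in> {1..card ?col}" using col by blast
    ultimately show "1 \<le> r \<and> r \<le> card ?col \<and> 1 \<le> c \<and> c \<le> card (?row r)" by simp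
  next
    assume "1 \<le> r \<and> r \<le> card ?col \<and> 1 \<le> c \<and> c \<le> card (?row r)"
    then have "c \<in> {1..card (?row r)}" by simp
    then have "c \<in> ?row r" using row by blast
    then show "(r, c) \<in> D" by simp
  qed
  have len: "length \<mu> = card ?col" by (simp add: \<mu>_def)
  have nth: "\<mu> ! (r - 1) = card (?row r)" if "1 \<le> r" "r \<le> card ?col" for r
    using that by (cases r) (simp_all add: \<mu>_def Suc_le_eq)
  have "(r, c) \<in> cells \<mu> \<longleftrightarrow> (r, c) \<in> D" for r c
  proof -
    define n where "n = card ?col"
    define l where "l = card (?row r)"
    have "(r, c) \<in> cells \<mu> \<longleftrightarrow> 1 \<le> r \<and> r \<le> n \<and> 1 \<le> c \<and> c \<le> \<mu> ! (r - 1)"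
      unfolding cells_def mem_Collect_eq case_prod_conv len n_def by blast
    moreover have "1 \<le> r \<Longrightarrow> r \<le> n \<Longrightarrow> \<mu> ! (r - 1) = l" unfolding n_def l_def by (rule nth)
    moreover have "(r, c) \<in> D \<longleftrightarrow> 1 \<le> r \<and> r \<le> n \<and> 1 \<le> c \<and> c \<le> l"
      unfolding n_def l_def by (rule mem)
    ultimately show ?thesis by auto
  qed
  then have "cells \<mu> = D" by auto
  moreover have "is_partition \<mu>"
    unfolding is_partition_def sorted_wrt_iff_nth_less
  proof (intro conjI allI impI)
    fix i j assume ij: "i < j" "j < length \<mu>"
    have "?row (Suc j) \<subseteq> ?row (Suc i)"
      using youngD(2)[OF D] youngD(3)[OF D, of "Suc j" _ "Suc i"] ij by force
    then have "card (?row (Suc j)) \<le> card (?row (Suc i))" by (rule card_mono[OF finr])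
    then show "\<mu> ! j \<le> \<mu> ! i" using ij by (simp add: \<mu>_def)
  next
    have "0 < card (?row (Suc i))" if "i < card ?col" for i
    proof -
      have "Suc i \<in> {1..card ?col}" using that by simp
      then have "(Suc i, 1) \<in> D" using col by blast
      then show ?thesis using finr[of "Suc i"] by (auto simp: card_gt_0_iff)
    qed
    then show "0 \<notin> set \<mu>" unfolding \<mu>_def by force
  qed
  ultimately show ?thesis using that by blast
qed

section \<open>Existence of expansions for arbitrary bounds\<close>

definition lower_corners :: "(nat \<times> nat) set \<Rightarrow> int \<Rightarrow> (nat \<times> nat \<Rightarrow> int) \<Rightarrow> nat \<times> nat \<Rightarrow> int"
  where "lower_corners D x B v = (if corner D (fst v) (snd v) then x else B v)"

lemma int_shift_invariant:
  fixes P :: "int \<Rightarrow> bool"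
  assumes "\<And>x. P x \<longleftrightarrow> P (x - 1)"
  shows "P x \<longleftrightarrow> P y"
proof -
  have down: "P x \<longleftrightarrow> P (x - int n)" for x n
  proof (induction n)
    case (Suc n)
    then show ?case using assms[of "x - int n"] by (simp add: algebra_simps)
  qed simp
  show ?thesis
  proof (cases "x \<le> y")
    case True
    then show ?thesis using down[of y "nat (y - x)"] by simp
  next
    case False
    then show ?thesis using down[of x "nat (x - y)"] by simp
  qed
qed

text \<open>The step is an equivalence, so the bound of a corner can travel to any integer in either
  direction. Which cells are corners depends on \<open>D\<close> only, so they can be treated one at
  a time.\<close>

lemma lower_corners_invariant:
  assumes D: "young D" and step: "\<And>B r c. corner D r c \<Longrightarrow> P B \<longleftrightarrow> P (B((r, c) := B (r, c) - 1))"
  shows "P B \<longleftrightarrow> P (lower_corners D x B)"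
proof -
  have one: "P B \<longleftrightarrow> P (B((r, c) := x))" if c: "corner D r c" for r c B
  proof -
    have "P (B((r, c) := y)) \<longleftrightarrow> P (B((r, c) := y - 1))" for y
      using step[OF c, of "B((r, c) := y)"] by simp
    then have "P (B((r, c) := B (r, c))) \<longleftrightarrow> P (B((r, c) := x))"
      by (rule int_shift_invariant)
    then show ?thesis by simp
  qed
  let ?C = "{v. corner D (fst v) (snd v)}"
  have "?C \<subseteq> D" by (auto simp: corner_def)
  then have fin: "finite ?C" using youngD(1)[OF D] finite_subset by blast
  have "P B \<longleftrightarrow> P (\<lambda>v. if v \<in> S then x else B v)" if "finite S" "S \<subseteq> ?C" for S
    using that
  proof (induction S)
    case (insert v S)
    have "(\<lambda>u. if u \<in> insert v S then x else B u) = (\<lambda>u. if u \<in> S then x else B u)((fst v, snd v) := x)"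
      by auto
    then show ?case using insert one[of "fst v" "snd v" "\<lambda>u. if u \<in> S then x else B u"] by simp
  qed simp
  from this[OF fin subset_refl] show ?thesis
    by (simp add: lower_corners_def[abs_def])
qed

text \<open>Every cell has a corner weakly to its southeast. Once all corners are bounded by
  \<open>x\<close>, so are all cells, and the bounds elsewhere, being at least \<open>x\<close>,
  become redundant.\<close>

lemma tableaux_lower_corners:
  assumes D: "young D" and x: "\<And>v. v \<in> D \<Longrightarrow> x \<le> B v" "\<And>v. v \<in> D \<Longrightarrow> x \<le> B' v"
  shows "tableaux D (lower_corners D x B) = tableaux D (lower_corners D x B')"
proof -
  have "T \<in> tableaux D (lower_corners D x B2)"
    if T: "T \<in> tableaux D (lower_corners D x B1)" and x: "\<And>v. v \<in> D \<Longrightarrow> x \<le> B2 v" for T B1 B2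
  proof (rule tableauxI[OF tableauxD(1)[OF T]])
    fix v assume v: "v \<in> D"
    obtain r c where rc: "v = (r, c)" by force
    obtain r' c' where c': "corner D r' c'" "r \<le> r'" "c \<le> c'"
      using corner_exists[OF D] v rc by blast
    have u: "(r', c') \<in> D" using c' by (simp add: corner_def)
    have "Max (T (r, c)) + (int r' - int r) \<le> Max (T (r', c'))"
      using v rc c' u by (intro ssvt_mono[OF D tableauxD(1)[OF T]]) auto
    moreover have "Max (T (r', c')) \<le> x"
      using tableauxD(2)[OF T u] c' by (simp add: lower_corners_def)
    ultimately have "Max (T v) \<le> x" using c' rc by simp
    then show "Max (T v) \<le> lower_corners D x B2 v" using x[OF v] by (simp add: lower_corners_def)
  qed
  then show ?thesis using x by blast
qed

lemma bound_below:
  assumes "finite D"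
  obtains x :: int where "\<And>v. v \<in> D \<Longrightarrow> x \<le> B v" "\<And>v. v \<in> D \<Longrightarrow> x \<le> B' v"
proof
  fix v assume v: "v \<in> D"
  then show "Min (insert 0 (B ` D \<union> B' ` D)) \<le> B v" "Min (insert 0 (B ` D \<union> B' ` D)) \<le> B' v"
    using assms by (auto intro!: Min_le)
qed

text \<open>As \<open>1 + beta * w\<close> is a unit of the coefficient ring, the corner recursion
  can be read in both directions. For fixed \<open>D\<close>, existence is thus unaffected by the
  bounds at corners, and lowering all corners far enough links an arbitrary \<open>B\<close> to the
  zero bound, where the function is \<open>G_minus\<close> itself.\<close>

lemma expansion_exists:
  assumes "young D"
  shows "\<exists>a. expansion_of (G D B) a"
  using assms
proof (induction "card D" arbitrary: D B rule: less_induct)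
  case (less D)
  note D = \<open>young D\<close>
  let ?P = "\<lambda>B. \<exists>a. expansion_of (G D B) a"
  have step: "?P B \<longleftrightarrow> ?P (B((r, c) := B (r, c) - 1))" if c: "corner D r c" for B r c
  proof -
    let ?b = "B (r, c) - 1"
    let ?w = "ominus (xvar (?b + 1)) (yvar (?b + 1 + int c - int r))"
      and ?v = "1 + beta * ominus (yvar (?b + 1 + int c - int r)) (xvar (?b + 1))"
    let ?g = "G (D - {(r, c)}) (cap_neighbours B r c ?b)"
    have eq: "G D B = (1 + beta * ?w) * G D (B((r, c) := ?b)) + ?w * ?g"
      by (rule G_corner[OF D c]) simp
    have v: "?v * (1 + beta * ?w) = 1" by (rule one_plus_ominus_inverse)
    have "?v * G D B = (?v * (1 + beta * ?w)) * G D (B((r, c) := ?b)) + ?v * ?w * ?g"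
      unfolding eq by (simp only: distrib_left ac_simps)
    then have eq': "G D (B((r, c) := ?b)) = ?v * G D B + (- (?v * ?w)) * ?g"
      unfolding v by simp
    have ring: "1 + beta * ?w \<in> coeff_ring" "?w \<in> coeff_ring" "?v \<in> coeff_ring" "- (?v * ?w) \<in> coeff_ring"
      by (intro coeff_ring_one_plus coeff_ring_ominus_xy coeff_ring_ominus_yx coeff_ring_minus coeff_ring.mult)+
    have "card (D - {(r, c)}) < card D"
      using c youngD(1)[OF D] by (intro psubset_card_mono) (auto simp: corner_def)
    then obtain a' where a': "expansion_of ?g a'"
      using less.hyps young_remove_corner[OF D c] by blast
    show ?thesis
    proof
      assume "?P (B((r, c) := ?b))"
      then show "?P B" using expansion_combine[OF _ a' ring(1,2)] unfolding eq by blast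
    next
      assume "?P B"
      then show "?P (B((r, c) := ?b))" using expansion_combine[OF _ a' ring(3,4)] unfolding eq' by blast
    qed
  qed
  obtain x where x: "\<And>v. v \<in> D \<Longrightarrow> x \<le> B v" "\<And>v. v \<in> D \<Longrightarrow> x \<le> (0 :: int)"
    using bound_below[OF youngD(1)[OF D], of B "\<lambda>_. 0"] by blast
  have "?P B \<longleftrightarrow> ?P (lower_corners D x B)"
    by (rule lower_corners_invariant[OF D, of ?P, OF step])
  also have "\<dots> \<longleftrightarrow> ?P (lower_corners D x (\<lambda>_. 0))"
    using G_cong[OF tableaux_lower_corners[OF D x(1) x(2), of "\<lambda>v. v"]] by simp
  also have "\<dots> \<longleftrightarrow> ?P (\<lambda>_. 0)"
    by (rule lower_corners_invariant[OF D, of ?P, OF step, symmetric])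
  also have "?P (\<lambda>_. 0)"
  proof -
    obtain \<mu> where "is_partition \<mu>" "cells \<mu> = D" using young_partition[OF D] by blast
    then show ?thesis using expansion_G_minus[of \<mu>] unfolding G_minus_eq_G by blast
  qed
  finally show ?case by simp
qed

section \<open>Coefficients after the substitution of y for x\<close>

definition J :: "(nat \<times> nat) set \<Rightarrow> (nat \<times> nat \<Rightarrow> int) \<Rightarrow> nat list \<Rightarrow> series"
  where "J D B \<mu> = x_to_y ((THE a. expansion_of (G D B) a) \<mu>)"

lemma J_eqI: "expansion_of (G D B) a \<Longrightarrow> J D B \<mu> = x_to_y (a \<mu>)"
  unfolding J_def using expansion_unique the_equality by (metis (no_types, lifting))

lemma J_cong: "tableaux D B = tableaux D B' \<Longrightarrow> J D B = J D B'"
  unfolding J_def fun_eq_iff by (drule G_cong) simp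

lemma J_corner:
  assumes D: "young D" and c: "corner D r c" and b: "B (r, c) = b + 1"
  defines "w \<equiv> upper_weight (b + 1) (b + 1 + int c - int r)"
  shows "J D B \<mu> = (1 + beta * w) * J D (B((r, c) := b)) \<mu>
    + w * J (D - {(r, c)}) (cap_neighbours B r c b) \<mu>"
proof -
  let ?w = "ominus (xvar (b + 1)) (yvar (b + 1 + int c - int r))"
  obtain a where a: "expansion_of (G D (B((r, c) := b))) a" using expansion_exists[OF D] by blast
  obtain a' where a': "expansion_of (G (D - {(r, c)}) (cap_neighbours B r c b)) a'"
    using expansion_exists[OF young_remove_corner[OF D c]] by blast
  have "expansion_of (G D B) (\<lambda>\<mu>. (1 + beta * ?w) * a \<mu> + ?w * a' \<mu>)"
    unfolding G_corner[of D r c B b, OF D c b]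
    by (intro expansion_combine a a' coeff_ring_one_plus coeff_ring_ominus_xy)
  then show ?thesis
    unfolding J_eqI[OF a] J_eqI[OF a'] w_def
    by (simp add: J_eqI x_to_y_add x_to_y_mult x_to_y_1 x_to_y_beta x_to_y_ominus)
qed

lemma J_base:
  assumes D: "young D"
  shows "J D (\<lambda>_. 0) \<mu> = (if is_partition \<mu> \<and> cells \<mu> = D then 1 else 0)"
proof -
  obtain \<nu> where \<nu>: "is_partition \<nu>" "cells \<nu> = D" using young_partition[OF D] by blast
  have "expansion_of (G D (\<lambda>_. 0)) (\<lambda>\<mu>. if \<mu> = \<nu> then 1 else 0)"
    using expansion_G_minus[OF \<nu>(1)] \<nu>(2) by (simp add: G_minus_eq_G)
  then have "J D (\<lambda>_. 0) \<mu> = (if \<mu> = \<nu> then 1 else 0)"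
    by (simp add: J_eqI x_to_y_0 x_to_y_1)
  moreover have "\<mu> = \<nu> \<longleftrightarrow> is_partition \<mu> \<and> cells \<mu> = D"
    using cells_inject[of \<mu> \<nu>] \<nu> by auto
  ultimately show ?thesis by simp
qed

text \<open>
  Diagonal positions have weight zero once \<open>x\<close> is specialised to \<open>y\<close>, so the bound on the last
  diagonal cell is irrelevant; if that cell is not a corner, lowering the corners makes its bound redundant.
\<close>

lemma J_diagonal:
  assumes "young D" "(q, q) \<in> D" "(Suc q, Suc q) \<notin> D"
  shows "J D (B((q, q) := s)) \<mu> = J D (B((q, q) := t)) \<mu>"
  using assms
proof (induction "card D" arbitrary: D B s t rule: less_induct)
  case (less D)
  note D = \<open>young D\<close>
  interpret up: regular_exchange_system beta upper_weight by (rule upper_system)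
  show ?case
  proof (cases "corner D q q")
    case True
    have "J D (B((q, q) := x)) \<mu> = J D (B((q, q) := x - 1)) \<mu>" for x
      using J_corner[OF D True, of "B((q, q) := x)" "x - 1" \<mu>] by simp
    then have "(J D (B((q, q) := x)) \<mu> = J D (B((q, q) := t)) \<mu>) \<longleftrightarrow>
        (J D (B((q, q) := x - 1)) \<mu> = J D (B((q, q) := t)) \<mu>)" for x by simp
    from int_shift_invariant[of "\<lambda>x. J D (B((q, q) := x)) \<mu> = J D (B((q, q) := t)) \<mu>" s t, OF this]
    show ?thesis by simp
  next
    case False
    let ?P = "\<lambda>B. J D (B((q, q) := s)) \<mu> = J D (B((q, q) := t)) \<mu>"
    have step: "?P B \<longleftrightarrow> ?P (B((r, c) := B (r, c) - 1))" if c: "corner D r c" for B r c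
    proof -
      have ne: "(r, c) \<noteq> (q, q)" using c False by auto
      let ?b = "B (r, c) - 1"
      let ?w = "upper_weight (?b + 1) (?b + 1 + int c - int r)"
      let ?D' = "D - {(r, c)}"
      have 1: "J D (B((q, q) := x)) \<mu> = (1 + beta * ?w) * J D ((B((r, c) := ?b))((q, q) := x)) \<mu>
          + ?w * J ?D' (cap_neighbours (B((q, q) := x)) r c ?b) \<mu>" for x
      proof -
        have "(B((q, q) := x)) (r, c) = ?b + 1" using ne by auto
        from J_corner[OF D c, of "B((q, q) := x)" ?b, OF this] show ?thesis
          by (simp only: fun_upd_twist[OF ne[symmetric]])
      qed
      let ?C = "\<lambda>x. cap_neighbours (B((q, q) := x)) r c ?b"
      have "J ?D' (?C s) \<mu> = J ?D' ((?C s)((q, q) := ?C s (q, q))) \<mu>" by simp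
      also have "\<dots> = J ?D' ((?C s)((q, q) := ?C t (q, q))) \<mu>"
      proof (rule less.hyps)
        show "card ?D' < card D"
          using c youngD(1)[OF D] by (intro psubset_card_mono) (auto simp: corner_def)
        show "young ?D'" by (rule young_remove_corner[OF D c])
        show "(q, q) \<in> ?D'" "(Suc q, Suc q) \<notin> ?D'" using less.prems ne by auto
      qed
      also have "(?C s)((q, q) := ?C t (q, q)) = ?C t"
      proof
        fix v
        show "((?C s)((q, q) := ?C t (q, q))) v = ?C t v"
          by (cases "v = (q, q)") (simp_all only: fun_upd_apply if_True if_False cap_neighbours_def simp_thms)
      qed
      finally have 2: "J ?D' (?C s) \<mu> = J ?D' (?C t) \<mu>" .
      have cancel: "(1 + beta * ?w) * f = (1 + beta * ?w) * g \<longleftrightarrow> f = g" for f g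
      proof
        assume "(1 + beta * ?w) * f = (1 + beta * ?w) * g"
        then have "((1 + beta * upper_weight (?b + 1 + int c - int r) (?b + 1)) * (1 + beta * ?w)) * f =
            ((1 + beta * upper_weight (?b + 1 + int c - int r) (?b + 1)) * (1 + beta * ?w)) * g"
          by (simp only: mult.assoc)
        then show "f = g" unfolding up.one_plus_inverse by simp
      qed simp
      show ?thesis unfolding 1 2 by (simp only: add_right_cancel cancel)
    qed
    obtain x where x: "\<And>v. v \<in> D \<Longrightarrow> x \<le> (B((q, q) := s)) v" "\<And>v. v \<in> D \<Longrightarrow> x \<le> (B((q, q) := t)) v"
      using bound_below[OF youngD(1)[OF D], of "B((q, q) := s)" "B((q, q) := t)"] by blast
    have lc: "(lower_corners D x B)((q, q) := y) = lower_corners D x (B((q, q) := y))" for y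
      using False by (auto simp: lower_corners_def fun_eq_iff)
    have "?P B \<longleftrightarrow> ?P (lower_corners D x B)"
      by (rule lower_corners_invariant[OF D, of ?P, OF step])
    moreover have "?P (lower_corners D x B)"
      unfolding lc by (simp only: J_cong[OF tableaux_lower_corners[OF D x]])
    ultimately show ?thesis by blast
  qed
qed

section \<open>Frobenius coordinates\<close>

definition decreasing :: "nat \<Rightarrow> (nat \<Rightarrow> nat) \<Rightarrow> bool"
  where "decreasing q k \<longleftrightarrow> (\<forall>i. 1 \<le> i \<and> i < q \<longrightarrow> k (Suc i) < k i)"

text \<open>The shape with \<open>q\<close> diagonal cells, arm lengths \<open>k\<close> and leg lengths \<open>k'\<close>.\<close>

definition frob :: "nat \<Rightarrow> (nat \<Rightarrow> nat) \<Rightarrow> (nat \<Rightarrow> nat) \<Rightarrow> (nat \<times> nat) set"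
  where "frob q k k' = {(r, c). 1 \<le> r \<and> 1 \<le> c \<and>
    (if r \<le> c then r \<le> q \<and> c \<le> r + k r else c \<le> q \<and> r \<le> c + k' c)}"

text \<open>
  Row \<open>r\<close> is bounded by \<open>p r\<close> to the right of the diagonal; below the diagonal, \<open>p' c\<close> bounds the
  y-index \<open>i + c - r\<close> of the entries \<open>i\<close> in column \<open>c\<close>.
\<close>

definition frob_bound :: "(nat \<Rightarrow> int) \<Rightarrow> (nat \<Rightarrow> int) \<Rightarrow> nat \<times> nat \<Rightarrow> int"
  where "frob_bound p p' = (\<lambda>(r, c). if r < c then p r else if c < r then p' c + int r - int c
    else min (p r) (p' c))"

lemma nested_decreasing: "nested q k p \<Longrightarrow> decreasing q k"
  by (simp add: nested_def decreasing_def)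

lemma decreasing_le:
  assumes "decreasing q k" "1 \<le> i" "i \<le> j" "j \<le> q"
  shows "k j + (j - i) \<le> k i"
  using assms(3,4)
proof (induction j rule: dec_induct)
  case (step n)
  then have "k (Suc n) < k n" using assms(1,2) unfolding decreasing_def by auto
  then show ?case using step by auto
qed simp

lemma frob_upper: "(r, c) \<in> frob q k k' \<Longrightarrow> r \<le> c \<Longrightarrow> 1 \<le> r \<and> r \<le> q \<and> c \<le> r + k r"
  and frob_lower: "(r, c) \<in> frob q k k' \<Longrightarrow> c < r \<Longrightarrow> 1 \<le> c \<and> c \<le> q \<and> r \<le> c + k' c"
  by (auto simp: frob_def)

lemma frob_upperI: "1 \<le> r \<Longrightarrow> r \<le> q \<Longrightarrow> r \<le> c \<Longrightarrow> c \<le> r + k r \<Longrightarrow> (r, c) \<in> frob q k k'"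
  and frob_lowerI: "1 \<le> c \<Longrightarrow> c \<le> q \<Longrightarrow> c \<le> r \<Longrightarrow> r \<le> c + k' c \<Longrightarrow> (r, c) \<in> frob q k k'"
  by (auto simp: frob_def)

lemma young_frob:
  assumes k: "decreasing q k" and k': "decreasing q k'"
  shows "young (frob q k k')"
proof -
  have "frob q k k' \<subseteq> {0..q + sum k' {0..q}} \<times> {0..q + sum k {0..q}}"
  proof
    fix u assume u: "u \<in> frob q k k'"
    obtain r c where rc: "u = (r, c)" by force
    have m: "k i \<le> sum k {0..q}" "k' i \<le> sum k' {0..q}" if "i \<le> q" for i
      using that by (auto intro!: member_le_sum)
    show "u \<in> {0..q + sum k' {0..q}} \<times> {0..q + sum k {0..q}}"
    proof (cases "r \<le> c")
      case True
      then show ?thesis using frob_upper[of r c q k k'] u rc m(1)[of r] by auto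
    next
      case False
      then show ?thesis using frob_lower[of r c q k k'] u rc m(2)[of c] by auto
    qed
  qed
  then have "finite (frob q k k')" by (rule finite_subset) simp
  moreover have "(r', c') \<in> frob q k k'"
    if rc: "(r, c) \<in> frob q k k'" and le: "1 \<le> r'" "r' \<le> r" "1 \<le> c'" "c' \<le> c" for r c r' c'
  proof (cases "r \<le> c")
    case True
    note u = frob_upper[OF rc True]
    show ?thesis
    proof (cases "r' \<le> c'")
      case True
      have "k r + (r - r') \<le> k r'" using u le by (intro decreasing_le[OF k]) auto
      then show ?thesis using True u le by (intro frob_upperI) auto
    next
      case False
      \<comment> \<open>Here \<open>(r', c')\<close> lies in the square of side \<open>q\<close>;
        strict decrease makes each of the first \<open>q\<close> legs reach at least row
        \<open>q\<close>.\<close>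
      have "k' q + (q - c') \<le> k' c'" using False u le by (intro decreasing_le[OF k']) auto
      then show ?thesis using False u le by (intro frob_lowerI) auto
    qed
  next
    case False
    then have lt: "c < r" by simp
    note u = frob_lower[OF rc lt]
    show ?thesis
    proof (cases "c' \<le> r'")
      case True
      have "k' c + (c - c') \<le> k' c'" using u le by (intro decreasing_le[OF k']) auto
      then show ?thesis using True u le by (intro frob_lowerI) auto
    next
      case False
      have "k q + (q - r') \<le> k r'" using False u le by (intro decreasing_le[OF k]) auto
      then show ?thesis using False u le by (intro frob_upperI) auto
    qed
  qed
  moreover have "\<forall>(r, c) \<in> frob q k k'. 1 \<le> r \<and> 1 \<le> c" by (auto simp: frob_def)
  ultimately show ?thesis unfolding young_def by blast
qed

lemma tableaux_bound_cong:
  assumes "\<And>r c. (r, c) \<in> D \<Longrightarrow> B (r, c) = B' (r, c)"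
  shows "tableaux D B = tableaux D B'"
  unfolding tableaux_def using assms by (intro Collect_cong conj_cong refl ball_cong) auto

lemma tableaux_bound_mono:
  assumes "\<And>r c. (r, c) \<in> D \<Longrightarrow> B (r, c) \<le> B' (r, c)"
  shows "tableaux D B \<subseteq> tableaux D B'"
proof
  fix T assume T: "T \<in> tableaux D B"
  show "T \<in> tableaux D B'"
  proof (rule tableauxI[OF tableauxD(1)[OF T]])
    fix v assume v: "v \<in> D"
    then show "Max (T v) \<le> B' v"
      using tableauxD(2)[OF T v] assms[of "fst v" "snd v"] by simp
  qed
qed

lemma frob_J_cong:
  assumes "\<And>i. i \<in> {1..q} \<Longrightarrow> p i = p1 i" "\<And>i. i \<in> {1..q} \<Longrightarrow> p' i = p1' i"
  shows "J (frob q k k') (frob_bound p p') = J (frob q k k') (frob_bound p1 p1')"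
proof (intro J_cong tableaux_bound_cong)
  fix r c assume "(r, c) \<in> frob q k k'"
  then show "frob_bound p p' (r, c) = frob_bound p1 p1' (r, c)"
    using assms(1)[of r] assms(2)[of c] by (cases "r \<le> c") (auto simp: frob_bound_def frob_def)
qed

lemma frob_diagonal:
  assumes k: "decreasing q k" and k': "decreasing q k'" and q: "1 \<le> q"
    and eq: "\<And>r c. (r, c) \<in> frob q k k' \<Longrightarrow> (r, c) \<noteq> (q, q) \<Longrightarrow> B (r, c) = B' (r, c)"
  shows "J (frob q k k') B \<mu> = J (frob q k k') B' \<mu>"
proof -
  let ?D = "frob q k k'"
  have "J ?D B \<mu> = J ?D (B((q, q) := B (q, q))) \<mu>" by simp
  also have "\<dots> = J ?D (B((q, q) := B' (q, q))) \<mu>"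
    using q by (intro J_diagonal young_frob k k') (auto simp: frob_def)
  also have "J ?D (B((q, q) := B' (q, q))) = J ?D B'"
    using eq by (intro J_cong tableaux_bound_cong) auto
  finally show ?thesis .
qed

text \<open>Row \<open>r\<close> ends in column \<open>r + k r\<close>. If the next row ends there
  too, its bound \<open>p r + 1\<close> already forces the entries of row \<open>r\<close> to be at
  most \<open>p r\<close>. If only the last diagonal cell is left, its bound is irrelevant.
  Otherwise the end of the row is a corner, and the exchange is the corner recursion.\<close>

lemma upper_exchange_rules:
  assumes k': "decreasing q k'"
  shows "exchange_rules beta upper_weight q (\<lambda>k p. J (frob q k k') (frob_bound p p') \<mu>)"
  unfolding exchange_rules_def
proof (intro conjI allI impI)
  fix k p p1 assume "\<forall>i \<in> {1..q}. p i = (p1 i :: int)"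
  then show "J (frob q k k') (frob_bound p p') \<mu> = J (frob q k k') (frob_bound p1 p') \<mu>"
    by (intro fun_cong[OF frob_J_cong]) auto
next
  fix k p r assume n: "nested q k p" and n1: "nested q k (p(r := p r + 1))" and r: "r \<in> {1..q}"
  let ?D = "frob q k k'" and ?p = "p(r := p r + 1)"
  let ?w = "upper_weight (p r + 1) (p r + int (k r) + 1)"
  note k = nested_decreasing[OF n]
  note D = young_frob[OF k k']
  show "J ?D (frob_bound ?p p') \<mu> =
      (if r < q \<and> k r = Suc (k (Suc r)) \<or> r = q \<and> k q = 0 then J ?D (frob_bound p p') \<mu>
       else (1 + beta * ?w) * J ?D (frob_bound p p') \<mu>
         + ?w * J (frob q (k(r := k r - 1)) k') (frob_bound ?p p') \<mu>)"
  proof (cases "r < q \<and> k r = Suc (k (Suc r)) \<or> r = q \<and> k q = 0")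
    case True
    then consider (tied) "r < q" "k r = Suc (k (Suc r))" | (empty) "r = q" "k q = 0" by (elim disjE conjE)
    then have "J ?D (frob_bound ?p p') \<mu> = J ?D (frob_bound p p') \<mu>"
    proof cases
      case tied
      then have ps: "p (Suc r) = p r + 1"
        using n n1 r unfolding nested_def by (auto split: if_splits)
      have "tableaux ?D (frob_bound ?p p') \<subseteq> tableaux ?D (frob_bound p p')"
      proof
        fix T assume T: "T \<in> tableaux ?D (frob_bound ?p p')"
        have row: "Max (T (r, c)) \<le> p r" if "(r, c) \<in> ?D" "r < c" for c
        proof -
          have u: "(Suc r, c) \<in> ?D"
            using frob_upper[OF that(1)] that tied r by (intro frob_upperI) auto
          have "Max (T (r, c)) + (int (Suc r) - int r) \<le> Max (T (Suc r, c))"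
            by (rule ssvt_mono[OF D tableauxD(1)[OF T] that(1) u]) auto
          also have "Max (T (Suc r, c)) \<le> p (Suc r)"
            using tableauxD(2)[OF T u] that by (auto simp: frob_bound_def split: if_splits)
          finally show ?thesis using ps by simp
        qed
        have diag: "Max (T (r, r)) \<le> p r" if rr: "(r, r) \<in> ?D"
        proof -
          have u: "(r, Suc r) \<in> ?D" using tied r by (intro frob_upperI) auto
          have "Max (T (r, r)) + (int r - int r) \<le> Max (T (r, Suc r))"
            by (rule ssvt_mono[OF D tableauxD(1)[OF T] rr u]) auto
          then show ?thesis using row[OF u] by simp
        qed
        show "T \<in> tableaux ?D (frob_bound p p')"
        proof (rule tableauxI[OF tableauxD(1)[OF T]])
          fix v assume v: "v \<in> ?D"
          obtain s c where sc: "v = (s, c)" by force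
          show "Max (T v) \<le> frob_bound p p' v"
            using tableauxD(2)[OF T v] row[of c] diag v sc
            by (cases "s = r") (auto simp: frob_bound_def split: if_splits)
        qed
      qed
      moreover have "tableaux ?D (frob_bound p p') \<subseteq> tableaux ?D (frob_bound ?p p')"
        by (rule tableaux_bound_mono) (auto simp: frob_bound_def)
      ultimately show ?thesis by (intro fun_cong[OF J_cong]) blast
    next
      case empty
      have "frob_bound ?p p' (s, c) = frob_bound p p' (s, c)"
        if "(s, c) \<in> ?D" "(s, c) \<noteq> (q, q)" for s c
        using that empty frob_upper[of q c q k k'] by (auto simp: frob_bound_def)
      then show ?thesis using r by (intro frob_diagonal[OF k k']) auto
    qed
    then show ?thesis using True by simp
  next
    case False
    note kr = nested_remove(2)[OF n n1 r False]
    have rq: "1 \<le> r" "r \<le> q" using r by auto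
    have small: "Suc (k (Suc r)) < k r" if "r < q"
    proof -
      have "k (Suc r) < k r" using k rq that by (simp add: decreasing_def)
      then show ?thesis using False that by simp
    qed
    let ?c = "r + k r" and ?B = "frob_bound ?p p'"
    have c: "corner ?D r ?c"
      unfolding corner_def
    proof (intro conjI notI)
      show "(r, ?c) \<in> ?D" using rq by (intro frob_upperI) auto
      show False if "(Suc r, ?c) \<in> ?D"
        using frob_upper[OF that] kr small by (cases "r < q") auto
      show False if "(r, Suc ?c) \<in> ?D" using frob_upper[OF that] by simp
    qed
    have b: "?B (r, ?c) = p r + 1" using kr by (simp add: frob_bound_def)
    \<comment> \<open>Entries increase weakly along a row, so lowering the bound at its end lowers
      the bound of the whole row.\<close>
    have 1: "J ?D (?B((r, ?c) := p r)) = J ?D (frob_bound p p')"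
    proof (rule J_cong, rule equalityI)
      show "tableaux ?D (frob_bound p p') \<subseteq> tableaux ?D (?B((r, ?c) := p r))"
        using kr by (intro tableaux_bound_mono) (auto simp: frob_bound_def)
      show "tableaux ?D (?B((r, ?c) := p r)) \<subseteq> tableaux ?D (frob_bound p p')"
      proof
        fix T assume T: "T \<in> tableaux ?D (?B((r, ?c) := p r))"
        have u: "(r, ?c) \<in> ?D" using c by (simp add: corner_def)
        have row: "Max (T (r, d)) \<le> p r" if "(r, d) \<in> ?D" "r \<le> d" for d
        proof -
          have "Max (T (r, d)) + (int r - int r) \<le> Max (T (r, ?c))"
            using frob_upper[OF that] by (intro ssvt_mono[OF D tableauxD(1)[OF T] that(1) u]) auto
          also have "\<dots> \<le> p r" using tableauxD(2)[OF T u] by simp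
          finally show ?thesis by simp
        qed
        show "T \<in> tableaux ?D (frob_bound p p')"
        proof (rule tableauxI[OF tableauxD(1)[OF T]])
          fix v assume v: "v \<in> ?D"
          obtain s d where sd: "v = (s, d)" by force
          show "Max (T v) \<le> frob_bound p p' v"
            using tableauxD(2)[OF T v] row[of d] v sd kr
            by (cases "s = r") (auto simp: frob_bound_def split: if_splits)
        qed
      qed
    qed
    have D': "?D - {(r, ?c)} = frob q (k(r := k r - 1)) k'"
      using kr by (auto simp: frob_def split: if_splits)
    \<comment> \<open>The caps restrict nothing: the left neighbour already has a bound of at most
      \<open>p r + 1\<close>, and the upper one has the bound
      \<open>p (r - 1) \<le> p r\<close>.\<close>
    have 2: "J (?D - {(r, ?c)}) (cap_neighbours ?B r ?c (p r)) = J (frob q (k(r := k r - 1)) k') ?B"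
      unfolding D'
    proof (intro J_cong tableaux_bound_cong)
      fix s d assume sd: "(s, d) \<in> frob q (k(r := k r - 1)) k'"
      have up: "p (r - 1) \<le> p r" if "1 < r"
        using nested_le[OF n, of "r - 1" r] that rq by auto
      show "cap_neighbours ?B r ?c (p r) (s, d) = ?B (s, d)"
      proof (cases "(s, d) = (r, ?c - 1)")
        case True
        then show ?thesis using kr by (auto simp: cap_neighbours_def frob_bound_def)
      next
        case left: False
        show ?thesis
        proof (cases "(s, d) = (r - 1, ?c)")
          case True
          then have "1 < r" using sd kr by (auto simp: frob_def split: if_splits)
          then have "?B (s, d) = p (r - 1)" using True kr by (auto simp: frob_bound_def)
          moreover have "r - 1 \<noteq> r" using \<open>1 < r\<close> by simp
          ultimately show ?thesis using True up[OF \<open>1 < r\<close>] by (simp add: cap_neighbours_def)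
        qed (use left in \<open>auto simp: cap_neighbours_def\<close>)
      qed
    qed
    have w: "upper_weight (p r + 1) (p r + 1 + int ?c - int r) = ?w" by (simp add: algebra_simps)
    show ?thesis
      unfolding if_not_P[OF False]
      using J_corner[of ?D r ?c ?B "p r" \<mu>, OF D c b] unfolding w 1 2 .
  qed
qed


text \<open>The bottom entry of a proper leg in column \<open>c\<close> is bounded by
  \<open>- p c\<close>, so raising \<open>p c\<close> lowers the bound and the corner recursion has
  to be inverted. Deleting the bottom cell leaves the bound on the y-indices unchanged, because
  \<open>p c\<close> grows as \<open>k' c\<close> shrinks.\<close>

lemma lower_exchange_rules:
  assumes k: "decreasing q k"
  shows "exchange_rules beta lower_weight q
    (\<lambda>k' p. J (frob q k k') (frob_bound p0 (\<lambda>c. - p c - int (k' c))) \<mu>)"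
  unfolding exchange_rules_def
proof (intro conjI allI impI)
  fix k' p p1 assume "\<forall>i \<in> {1..q}. p i = (p1 i :: int)"
  then show "J (frob q k k') (frob_bound p0 (\<lambda>c. - p c - int (k' c))) \<mu> =
      J (frob q k k') (frob_bound p0 (\<lambda>c. - p1 c - int (k' c))) \<mu>"
    by (intro fun_cong[OF frob_J_cong]) auto
next
  fix k' p c assume n: "nested q k' p" and n1: "nested q k' (p(c := p c + 1))" and c: "c \<in> {1..q}"
  let ?D = "frob q k k'" and ?p = "p(c := p c + 1)" and ?k = "k'(c := k' c - 1)"
  let ?f = "\<lambda>d. - p d - int (k' d)" and ?f1 = "\<lambda>d. - ?p d - int (k' d)"
  let ?w = "lower_weight (p c + 1) (p c + int (k' c) + 1)"
  note k' = nested_decreasing[OF n]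
  note D = young_frob[OF k k']
  have f1_le: "frob_bound p0 ?f1 v \<le> frob_bound p0 ?f v" for v
    by (cases v) (auto simp: frob_bound_def)
  have f1_other: "frob_bound p0 ?f1 (s, d) = frob_bound p0 ?f (s, d)" if "d \<noteq> c \<or> s < d" for s d
    using that by (auto simp: frob_bound_def)
  show "J ?D (frob_bound p0 ?f1) \<mu> =
      (if c < q \<and> k' c = Suc (k' (Suc c)) \<or> c = q \<and> k' q = 0 then J ?D (frob_bound p0 ?f) \<mu>
       else (1 + beta * ?w) * J ?D (frob_bound p0 ?f) \<mu>
         + ?w * J (frob q k ?k) (frob_bound p0 (\<lambda>d. - ?p d - int (?k d))) \<mu>)"
  proof (cases "c < q \<and> k' c = Suc (k' (Suc c)) \<or> c = q \<and> k' q = 0")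
    case True
    then consider (tied) "c < q" "k' c = Suc (k' (Suc c))" | (empty) "c = q" "k' q = 0" by (elim disjE conjE)
    then have "J ?D (frob_bound p0 ?f1) \<mu> = J ?D (frob_bound p0 ?f) \<mu>"
    proof cases
      case tied
      then have ps: "p (Suc c) = p c + 1"
        using n n1 c unfolding nested_def by (auto split: if_splits)
      have "tableaux ?D (frob_bound p0 ?f) \<subseteq> tableaux ?D (frob_bound p0 ?f1)"
      proof
        fix T assume T: "T \<in> tableaux ?D (frob_bound p0 ?f)"
        have col: "Max (T (r, c)) \<le> ?f c + int r - int c - 1" if "(r, c) \<in> ?D" "c < r" for r
        proof -
          have u: "(r, Suc c) \<in> ?D"
            using frob_lower[OF that(1)] that tied c by (intro frob_lowerI) auto
          have "Max (T (r, c)) + (int r - int r) \<le> Max (T (r, Suc c))"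
            by (rule ssvt_mono[OF D tableauxD(1)[OF T] that(1) u]) auto
          also have "Max (T (r, Suc c)) \<le> ?f (Suc c) + int r - int (Suc c)"
            using tableauxD(2)[OF T u] that by (auto simp: frob_bound_def split: if_splits)
          finally show ?thesis using ps tied by simp
        qed
        have diag: "Max (T (c, c)) \<le> ?f c - 1" if cc: "(c, c) \<in> ?D"
        proof -
          have u: "(Suc c, c) \<in> ?D" using tied c by (intro frob_lowerI) auto
          have "Max (T (c, c)) + (int (Suc c) - int c) \<le> Max (T (Suc c, c))"
            by (rule ssvt_mono[OF D tableauxD(1)[OF T] cc u]) auto
          then show ?thesis using col[OF u] by simp
        qed
        show "T \<in> tableaux ?D (frob_bound p0 ?f1)"
        proof (rule tableauxI[OF tableauxD(1)[OF T]])
          fix v assume v: "v \<in> ?D"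
          obtain r d where rd: "v = (r, d)" by force
          show "Max (T v) \<le> frob_bound p0 ?f1 v"
          proof (cases "d \<noteq> c \<or> r < d")
            case True
            then show ?thesis using tableauxD(2)[OF T v] f1_other rd by simp
          next
            case False
            then show ?thesis
              using tableauxD(2)[OF T v] col[of r] diag v rd
              by (cases "r = c") (auto simp: frob_bound_def)
          qed
        qed
      qed
      moreover have "tableaux ?D (frob_bound p0 ?f1) \<subseteq> tableaux ?D (frob_bound p0 ?f)"
        by (rule tableaux_bound_mono) (rule f1_le)
      ultimately show ?thesis by (intro fun_cong[OF J_cong]) blast
    next
      case empty
      have "frob_bound p0 ?f1 (s, d) = frob_bound p0 ?f (s, d)"
        if sd: "(s, d) \<in> ?D" "(s, d) \<noteq> (q, q)" for s d
      proof (rule f1_other, rule ccontr)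
        assume "\<not> (d \<noteq> c \<or> s < d)"
        then have "d = q" "q < s" using sd empty by auto
        then show False using frob_lower[of s q q k k'] sd empty by auto
      qed
      then show ?thesis using c by (intro frob_diagonal[OF k k']) auto
    qed
    then show ?thesis using True by simp
  next
    case False
    note kc = nested_remove(2)[OF n n1 c False]
    have cq: "1 \<le> c" "c \<le> q" using c by auto
    have small: "Suc (k' (Suc c)) < k' c" if "c < q"
    proof -
      have "k' (Suc c) < k' c" using k' cq that by (simp add: decreasing_def)
      then show ?thesis using False that by simp
    qed
    let ?r = "c + k' c" and ?B = "frob_bound p0 ?f" and ?b = "- p c - 1"
    have u: "(?r, c) \<in> ?D" using cq by (intro frob_lowerI) auto
    have co: "corner ?D ?r c"
      unfolding corner_def
    proof (intro conjI notI)
      show "(?r, c) \<in> ?D" by (rule u)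
      show False if "(?r, Suc c) \<in> ?D"
      proof (cases "Suc c < ?r")
        case True
        then show False using frob_lower[OF that] small by (cases "c < q") auto
      next
        case False
        then show False using frob_upper[OF that] kc small by (cases "c < q") auto
      qed
      show False if "(Suc ?r, c) \<in> ?D" using frob_lower[OF that] by simp
    qed
    have b: "?B (?r, c) = ?b + 1" using kc by (simp add: frob_bound_def)
    have 1: "J ?D (?B((?r, c) := ?b)) = J ?D (frob_bound p0 ?f1)"
    proof (rule J_cong, rule equalityI)
      show "tableaux ?D (frob_bound p0 ?f1) \<subseteq> tableaux ?D (?B((?r, c) := ?b))"
      proof (rule tableaux_bound_mono)
        fix s d
        show "frob_bound p0 ?f1 (s, d) \<le> (?B((?r, c) := ?b)) (s, d)"
          using f1_le[of "(s, d)"] kc by (auto simp: frob_bound_def)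
      qed
      show "tableaux ?D (?B((?r, c) := ?b)) \<subseteq> tableaux ?D (frob_bound p0 ?f1)"
      proof
        fix T assume T: "T \<in> tableaux ?D (?B((?r, c) := ?b))"
        have col: "Max (T (s, c)) \<le> ?f1 c + int s - int c" if "(s, c) \<in> ?D" "c \<le> s" for s
        proof -
          have "s \<le> ?r"
            using frob_lower[OF that(1)] that by (cases "c < s") auto
          then have "Max (T (s, c)) + (int ?r - int s) \<le> Max (T (?r, c))"
            by (intro ssvt_mono[OF D tableauxD(1)[OF T] that(1) u]) auto
          also have "\<dots> \<le> ?b" using tableauxD(2)[OF T u] by simp
          finally show ?thesis by simp
        qed
        show "T \<in> tableaux ?D (frob_bound p0 ?f1)"
        proof (rule tableauxI[OF tableauxD(1)[OF T]])
          fix v assume v: "v \<in> ?D"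
          obtain s d where sd: "v = (s, d)" by force
          show "Max (T v) \<le> frob_bound p0 ?f1 v"
          proof (cases "d \<noteq> c \<or> s < d")
            case True
            then show ?thesis using tableauxD(2)[OF T v] f1_other[OF True] sd kc by (auto split: if_splits)
          next
            case False
            then have d: "d = c" "c \<le> s" by auto
            have "Max (T (s, c)) \<le> p0 c" if "s = c"
              using tableauxD(2)[OF T v] sd d kc that by (auto simp: frob_bound_def split: if_splits)
            then show ?thesis
              using col[of s] v sd d by (auto simp: frob_bound_def)
          qed
        qed
      qed
    qed
    have D': "?D - {(?r, c)} = frob q k ?k"
      using kc by (auto simp: frob_def split: if_splits)
    have f2: "(\<lambda>d. - ?p d - int (?k d)) = ?f"
      using kc by (auto simp: fun_eq_iff of_nat_diff)
    have 2: "J (?D - {(?r, c)}) (cap_neighbours ?B ?r c ?b) =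
        J (frob q k ?k) (frob_bound p0 (\<lambda>d. - ?p d - int (?k d)))"
      unfolding D' f2
    proof (intro J_cong tableaux_bound_cong)
      fix s d assume sd: "(s, d) \<in> frob q k ?k"
      have up: "?f (c - 1) + 1 \<le> ?f c" if "1 < c"
      proof -
        have "1 \<le> c - 1" "c - 1 \<noteq> c" using that by auto
        then show ?thesis using nested_le[OF n1, of "c - 1" c] cq by simp
      qed
      show "cap_neighbours ?B ?r c ?b (s, d) = ?B (s, d)"
      proof (cases "(s, d) = (?r, c - 1)")
        case True
        then have "1 < c" using sd kc by (auto simp: frob_def split: if_splits)
        then have "?B (s, d) \<le> ?b + 1" using True up[OF \<open>1 < c\<close>] by (auto simp: frob_bound_def of_nat_diff)
        then show ?thesis using True by (simp add: cap_neighbours_def)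
      next
        case left: False
        show ?thesis
        proof (cases "(s, d) = (?r - 1, c)")
          case True
          then have "?B (s, d) \<le> ?b" using kc by (auto simp: frob_bound_def of_nat_diff)
          moreover have "?r - 1 \<noteq> ?r" using kc by simp
          ultimately show ?thesis using True by (simp add: cap_neighbours_def)
        qed (use left in \<open>auto simp: cap_neighbours_def\<close>)
      qed
    qed
    interpret up: regular_exchange_system beta upper_weight by (rule upper_system)
    let ?inv = "upper_weight (- p c) (- p c - int (k' c))"
    have w0: "upper_weight (?b + 1) (?b + 1 + int c - int ?r) = ?inv" by (simp add: algebra_simps)
    have w: "?w = upper_weight (- p c - int (k' c)) (- p c)"
      by (simp add: lower_weight_def upper_weight_def)
    have inv: "(1 + beta * ?w) * (1 + beta * ?inv) = 1" unfolding w by (rule up.one_plus_inverse)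
    \<comment> \<open>The two weights are inverse to each other in the sense
      \<open>?w + ?inv + beta * ?w * ?inv = 0\<close>; this solves the corner recursion for the
      state with lowered bound.\<close>
    have "(1 + beta * ?w) * ?inv = (?w + ?inv + beta * ?w * ?inv) - ?w" by (simp add: distrib_right)
    also have "?w + ?inv + beta * ?w * ?inv = 0"
      unfolding w
      using up.e_trans[where a = "- p c - int (k' c)" and b = "- p c" and c = "- p c - int (k' c)", symmetric]
      by simp
    finally have neg: "(1 + beta * ?w) * ?inv = - ?w" by simp
    let ?ra = "J ?D (frob_bound p0 ?f1) \<mu>"
      and ?re = "J (frob q k ?k) (frob_bound p0 (\<lambda>d. - ?p d - int (?k d))) \<mu>"
    have J: "J ?D ?B \<mu> = (1 + beta * ?inv) * ?ra + ?inv * ?re"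
      using J_corner[of ?D ?r c ?B ?b \<mu>, OF D co b] unfolding w0 1 2 .
    have "(1 + beta * ?w) * J ?D ?B \<mu> + ?w * ?re =
        ((1 + beta * ?w) * (1 + beta * ?inv)) * ?ra + ((1 + beta * ?w) * ?inv) * ?re + ?w * ?re"
      unfolding J distrib_left[of "1 + beta * ?w" "(1 + beta * ?inv) * ?ra"] mult.assoc ..
    also have "\<dots> = ?ra" unfolding inv neg by simp
    finally show ?thesis
      unfolding if_not_P[OF False] by (rule sym)
  qed
qed

text \<open>Strict increase down a column turns the bound 0 at its bottom into the sharper bounds
  above, so the target bounds describe the same tableaux as the zero bound.\<close>

lemma frob_base:
  assumes k: "decreasing q k" and k': "decreasing q k'"
  shows "J (frob q k k') (frob_bound (\<lambda>_. 0) (\<lambda>c. - 0 - int (k' c))) \<mu> =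
    (if is_partition \<mu> \<and> cells \<mu> = frob q k k' then 1 else 0)"
proof -
  let ?D = "frob q k k'" and ?B = "frob_bound (\<lambda>_. 0) (\<lambda>c. - 0 - int (k' c))"
  note D = young_frob[OF k k']
  have "tableaux ?D ?B = tableaux ?D (\<lambda>_. 0)"
  proof (rule equalityI)
    show "tableaux ?D ?B \<subseteq> tableaux ?D (\<lambda>_. 0)"
    proof (rule tableaux_bound_mono)
      fix r c assume "(r, c) \<in> ?D"
      then show "?B (r, c) \<le> 0" using frob_lower[of r c q k k'] by (auto simp: frob_bound_def)
    qed
    show "tableaux ?D (\<lambda>_. 0) \<subseteq> tableaux ?D ?B"
    proof
      fix T assume T: "T \<in> tableaux ?D (\<lambda>_. 0)"
      show "T \<in> tableaux ?D ?B"
      proof (rule tableauxI[OF tableauxD(1)[OF T]])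
        fix v assume v: "v \<in> ?D"
        obtain r c where rc: "v = (r, c)" by force
        have le: "Max (T v) \<le> 0" by (rule tableauxD(2)[OF T v])
        show "Max (T v) \<le> ?B v"
        proof (cases "r < c")
          case True
          then show ?thesis using le rc by (simp add: frob_bound_def)
        next
          case False
          have r: "1 \<le> c" "c \<le> q" "r \<le> c + k' c"
            using frob_lower[of r c q k k'] frob_upper[of r c q k k'] v rc False by (cases "r = c"; auto)+
          then have u: "(c + k' c, c) \<in> ?D" by (intro frob_lowerI) auto
          have "Max (T (r, c)) + (int (c + k' c) - int r) \<le> Max (T (c + k' c, c))"
            using v rc r by (intro ssvt_mono[OF D tableauxD(1)[OF T] _ u]) auto
          also have "\<dots> \<le> 0" by (rule tableauxD(2)[OF T u])
          finally show ?thesis using False le rc by (auto simp: frob_bound_def)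
        qed
      qed
    qed
  qed
  then show ?thesis using J_cong J_base[OF D] by metis
qed

section \<open>Positivity\<close>

lemma positive_sum_0: "positive_sum once twice 0"
  unfolding positive_sum_def by (rule exI[where x = "[]"]) simp

lemma positive_sum_add:
  assumes "positive_sum once twice f" "positive_sum once twice g"
  shows "positive_sum once twice (f + g)"
proof -
  obtain ts us where "\<forall>(k, M) \<in> set ts. admissible once twice M" "f = (\<Sum>t \<leftarrow> ts. product_value t)"
    "\<forall>(k, M) \<in> set us. admissible once twice M" "g = (\<Sum>t \<leftarrow> us. product_value t)"
    using assms unfolding positive_sum_def by blast
  then show ?thesis
    unfolding positive_sum_def by (intro exI[where x = "ts @ us"]) auto
qed

lemma positive_sum_sum:
  "(\<And>i. i \<in> I \<Longrightarrow> positive_sum once twice (f i)) \<Longrightarrow> positive_sum once twice (\<Sum>i \<in> I. f i)"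
  by (induction I rule: infinite_finite_induct) (auto simp: positive_sum_0 intro: positive_sum_add)

lemma positive_sum_sum_list:
  "(\<And>t. t \<in> set ts \<Longrightarrow> positive_sum once twice (f t)) \<Longrightarrow> positive_sum once twice (\<Sum>t \<leftarrow> ts. f t)"
  by (induction ts) (auto simp: positive_sum_0 intro: positive_sum_add)

text \<open>Translates reflected labels of the leg side back into the y-indices of
  \<open>lower_weight\<close>.\<close>

definition reflect :: "int \<times> int \<Rightarrow> int \<times> int"
  where "reflect = (\<lambda>(a, b). (1 - b, 1 - a))"

lemma inj_reflect: "inj reflect"
  by (auto simp: inj_def reflect_def)

text \<open>Either factor contributes a pair at most once, so multiplicity two occurs only for pairs
  available from both sides; the last assumption confines these to \<open>twice\<close>.\<close>

lemma positive_sum_mult: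
  assumes x: "x \<in> positive_span beta upper_weight A" and y: "y \<in> positive_span beta lower_weight A'"
    and ok: "\<And>u. u \<in> A \<union> reflect ` A' \<Longrightarrow> twice u \<or> once u \<and> \<not> (u \<in> A \<and> u \<in> reflect ` A')"
  shows "positive_sum once twice (x * y)"
proof -
  obtain ts where ts: "\<forall>(n, S) \<in> set ts. finite S \<and> S \<subseteq> A"
    "x = (\<Sum>(n, S) \<leftarrow> ts. beta ^ n * (\<Prod>(a, b) \<in> S. upper_weight a b))"
    using x unfolding positive_span_def by blast
  obtain us where us: "\<forall>(n, S) \<in> set us. finite S \<and> S \<subseteq> A'"
    "y = (\<Sum>(n, S) \<leftarrow> us. beta ^ n * (\<Prod>(a, b) \<in> S. lower_weight a b))"
    using y unfolding positive_span_def by blast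
  have "positive_sum once twice ((beta ^ n * (\<Prod>(a, b) \<in> S. upper_weight a b)) *
      (beta ^ n' * (\<Prod>(a, b) \<in> S'. lower_weight a b)))" (is "positive_sum _ _ ?z")
    if S: "finite S" "S \<subseteq> A" and S': "finite S'" "S' \<subseteq> A'" for n n' S S'
  proof -
    define M where "M = mset_set S + mset_set (reflect ` S')"
    have "(\<Prod>(a, b) \<in> S'. lower_weight a b) = (\<Prod>(a, b) \<in> reflect ` S'. upper_weight a b)"
      by (subst prod.reindex[OF inj_on_subset[OF inj_reflect subset_UNIV]])
        (auto simp: reflect_def lower_weight_def upper_weight_def intro!: prod.cong)
    then have "?z = beta ^ (n + n') *
        ((\<Prod>(a, b) \<in> S. upper_weight a b) * (\<Prod>(a, b) \<in> reflect ` S'. upper_weight a b))"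
      by (simp add: power_add ac_simps)
    also have "\<dots> = product_value (n + n', M)"
      by (simp add: product_value_def M_def upper_weight_def[abs_def] prod_unfold_prod_mset)
    finally have "?z = product_value (n + n', M)" .
    moreover have "admissible once twice M"
      unfolding admissible_def
    proof
      fix u assume "u \<in># M"
      then have u: "u \<in> A \<union> reflect ` A'"
        using S S' by (auto simp: M_def)
      have count: "count M u = (if u \<in> S then 1 else 0) + (if u \<in> reflect ` S' then 1 else 0)"
        using S S' by (simp add: M_def count_mset_set')
      have "count M u \<le> 1" if "\<not> (u \<in> A \<and> u \<in> reflect ` A')"
        unfolding count using that S S' by auto
      moreover have "count M u \<le> 2" unfolding count by auto
      ultimately show "once u \<and> count M u \<le> 1 \<or> twice u \<and> count M u \<le> 2"
        using ok[OF u] by blast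
    qed
    ultimately show ?thesis
      unfolding positive_sum_def by (intro exI[where x = "[(n + n', M)]"]) simp
  qed
  note summand = this
  have "x * y = (\<Sum>t \<leftarrow> ts. \<Sum>s \<leftarrow> us. (case t of (n, S) \<Rightarrow> beta ^ n * (\<Prod>(a, b) \<in> S. upper_weight a b)) *
      (case s of (n', S') \<Rightarrow> beta ^ n' * (\<Prod>(a, b) \<in> S'. lower_weight a b)))"
    unfolding ts(2) us(2) by (simp add: sum_list_const_mult sum_list_mult_const)
  also have "positive_sum once twice \<dots>"
  proof (intro positive_sum_sum_list)
    fix t s assume t: "t \<in> set ts" and s: "s \<in> set us"
    obtain n S n' S' where eq: "t = (n, S)" "s = (n', S')" by force
    have "finite S \<and> S \<subseteq> A" "finite S' \<and> S' \<subseteq> A'" using ts(1) us(1) t s eq by auto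
    then show "positive_sum once twice
        ((case t of (n, S) \<Rightarrow> beta ^ n * (\<Prod>(a, b) \<in> S. upper_weight a b)) *
         (case s of (n', S') \<Rightarrow> beta ^ n' * (\<Prod>(a, b) \<in> S'. lower_weight a b)))"
      unfolding eq case_prod_conv by (intro summand) auto
  qed
  finally show ?thesis .
qed

section \<open>From flagged tableaux to the two sides of the diagonal\<close>

lemma j_coeff_eq_J: "j_coeff lam \<phi> \<mu> = J (cells lam) (\<lambda>(r, c). \<phi> ! (r - 1)) \<mu>"
proof -
  have "{T \<in> ssvt (cells lam). \<forall>(r, c) \<in> cells lam. Max (T (r, c)) \<le> \<phi> ! (r - 1)} =
      tableaux (cells lam) (\<lambda>(r, c). \<phi> ! (r - 1))"
    by (simp add: tableaux_def case_prod_beta)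
  then have "G_flagged lam \<phi> = G (cells lam) (\<lambda>(r, c). \<phi> ! (r - 1))"
    by (simp add: G_flagged_def G_def)
  then show ?thesis
    by (simp add: j_coeff_def a_coeff_def J_def is_expansion_def expansion_of_def)
qed

text \<open>The arms are expanded with the legs fixed, then the legs for each resulting arm shape
  \<open>m\<close>. The same \<open>C'\<close> works for every \<open>m\<close>, as each
  \<open>m\<close> merely supplies another solution of the exchange rules.\<close>

lemma frob_expansion:
  assumes upper: "nested q k p" and lower: "nested q k' p'"
    and C: "expands True beta upper_weight q k p A C"
    and C': "expands True beta lower_weight q k' p' A' C'"
  shows "J (frob q k k') (frob_bound p (\<lambda>c. - p' c - int (k' c))) \<mu> =
    (\<Sum>m \<in> smaller_shapes q k. \<Sum>m' \<in> smaller_shapes q k'.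
      C m * C' m' * (if is_partition \<mu> \<and> cells \<mu> = frob q m m' then 1 else 0))"
proof -
  let ?f = "\<lambda>c. - p' c - int (k' c)"
  have dec: "decreasing q m" if "m \<in> smaller_shapes q l" for m l
    using that by (simp add: smaller_shapes_def decreasing_def)
  have "J (frob q k k') (frob_bound p ?f) \<mu> =
      (\<Sum>m \<in> smaller_shapes q k. C m * J (frob q m k') (frob_bound (\<lambda>_. 0) ?f) \<mu>)"
    using C upper_exchange_rules[OF nested_decreasing[OF lower], of ?f \<mu>] unfolding expands_def by blast
  also have "\<dots> = (\<Sum>m \<in> smaller_shapes q k. C m * (\<Sum>m' \<in> smaller_shapes q k'. C' m' *
      J (frob q m m') (frob_bound (\<lambda>_. 0) (\<lambda>c. - 0 - int (m' c))) \<mu>))"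
  proof (intro sum.cong refl arg_cong2[where f = "(*)"])
    fix m assume "m \<in> smaller_shapes q k"
    then have "decreasing q m" by (rule dec)
    from lower_exchange_rules[OF this, of "\<lambda>_. 0" \<mu>] show "J (frob q m k') (frob_bound (\<lambda>_. 0) ?f) \<mu> = (\<Sum>m' \<in> smaller_shapes q k'. C' m' *
        J (frob q m m') (frob_bound (\<lambda>_. 0) (\<lambda>c. - 0 - int (m' c))) \<mu>)"
      using C' unfolding expands_def by blast
  qed
  also have "\<dots> = (\<Sum>m \<in> smaller_shapes q k. C m * (\<Sum>m' \<in> smaller_shapes q k'. C' m' *
      (if is_partition \<mu> \<and> cells \<mu> = frob q m m' then 1 else 0)))"
    using frob_base[OF dec dec] by (intro sum.cong refl arg_cong2[where f = "(*)"])
  finally show ?thesis by (simp add: sum_distrib_left mult.assoc)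
qed

text \<open>
  The flag bounds the rows meeting the diagonal directly.  Column \<open>c \<le> q\<close>, ending in row \<open>h c\<close>, gets the bound on
  its y-indices implied by the flag, raised where necessary to make these bounds increasing.  Raising is
  harmless, since it only concerns columns that do not end at a corner.
\<close>

lemma flagged_to_frob:
  fixes lam :: "nat list" and \<phi> :: "int list"
  assumes lam: "is_partition lam" "lam \<noteq> []" and flag: "is_flag lam \<phi>" and comp: "compatible lam \<phi>"
  defines "q \<equiv> durfee lam"
  obtains k k' f p where "1 \<le> q" "nested q k f" "nested q k' p" "f q = \<phi> ! (q - 1)"
    "\<phi> ! (q - 1) \<ge> 0 \<Longrightarrow> p q \<le> 0"
    "\<And>\<mu>. j_coeff lam \<phi> \<mu> = J (frob q k k') (frob_bound f (\<lambda>c. - p c - int (k' c))) \<mu>"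
proof -
  let ?D = "cells lam"
  define l where "l = length lam"
  note D = young_cells[OF lam(1)]
  note fin = youngD(1)[OF D]
  have mem: "(r, c) \<in> ?D \<longleftrightarrow> 1 \<le> r \<and> r \<le> l \<and> 1 \<le> c \<and> c \<le> lam ! (r - 1)" for r c
    by (simp add: cells_def l_def)
  have "finite {i. (i, i) \<in> ?D}"
    by (rule finite_subset[of _ "fst ` ?D"]) (use fin in force)+
  moreover have "(1, 1) \<in> ?D"
    using lam partition_nth_pos[OF lam(1), of 0] by (simp add: mem l_def Suc_le_eq)
  ultimately have q: "(q, q) \<in> ?D" "1 \<le> q" and q_max: "\<And>i. (i, i) \<in> ?D \<Longrightarrow> i \<le> q"
    using Max_in[of "{i. (i, i) \<in> ?D}"] Max_ge[of "{i. (i, i) \<in> ?D}"] unfolding q_def durfee_def by blast+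
  have square: "(r, c) \<in> ?D" if "1 \<le> r" "r \<le> q" "1 \<le> c" "c \<le> q" for r c
    using youngD(3)[OF D q(1), of r c] that by blast
  have beyond: "min r c \<le> q" if "(r, c) \<in> ?D" for r c
    using youngD(3)[OF D that, of "min r c" "min r c"] youngD(2)[OF D that] q_max by simp
  define h where "h c = card {r. (r, c) \<in> ?D}" for c
  have h: "(r, c) \<in> ?D \<longleftrightarrow> 1 \<le> r \<and> r \<le> h c" if "1 \<le> c" for r c
  proof -
    have "finite {r. (r, c) \<in> ?D}"
      by (rule finite_subset[of _ "fst ` ?D"]) (use fin in force)+
    then have "{r. (r, c) \<in> ?D} = {1..card {r. (r, c) \<in> ?D}}"
      using youngD(2)[OF D] youngD(3)[OF D, of _ c _ c] that by (intro initial_segment) blast+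
    then have "r \<in> {r. (r, c) \<in> ?D} \<longleftrightarrow> r \<in> {1..h c}" unfolding h_def by (rule arg_cong)
    then show ?thesis by simp
  qed
  have hq: "q \<le> h c" if "1 \<le> c" "c \<le> q" for c
    using h[OF that(1), of q] square[of q c] that q by simp
  have hl: "h c \<le> l" "(h c, c) \<in> ?D" "c \<le> lam ! (h c - 1)" if "1 \<le> c" "c \<le> q" for c
    using h[OF that(1), of "h c"] hq[OF that] q mem[of "h c" c] by auto
  have h_anti: "h (Suc c) \<le> h c" if "1 \<le> c" "Suc c \<le> q" for c
    using h[of c "h (Suc c)"] youngD(3)[OF D hl(2)[of "Suc c"], of "h (Suc c)" c] hq[of "Suc c"] q that by simp
  have row: "q \<le> lam ! (i - 1)" if "1 \<le> i" "i \<le> q" for i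
    using square[of i q] mem[of i q] that q by simp
  have ql: "q \<le> l" using q mem by blast
  define f where "f i = \<phi> ! (i - 1)" for i
  \<comment> \<open>The largest y-index allowed at the end of row \<open>i\<close>; compatibility of
    the flag says exactly that it decreases weakly.\<close>
  define psi where "psi i = f i + int (lam ! (i - 1)) - int i" for i
  have f_mono: "f i \<le> f j" if "1 \<le> i" "i \<le> j" "j \<le> l" for i j
    using flag that unfolding is_flag_def f_def l_def by (intro sorted_nth_mono) auto
  have psi_step: "psi (Suc i) \<le> psi i" if "1 \<le> i" "i < l" for i
    using comp that unfolding compatible_def psi_def f_def l_def by fastforce
  have psi_anti: "psi j \<le> psi i" if "1 \<le> i" "i \<le> j" "j \<le> l" for i j
    using that(2,3)
  proof (induction j rule: dec_induct)
    case (step n)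
    then show ?case using psi_step[of n] that(1) by simp
  qed simp
  define k where "k i = lam ! (i - 1) - i" for i
  define k' where "k' c = h c - c" for c
  \<comment> \<open>The second argument of the maximum is the \<open>psi\<close> value of the first
    row below column \<open>c\<close>. It dominates \<open>f'\<close> for all longer columns to the
    left, which makes \<open>f'\<close> increase.\<close>
  define f' where "f' c = (if h c < l then max (f (h c) + int c - int (h c)) (psi (Suc (h c)))
    else f (h c) + int c - int (h c))" for c
  define p where "p c = - f' c - int (k' c)" for c
  have f'_p: "(\<lambda>c. - p c - int (k' c)) = f'" by (simp add: p_def)
  have ki: "int (k i) = int (lam ! (i - 1)) - int i" if "1 \<le> i" "i \<le> q" for i
    using row[OF that] that by (simp add: k_def of_nat_diff)
  have k'c: "int (k' c) = int (h c) - int c" if "1 \<le> c" "c \<le> q" for c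
    using hq[OF that] that by (simp add: k'_def of_nat_diff)
  have f'_ge: "f (h c) + int c - int (h c) \<le> f' c" for c by (simp add: f'_def)
  have frob: "?D = frob q k k'"
  proof (intro set_eqI)
    fix u :: "nat \<times> nat"
    obtain r c where rc: "u = (r, c)" by force
    show "u \<in> ?D \<longleftrightarrow> u \<in> frob q k k'"
    proof (cases "r \<le> c")
      case True
      have "(r, c) \<in> ?D \<longleftrightarrow> 1 \<le> r \<and> r \<le> q \<and> c \<le> lam ! (r - 1)"
        using mem[of r c] beyond[of r c] True ql by auto
      also have "\<dots> \<longleftrightarrow> (r, c) \<in> frob q k k'"
        using True row[of r] by (auto simp: frob_def k_def)
      finally show ?thesis using rc by simp
    next
      case False
      have "(r, c) \<in> ?D \<longleftrightarrow> 1 \<le> c \<and> c \<le> q \<and> r \<le> h c"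
        using h[of c r] beyond[of r c] youngD(2)[OF D, of r c] False by (cases "1 \<le> c") auto
      also have "\<dots> \<longleftrightarrow> (r, c) \<in> frob q k k'"
        using False hq[of c] by (auto simp: frob_def k'_def)
      finally show ?thesis using rc by simp
    qed
  qed
  have upper: "nested q k f"
    unfolding nested_def
  proof (intro allI impI conjI)
    fix i assume i: "1 \<le> i \<and> i < q"
    then have i': "1 \<le> i" "i < l" "i \<le> q" "Suc i \<le> q" using ql by auto
    have "lam ! (Suc i - 1) \<le> lam ! (i - 1)"
      using i' by (intro partition_nth_antimono[OF lam(1)]) (auto simp: l_def)
    then show "k (Suc i) < k i" using row[of "Suc i"] i' by (simp add: k_def)
    show "f i \<le> f (Suc i)" using i' by (intro f_mono) auto
    show "f (Suc i) + int (k (Suc i)) \<le> f i + int (k i)"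
      using psi_step[OF i'(1,2)] ki[of i] ki[of "Suc i"] i' by (simp add: psi_def)
  qed
  have lower: "nested q k' p"
    unfolding nested_def
  proof (intro allI impI)
    fix c assume c: "1 \<le> c \<and> c < q"
    then have c': "1 \<le> c" "c \<le> q" "Suc c \<le> q" by auto
    let ?a = "h c" and ?b = "h (Suc c)"
    have ba: "?b \<le> ?a" by (rule h_anti[OF c'(1,3)])
    have b1: "1 \<le> ?b" "Suc c \<le> ?b" using hq[of "Suc c"] c' by auto
    have al: "?a \<le> l" by (rule hl(1)[OF c'(1,2)])
    have psi_a: "f ?a + int c - int ?a \<le> psi ?a"
      using hl(3)[OF c'(1,2)] by (simp add: psi_def)
    have f'_psi: "f' c \<le> psi ?a"
      using psi_a psi_step[of ?a] ba b1 by (auto simp: f'_def)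
    have 1: "f' c \<le> f' (Suc c)"
    proof (cases "?a = ?b")
      case True
      then show ?thesis by (auto simp: f'_def)
    next
      case False
      then have "psi ?a \<le> psi (Suc ?b)" using ba b1 al by (intro psi_anti) auto
      moreover have "psi (Suc ?b) \<le> f' (Suc c)" using False ba al by (simp add: f'_def)
      ultimately show ?thesis using f'_psi by simp
    qed
    have 2: "f' (Suc c) + int ?b - int (Suc c) \<le> f' c + int ?a - int c"
    proof (cases "?a = ?b")
      case True
      then show ?thesis by (auto simp: f'_def)
    next
      case False
      then have lt: "?b < ?a" using ba by simp
      \<comment> \<open>Row \<open>Suc ?b\<close> ends exactly in column \<open>c\<close>. So
        \<open>psi (Suc ?b)\<close> is expressed through \<open>f (Suc ?b)\<close>, and the
        monotonicity of the flag suffices.\<close>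
      have "(Suc ?b, c) \<in> ?D" using h[of c "Suc ?b"] c' lt by simp
      moreover have "(Suc ?b, Suc c) \<notin> ?D" using h[of "Suc c" "Suc ?b"] by simp
      ultimately have "lam ! (Suc ?b - 1) = c" using mem[of "Suc ?b" c] mem[of "Suc ?b" "Suc c"] by auto
      moreover have "f ?b \<le> f ?a" "f (Suc ?b) \<le> f ?a" using lt b1 al by (auto intro: f_mono)
      ultimately show ?thesis using f'_ge[of c] lt al by (auto simp: f'_def psi_def)
    qed
    have "k' (Suc c) < k' c" using ba b1 by (simp add: k'_def)
    then show "k' (Suc c) < k' c \<and> p c \<le> p (Suc c) \<and> p (Suc c) + int (k' (Suc c)) \<le> p c + int (k' c)"
      using 1 2 k'c[of c] k'c[of "Suc c"] c' by (simp add: p_def)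
  qed
  have sub1: "tableaux ?D (\<lambda>(r, c). f r) \<subseteq> tableaux ?D (frob_bound f f')"
  proof
    fix T assume T: "T \<in> tableaux ?D (\<lambda>(r, c). f r)"
    show "T \<in> tableaux ?D (frob_bound f f')"
    proof (rule tableauxI[OF tableauxD(1)[OF T]])
      fix v assume v: "v \<in> ?D"
      obtain r c where rc: "v = (r, c)" by force
      have le: "Max (T v) \<le> f r" using tableauxD(2)[OF T v] rc by simp
      show "Max (T v) \<le> frob_bound f f' v"
      proof (cases "r < c")
        case True
        then show ?thesis using le rc by (simp add: frob_bound_def)
      next
        case False
        have c: "1 \<le> c" "c \<le> q" using v rc youngD(2)[OF D, of r c] beyond[of r c] False by auto
        have rh: "r \<le> h c" using h[OF c(1)] v rc by simp
        have "Max (T (r, c)) + (int (h c) - int r) \<le> Max (T (h c, c))"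
          using v rc rh by (intro ssvt_mono[OF D tableauxD(1)[OF T] _ hl(2)[OF c]]) auto
        also have "\<dots> \<le> f (h c)" using tableauxD(2)[OF T hl(2)[OF c]] by simp
        finally show ?thesis using f'_ge[of c] le rc False by (auto simp: frob_bound_def)
      qed
    qed
  qed
  have sub2: "tableaux ?D (frob_bound f f') \<subseteq> tableaux ?D (\<lambda>(r, c). f r)"
  proof
    fix T assume T: "T \<in> tableaux ?D (frob_bound f f')"
    show "T \<in> tableaux ?D (\<lambda>(r, c). f r)"
    proof (rule tableauxI[OF tableauxD(1)[OF T]])
      fix v assume v: "v \<in> ?D"
      obtain r c where rc: "v = (r, c)" by force
      have r1: "1 \<le> r" "r \<le> l" "1 \<le> c" "c \<le> lam ! (r - 1)" using v rc mem by auto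
      have row_le: "Max (T (r, c)) \<le> Max (T (r, d))" if "(r, d) \<in> ?D" "c \<le> d" for d
        using ssvt_mono[OF D tableauxD(1)[OF T], of r c r d] v rc that by simp
      consider "r \<le> c" | "c < r" "r \<le> q" | "q < r" using beyond[of r c] v rc by linarith
      then have "Max (T (r, c)) \<le> f r"
      proof cases
        case 1
        then show ?thesis using tableauxD(2)[OF T v] rc by (auto simp: frob_bound_def split: if_splits)
      next
        case 2
        have u: "(r, r) \<in> ?D" using 2 r1 by (intro square) auto
        have "Max (T (r, r)) \<le> f r" using tableauxD(2)[OF T u] by (simp add: frob_bound_def)
        then show ?thesis using row_le[OF u] 2 by simp
      next
        case 3
        \<comment> \<open>Below the square the bound comes from the corner \<open>(m, d)\<close>
          closing the block of rows of length \<open>d\<close>. There \<open>f'\<close> is not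
          raised, as \<open>psi\<close> decreases; climbing back \<open>m - r\<close> rows gains as
          much as the flag can have grown between rows of equal length.\<close>
        define d where "d = lam ! (r - 1)"
        define m where "m = h d"
        have rd: "(r, d) \<in> ?D" using r1 by (simp add: mem d_def)
        have d: "1 \<le> d" "d \<le> q" using beyond[OF rd] 3 r1 by (auto simp: d_def)
        have rm: "r \<le> m" using h[OF d(1)] rd by (simp add: m_def)
        have u: "(m, d) \<in> ?D" and ml: "m \<le> l" and dm: "d \<le> lam ! (m - 1)"
          using hl[OF d] by (auto simp: m_def)
        have "lam ! (m - 1) \<le> lam ! (r - 1)"
          using rm r1 ml by (intro partition_nth_antimono[OF lam(1)]) (auto simp: l_def)
        then have lm: "lam ! (m - 1) = d" using dm by (simp add: d_def)
        have f'd: "f' d = f m + int d - int m"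
          using psi_step[of m] rm r1 lm by (auto simp: f'_def m_def[symmetric] psi_def)
        have "Max (T (m, d)) \<le> f m"
          using tableauxD(2)[OF T u] f'd 3 d rm by (auto simp: frob_bound_def)
        moreover have "Max (T (r, d)) + (int m - int r) \<le> Max (T (m, d))"
          using rm by (intro ssvt_mono[OF D tableauxD(1)[OF T] rd u]) auto
        moreover have "f m - (int m - int r) \<le> f r"
          using psi_anti[OF r1(1) rm ml] lm by (simp add: psi_def d_def)
        moreover have "Max (T (r, c)) \<le> Max (T (r, d))" using r1 by (intro row_le[OF rd]) (simp add: d_def)
        ultimately show ?thesis by linarith
      qed
      then show "Max (T v) \<le> (case v of (r, c) \<Rightarrow> f r)" using rc by simp
    qed
  qed
  show ?thesis
  proof (rule that[OF q(2) upper lower])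
    show "f q = \<phi> ! (q - 1)" by (simp add: f_def)
    show "p q \<le> 0" if "\<phi> ! (q - 1) \<ge> 0"
    proof -
      \<comment> \<open>Column \<open>q\<close> reaches row \<open>h q\<close>, at or below row
        \<open>q\<close>, where the flag is no smaller.\<close>
      have "f q \<le> f (h q)" using hq[of q] hl(1)[of q] q by (intro f_mono) auto
      moreover have "0 \<le> f q" using that by (simp add: f_def)
      ultimately show ?thesis using f'_ge[of q] k'c[of q] q by (simp add: p_def)
    qed
    show "j_coeff lam \<phi> \<mu> = J (frob q k k') (frob_bound f (\<lambda>c. - p c - int (k' c))) \<mu>" for \<mu>
    proof -
      have "J ?D (\<lambda>(r, c). f r) = J ?D (frob_bound f f')"
        by (rule J_cong) (rule equalityI[OF sub1 sub2])
      then show ?thesis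
        unfolding f'_p frob[symmetric] j_coeff_eq_J f_def[symmetric] by (rule fun_cong)
    qed
  qed
qed

theorem theorem4p7:
  fixes lam \<rho> :: "nat list" and \<phi> :: "int list" and q :: nat
  assumes "is_partition lam" and "lam \<noteq> []"
    and "is_flag lam \<phi>" and "compatible lam \<phi>"
    and "is_partition \<rho>" and "cells \<rho> \<subseteq> cells lam"
    and "j_coeff lam \<phi> \<rho> \<noteq> 0"
    and "q = durfee lam"
  shows "(\<phi> ! (q - 1) \<le> 0 \<longrightarrow> positive_sum type2 type3 (j_coeff lam \<phi> \<rho>)) \<and>
         (\<phi> ! (q - 1) \<ge> 0 \<longrightarrow> positive_sum type1 type3 (j_coeff lam \<phi> \<rho>))"
proof -
  obtain k k' f p where fr: "1 \<le> q" "nested q k f" "nested q k' p" "f q = \<phi> ! (q - 1)"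
    "\<phi> ! (q - 1) \<ge> 0 \<Longrightarrow> p q \<le> 0"
    "\<And>\<mu>. j_coeff lam \<phi> \<mu> = J (frob q k k') (frob_bound f (\<lambda>c. - p c - int (k' c))) \<mu>"
    using flagged_to_frob[OF assms(1-4)] unfolding assms(8) by metis
  obtain C where C: "expands True beta upper_weight q k f (type_1_pairs \<union> type_3_pairs) C"
    "f q \<le> 0 \<Longrightarrow> expands True beta upper_weight q k f type_3_pairs C"
    using nested_expansion[OF upper_system fr(2,1)] by metis
  obtain C' where C': "expands True beta lower_weight q k' p (type_1_pairs \<union> type_3_pairs) C'"
    "p q \<le> 0 \<Longrightarrow> expands True beta lower_weight q k' p type_3_pairs C'"
    using nested_expansion[OF lower_system fr(3,1)] by metis
  have pos: "positive_sum once type3 (j_coeff lam \<phi> \<rho>)"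
    if A: "expands True beta upper_weight q k f A C" and A': "expands True beta lower_weight q k' p A' C'"
      and ok: "\<And>u. u \<in> A \<union> reflect ` A' \<Longrightarrow> type3 u \<or> once u \<and> \<not> (u \<in> A \<and> u \<in> reflect ` A')"
    for A A' once
    unfolding fr(6) frob_expansion[OF fr(2,3) A A']
  proof (intro positive_sum_sum)
    fix m m'
    have "positive_sum once type3 (C m * C' m')"
      using A A' ok by (intro positive_sum_mult[where A = A and A' = A']) (auto simp: expands_def)
    then show "positive_sum once type3
        (C m * C' m' * (if is_partition \<rho> \<and> cells \<rho> = frob q m m' then 1 else 0))"
      by (simp add: positive_sum_0)
  qed
  \<comment> \<open>The sign of the flag at row \<open>q\<close> decides which side is confined to
    Type 3: the arms if it is at most 0, the legs if it is at least 0. The remaining type then comes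
    from the other side alone, hence at most once, whereas Type 3 may come from both.\<close>
  show ?thesis
  proof (intro conjI impI)
    assume "\<phi> ! (q - 1) \<le> 0"
    then have "f q \<le> 0" using fr(4) by simp
    then show "positive_sum type2 type3 (j_coeff lam \<phi> \<rho>)"
      by (intro pos[OF C(2) C'(1)])
        (auto simp: type_1_pairs_def type_3_pairs_def type2_def type3_def reflect_def)
  next
    assume "\<phi> ! (q - 1) \<ge> 0"
    then have "p q \<le> 0" by (rule fr(5))
    then show "positive_sum type1 type3 (j_coeff lam \<phi> \<rho>)"
      by (intro pos[OF C(1) C'(2)])
        (auto simp: type_1_pairs_def type_3_pairs_def type1_def type3_def reflect_def)
  qed
qed

end
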